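(* Let $m\in\mathbb{N}$. For every $\varepsilon>0$ there exists a constant $c_\varepsilon$ (independent of $u$) such that for every $u\in H^1(\mathbb{S}^2)$ satisfying $\int_{\mathbb{S}^2}u\,d\mu=0$ and $\int_{\mathbb{S}^2}p\,e^{2u}\,d\mu=0$ for every $p\in\overset{\circ}{\mathcal{P}}_m$, one has $$\log\int_{\mathbb{S}^2}e^{2u}\,d\mu\le\left(\frac{1}{4\pi N_m}+\varepsilon\right)\|\nabla u\|_{L^2(\mathbb{S}^2)}^2+c_\varepsilon .$$
   Context: $\mathbb{N}$ denotes the positive integers. $\mathbb{S}^2\subset\mathbb{R}^3$ is the unit sphere with its standard round metric and $\mu$ is its standard area measure (total mass $4\pi$). $H^1(\mathbb{S}^2)$ is the Sobolev space of real-valued $L^2$ functions with weak gradient in $L^2$. For a nonnegative integer $k$, $\mathcal{P}_k$ is the set of all (real) polynomials on $\mathbb{R}^3$ of degree at most $k$, and $\overset{\circ}{\mathcal{P}}_k=\{p\in\mathcal{P}_k:\int_{\mathbb{S}^2}p\,d\mu=0\}$. For $m\in\mathbb{N}$, $\mathcal{N}_m$ is the set of all $N\in\mathbb{N}$ for which there exist points $x_1,\dots,x_N\in\mathbb{S}^2$ and weights $\nu_1,\dots,\nu_N\in[0,\infty)$ with $\nu_1+\cdots+\nu_N=1$ such that $\nu_1p(x_1)+\cdots+\nu_Np(x_N)=0$ for all $p\in\overset{\circ}{\mathcal{P}}_m$. (Equivalently, $\nu_1p(x_1)+\cdots+\nu_Np(x_N)=\frac{1}{4\pi}\int_{\mathbb{S}^2}p\,d\mu$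 for all $p\in\mathcal{P}_m$.) $N_m=\min\mathcal{N}_m$ is the smallest element of $\mathcal{N}_m$. *)

theory Defs
  imports "HOL-Analysis.Analysis"
begin

section \<open>The area measure of the unit sphere\<close>

abbreviation S2 :: "(real^3) set" where
  "S2 \<equiv> sphere 0 1"

text \<open>Polar coordinates: the area of \<open>A \<subseteq> S2\<close> is three times the volume of the cone
  \<open>{r x | 0 < r < 1, x \<in> A}\<close>, and \<open>sgn x\<close> is the radial projection of \<open>x\<close> to \<open>S2\<close>.\<close>

definition sphere_measure :: "(real^3) measure" where
  "sphere_measure =
     scale_measure 3
       (distr (restrict_space lborel (ball 0 1 - {0})) (restrict_space borel S2) sgn)"

lemma space_sphere_measure [simp]: "space sphere_measure = S2"
  by (simp add: sphere_measure_def space_scale_measure space_restrict_space)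

lemma sets_sphere_measure [simp, measurable_cong]:
  "sets sphere_measure = sets (restrict_space borel S2)"
  by (simp add: sphere_measure_def)

lemma emeasure_sphere_measure:
  assumes "A \<in> sets borel" "A \<subseteq> S2"
  shows "emeasure sphere_measure A = 3 * emeasure lborel {x \<in> ball 0 1 - {0}. sgn x \<in> A}"
proof -
  let ?B = "ball 0 1 - {0 :: real^3}"
  have m: "sgn \<in> measurable (restrict_space lborel ?B) (restrict_space borel S2)"
  proof (rule measurable_restrict_space2)
    show "sgn \<in> space (restrict_space lborel ?B) \<rightarrow> S2"
      by (auto simp: space_restrict_space norm_sgn)
    have "(\<lambda>x :: real^3. x /\<^sub>R norm x) \<in> borel_measurable lborel"
      by measurable
    then show "sgn \<in> borel_measurable (restrict_space lborel ?B)"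
      by (intro measurable_restrict_space1) (simp add: sgn_div_norm[abs_def])
  qed
  have A: "A \<in> sets (restrict_space borel S2)"
    using assms by (auto simp: sets_restrict_space_iff)
  have eq: "sgn -` A \<inter> ?B = {x \<in> ?B. sgn x \<in> A}"
    by auto
  have "emeasure sphere_measure A = 3 * emeasure (restrict_space lborel ?B) (sgn -` A \<inter> ?B)"
    using m A by (simp add: sphere_measure_def emeasure_distr space_restrict_space)
  also have "\<dots> = 3 * emeasure lborel (sgn -` A \<inter> ?B)"
    by (subst emeasure_restrict_space) auto
  finally show ?thesis by (simp add: eq)
qed

lemma emeasure_sphere_measure_total: "emeasure sphere_measure S2 = ennreal (4 * pi)"
proof -
  have "{x \<in> ball 0 1 - {0}. sgn x \<in> S2} = ball 0 1 - {0 :: real^3}"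
    by (auto simp: norm_sgn)
  then have "emeasure sphere_measure S2 = 3 * emeasure lborel (ball 0 1 - {0 :: real^3})"
    by (simp add: emeasure_sphere_measure)
  also have "emeasure lborel (ball 0 1 - {0 :: real^3}) = emeasure lborel (ball (0 :: real^3) 1)"
    by (subst emeasure_Diff) auto
  also have "3 * \<dots> = ennreal (4 * pi)"
    by (simp add: emeasure_ball unit_ball_vol_3 flip: ennreal_numeral ennreal_mult)
  finally show ?thesis .
qed

section \<open>Polynomials and the number \<open>N_m\<close>\<close>

definition exponents :: "nat \<Rightarrow> (3 \<Rightarrow> nat) set" where
  "exponents k = {\<alpha>. (\<Sum>i\<in>UNIV. \<alpha> i) \<le> k}"

lemma finite_exponents: "finite (exponents k)"
proof (rule finite_subset)
  show "exponents k \<subseteq> PiE UNIV (\<lambda>_. {..k})"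
    unfolding exponents_def
  proof
    fix \<alpha> :: "3 \<Rightarrow> nat"
    assume "\<alpha> \<in> {\<alpha>. (\<Sum>i\<in>UNIV. \<alpha> i) \<le> k}"
    moreover have "\<alpha> i \<le> (\<Sum>i\<in>UNIV. \<alpha> i)" for i
      by (rule member_le_sum) auto
    ultimately have "\<alpha> i \<le> k" for i
      by (metis le_trans mem_Collect_eq)
    then show "\<alpha> \<in> PiE UNIV (\<lambda>_. {..k})"
      by (simp add: PiE_iff)
  qed
qed (auto intro: finite_PiE)

definition polys :: "nat \<Rightarrow> (real^3 \<Rightarrow> real) set" where
  "polys k = {p. \<exists>c :: (3 \<Rightarrow> nat) \<Rightarrow> real.
     p = (\<lambda>x. \<Sum>\<alpha>\<in>exponents k. c \<alpha> * (\<Prod>i\<in>UNIV. (x $ i) ^ \<alpha> i))}"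

definition mean_zero_polys :: "nat \<Rightarrow> (real^3 \<Rightarrow> real) set" where
  "mean_zero_polys k = {p \<in> polys k. (LINT x|sphere_measure. p x) = 0}"

definition cubature_sizes :: "nat \<Rightarrow> nat set" where
  "cubature_sizes m = {N. N \<ge> 1 \<and> (\<exists>(x :: nat \<Rightarrow> real^3) (\<nu> :: nat \<Rightarrow> real).
     (\<forall>i\<in>{1..N}. x i \<in> S2 \<and> \<nu> i \<ge> 0) \<and> (\<Sum>i=1..N. \<nu> i) = 1 \<and>
     (\<forall>p\<in>mean_zero_polys m. (\<Sum>i=1..N. \<nu> i * p (x i)) = 0))}"

definition min_cubature_size :: "nat \<Rightarrow> nat" where
  "min_cubature_size m = (LEAST N. N \<in> cubature_sizes m)"

section \<open>The Sobolev space \<open>H\<^sup>1\<close> of the sphere\<close>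

primrec k_times_cont_diff :: "nat \<Rightarrow> (real^3 \<Rightarrow> real^3) \<Rightarrow> bool" where
  "k_times_cont_diff 0 F \<longleftrightarrow> continuous_on UNIV F"
| "k_times_cont_diff (Suc k) F \<longleftrightarrow> (\<forall>x. F differentiable (at x)) \<and>
     (\<forall>v. k_times_cont_diff k (\<lambda>x. frechet_derivative F (at x) v))"

text \<open>Every smooth tangent vector field on \<open>S2\<close> is the restriction of a smooth map on the
  ambient space, so vector fields are represented by such extensions. The weak gradient only
  involves their values on \<open>S2\<close>: for a tangent field, \<open>sphere_div\<close>, the trace of the derivative
  over the tangent plane at \<open>x \<in> S2\<close>, is the Riemannian divergence and does not depend
  on the extension.\<close>

definition smooth_tangent_field :: "(real^3 \<Rightarrow> real^3) \<Rightarrow> bool" where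
  "smooth_tangent_field X \<longleftrightarrow> (\<forall>k. k_times_cont_diff k X) \<and> (\<forall>x\<in>S2. X x \<bullet> x = 0)"

definition sphere_div :: "(real^3 \<Rightarrow> real^3) \<Rightarrow> real^3 \<Rightarrow> real" where
  "sphere_div X x = (\<Sum>b\<in>Basis. frechet_derivative X (at x) b \<bullet> b)
     - frechet_derivative X (at x) x \<bullet> x"

definition has_weak_gradient :: "(real^3 \<Rightarrow> real) \<Rightarrow> (real^3 \<Rightarrow> real^3) \<Rightarrow> bool" where
  "has_weak_gradient u G \<longleftrightarrow>
     G \<in> borel_measurable sphere_measure \<and>
     integrable sphere_measure (\<lambda>x. (norm (G x))\<^sup>2) \<and>
     (\<forall>x\<in>S2. G x \<bullet> x = 0) \<and>
     (\<forall>X. smooth_tangent_field X \<longrightarrow>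
        (LINT x|sphere_measure. u x * sphere_div X x) = - (LINT x|sphere_measure. G x \<bullet> X x))"

text \<open>Elements of \<open>H\<^sup>1\<close> are represented by functions on the ambient space, of which only the
  values on \<open>S2\<close> matter. The weak gradient is unique up to null sets.\<close>

definition sphere_H1 :: "(real^3 \<Rightarrow> real) set" where
  "sphere_H1 = {u \<in> borel_measurable sphere_measure.
     integrable sphere_measure (\<lambda>x. (u x)\<^sup>2) \<and> (\<exists>G. has_weak_gradient u G)}"

definition weak_gradient :: "(real^3 \<Rightarrow> real) \<Rightarrow> real^3 \<Rightarrow> real^3" where
  "weak_gradient u = (SOME G. has_weak_gradient u G)"

end

theory Submission
  imports Defs
begin

text \<open>
Write \<open>E = \<integral>|\<nabla>u|\<^sup>2\<close>. The idea is to test \<open>u\<close> against several probability densities at once and to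
play entropy off against logarithmic energy.

\<^emph>\<open>Entropy.\<close> Let \<open>Z = \<integral>\<^sub>\<Omega> e\<^bsup>2u\<^esup>\<close> and \<open>\<rho> = e\<^bsup>2u\<^esup> 1\<^sub>\<Omega> / Z\<close>. Then \<open>ln Z = 2 \<integral>u \<rho> - \<integral>\<rho> ln \<rho>\<close>, and by the Gibbs
variational principle \<open>\<integral>\<rho> ln \<rho> \<ge> \<integral>\<rho> \<psi> - ln \<integral>e\<^sup>\<psi>\<close> for all \<open>\<psi>\<close>. On a surface \<open>|x - y|\<^bsup>-2t\<^esup>\<close> has bounded
integrals for \<open>t < 1\<close>, so \<open>\<psi>(x) = t ln |x - y|\<^bsup>-2\<^esup>\<close>, averaged over \<open>y\<close> with respect to \<open>\<rho>\<close>, shows that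
the entropy controls \<open>t\<close> times the logarithmic energy \<open>\<integral>\<integral> \<rho>(x) \<rho>(y) ln |x - y|\<^bsup>-2\<^esup>\<close>
(lemma \<open>ln_exp_integral_le_log_energy\<close>).

\<^emph>\<open>Energy.\<close> Integrating the weak gradient against the gradient of the Green function gives
\<open>u \<le> T |\<nabla>u|\<close> for the operator \<open>T\<close> with kernel \<open>1 / (2 \<pi> |x - y|)\<close>, and the kernel of \<open>T\<^sup>2\<close> is at most
\<open>ln |x - y|\<^bsup>-2\<^esup> / (4 \<pi>)\<close> up to an additive constant (lemmas \<open>smoothing_le_riesz_potential\<close> and
\<open>integral_riesz_kernel_product_le\<close>). Let \<open>\<rho>\<^sub>1, \<dots>, \<rho>\<^sub>N\<close> be densities as above on sets \<open>\<Omega>\<^sub>i\<close> that keep a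
positive distance from each other, and let \<open>\<sigma>\<close> be their mean. Then
\<open>2 \<integral>u \<sigma> \<le> 2 \<integral>|\<nabla>u| T\<sigma> \<le> \<gamma> E + \<gamma>\<^bsup>-1\<^esup> \<integral>(T\<sigma>)\<^sup>2\<close>, and up to a constant the last integral is
\<open>1 / (4 \<pi> N\<^sup>2)\<close> times the sum of the \<open>N\<close> self-energies, because the mutual energies are bounded. For
\<open>\<gamma> > 1 / (4 \<pi> N)\<close> the choice \<open>t = 1 / (4 \<pi> \<gamma> N) < 1\<close> makes the self-energies cancel against the
entropies, and the mean of the \<open>N\<close> numbers \<open>ln \<integral>\<^bsub>\<Omega>\<^sub>i\<^esub> e\<^bsup>2u\<^esup>\<close> is at most \<open>\<gamma> E + C\<close>
(lemma \<open>separated_moser_trudinger\<close>). The case of one set also yields that \<open>e\<^bsup>2u\<^esup>\<close> is integrable.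

\<^emph>\<open>Constraints.\<close> If \<open>N - 1\<close> nodes carry no cubature formula, then by compactness a probability density
that annihilates all polynomials of mean zero cannot be concentrated near \<open>N - 1\<close> points
(lemma \<open>concentration_gap\<close>). Choosing balls greedily yields \<open>N\<close> separated balls each carrying a fixed
fraction of the mass of \<open>e\<^bsup>2u\<^esup>\<close> (lemma \<open>separated_heavy_balls\<close>). On these balls
\<open>ln \<integral>\<^bsub>\<Omega>\<^sub>i\<^esub> e\<^bsup>2u\<^esup>\<close> differs from \<open>ln \<integral>e\<^bsup>2u\<^esup>\<close> by a constant at most, which proves the theorem.

All kernels are regularised: \<open>|x - y|\<^sup>2\<close> is replaced by \<open>|x - y|\<^sup>2 + \<delta>\<close>, so that they are bounded and the
test fields are smooth on the whole space. This replaces \<open>u\<close> by a smoothed function, which tends to \<open>u\<close>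
almost everywhere along a sequence \<open>\<delta> \<rightarrow> 0\<close>; the estimates do not depend on \<open>\<delta>\<close>, and Fatou's lemma
transfers them to \<open>u\<close>.
\<close>

section \<open>The distribution of the distance to a point of the sphere\<close>

abbreviation \<mu> :: "(real^3) measure" where
  "\<mu> \<equiv> sphere_measure"

lemma prod_Basis_vec3: "(\<Prod>b\<in>(Basis::(real^3) set). f b) = f (axis 1 1) * f (axis 2 1) * f (axis 3 1)"
proof -
  have B: "(Basis::(real^3) set) = (\<lambda>i. axis i 1) ` {1,2,3}"
    by (auto simp: Basis_vec_def UNIV_3[symmetric])
  have "inj_on (\<lambda>i::3. axis i (1::real)) {1,2,3}"
    by (auto simp: inj_on_def axis_eq_axis)
  then show ?thesis
    unfolding B by (subst prod.reindex) (simp_all add: mult.assoc)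
qed

lemma vector_3_measurable [measurable]:
  "(\<lambda>p::(real \<times> real) \<times> real. vector [fst (fst p), snd (fst p), snd p] :: real^3) \<in> borel_measurable borel"
proof (rule borel_measurable_continuous_onI)
  let ?f = "\<lambda>p::(real \<times> real) \<times> real. (\<chi> i. if i = 1 then fst (fst p) else if i = 2 then snd (fst p) else snd p) :: real^3"
  have "continuous_on UNIV ?f"
    apply (intro continuous_on_vec_lambda)
    subgoal for i by (cases "i = 1"; cases "i = 2") (auto intro!: continuous_on_fst continuous_on_snd continuous_on_id)
    done
  also have "?f = (\<lambda>p::(real \<times> real) \<times> real. vector [fst (fst p), snd (fst p), snd p] :: real^3)"
    by (auto simp: fun_eq_iff vec_eq_iff forall_3)
  finally show "continuous_on UNIV (\<lambda>p::(real \<times> real) \<times> real. vector [fst (fst p), snd (fst p), snd p] :: real^3)" .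
qed

text \<open>This makes slicing by Fubini's theorem available on the type of vectors.\<close>

lemma lborel_vec3: "(lborel :: (real^3) measure) = distr lborel borel (\<lambda>p. vector [fst (fst p), snd (fst p), snd p])"
proof (rule lborel_eqI)
  fix l u :: "real^3" 
  assume lu: "\<And>b. b \<in> Basis \<Longrightarrow> l \<bullet> b \<le> u \<bullet> b"
  have lu': "l $ i \<le> u $ i" for i
    using lu[of "axis i 1"] by (auto simp: inner_axis Basis_vec_def)
  let ?T = "\<lambda>p. vector [fst (fst p), snd (fst p), snd p] :: real^3"
  have "?T -` box l u = ({l$1<..<u$1} \<times> {l$2<..<u$2}) \<times> {l$3<..<u$3}"
    by (auto simp: mem_box_cart forall_3)
  then have "emeasure (distr lborel borel ?T) (box l u) = emeasure (lborel \<Otimes>\<^sub>M lborel) (({l$1<..<u$1} \<times> {l$2<..<u$2}) \<times> {l$3<..<u$3})"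
    by (subst emeasure_distr) (auto simp: lborel_prod)
  also have "\<dots> = emeasure (lborel \<Otimes>\<^sub>M lborel) ({l$1<..<u$1} \<times> {l$2<..<u$2}) * emeasure lborel {l$3<..<u$3}"
    by (subst lborel.emeasure_pair_measure_Times) (auto simp: lborel_prod intro!: borel_open open_Times)
  also have "emeasure (lborel \<Otimes>\<^sub>M lborel) ({l$1<..<u$1} \<times> {l$2<..<u$2}) = ennreal (u$1-l$1) * ennreal (u$2-l$2)"
    by (subst lborel.emeasure_pair_measure_Times) (auto simp: lu')
  also have "\<dots> * emeasure lborel {l$3<..<u$3} = ennreal (\<Prod>b\<in>Basis. (u - l) \<bullet> b)"
    using lu' by (simp add: prod_Basis_vec3 inner_axis flip: ennreal_mult)
  finally show "emeasure (distr lborel borel ?T) (box l u) = ennreal (\<Prod>b\<in>Basis. (u - l) \<bullet> b)" .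
qed simp

text \<open>The slice at height \<open>c\<close> is a disc whose squared radius is \<open>c\<^sup>2 (1 / \<kappa>\<^sup>2 - 1)\<close> on the cone part
  \<open>c < \<kappa>\<close> and \<open>1 - c\<^sup>2\<close> on the cap part. Only lower and upper bounds are assumed for \<open>E\<close>, so that the sector
  with and without its boundary cone are both covered.\<close>

lemma sector_volume:
  fixes E :: "(real^3) set"
  assumes E: "E \<in> sets borel" and k: "0 \<le> \<kappa>" "\<kappa> \<le> 1"
    and 1: "{x \<in> ball 0 1 - {0}. x $ 3 > \<kappa> * norm x} \<subseteq> E" and 2: "E \<subseteq> {x \<in> ball 0 1 - {0}. x $ 3 \<ge> \<kappa> * norm x}"
  shows "emeasure lborel E = ennreal (2 * pi / 3 * (1 - \<kappa>))"
proof -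
  let ?T = "\<lambda>p. vector [fst (fst p), snd (fst p), snd p] :: real^3"
  \<comment> \<open>the squared radius of the slice at height \<open>c\<close>\<close>
  define R where "R c = (if c < \<kappa> then c\<^sup>2 * (1 / \<kappa>\<^sup>2 - 1) else 1 - c\<^sup>2)" for c
  have E': "?T -` E \<in> sets (lborel \<Otimes>\<^sub>M lborel)"
    using measurable_sets[OF vector_3_measurable, of E] E
    by (simp only: lborel_prod sets_lborel space_borel Int_UNIV_right)
  have nT: "norm (?T (p, c)) = sqrt ((norm p)\<^sup>2 + c\<^sup>2)" for p c
    by (cases p) (simp add: norm_vec_def L2_set_def sum_3 norm_Pair)
  have area: "emeasure lborel ((\<lambda>p. (p, c)) -` (?T -` E)) = ennreal (pi * R c) * indicator {0..1} c"
    if c: "c \<noteq> 0" for c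
  proof (cases "0 < c \<and> c < 1")
    case False
    have "(\<lambda>p. (p, c)) -` (?T -` E) = {}"
    proof (rule ccontr)
      assume "\<not> ?thesis"
      then obtain p where "?T (p, c) \<in> E" by auto
      with 2 have "norm (?T (p, c)) < 1" "c \<ge> \<kappa> * norm (?T (p, c))" by auto
      then have "(norm p)\<^sup>2 + c\<^sup>2 < 1" "c \<ge> \<kappa> * sqrt ((norm p)\<^sup>2 + c\<^sup>2)"
        unfolding nT by simp_all
      moreover have "\<kappa> * sqrt ((norm p)\<^sup>2 + c\<^sup>2) \<ge> 0" using k by simp
      ultimately have "0 \<le> c" "c\<^sup>2 < 1" by (auto intro: le_less_trans[rotated])
      then show False using False c by (auto simp: abs_square_less_1)
    qed
    moreover have "ennreal (pi * R c) * indicator {0..1} c = 0"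
      using False c k by (auto simp: indicator_def R_def not_less)
    ultimately show ?thesis by simp
  next
    case c: True
    have R0: "R c \<ge> 0"
      using c k by (auto simp: R_def abs_square_le_1 field_simps power_le_one)
    have R: "R c \<ge> 0 \<and> {p. (norm p)\<^sup>2 < R c} \<subseteq> (\<lambda>p. (p, c)) -` (?T -` E) \<and> (\<lambda>p. (p, c)) -` (?T -` E) \<subseteq> {p. (norm p)\<^sup>2 \<le> R c}"
    proof (intro conjI R0 subsetI)
      fix p :: "real \<times> real" assume "p \<in> {p. (norm p)\<^sup>2 < R c}"
      then have p: "(norm p)\<^sup>2 < R c" by simp
      have n0: "norm (?T (p, c)) > 0"
        unfolding nT using c by (simp add: add_nonneg_pos)
      have "norm (?T (p, c)) < 1 \<and> \<kappa> * norm (?T (p, c)) < c"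
      proof (cases "c < \<kappa>")
        case True
        with p have "(norm p)\<^sup>2 + c\<^sup>2 < (c / \<kappa>)\<^sup>2" 
          by (simp add: R_def field_simps power_divide)
        then have a: "norm (?T (p, c)) < c / \<kappa>"
          unfolding nT using c True by (simp add: real_less_lsqrt)
        moreover have "c / \<kappa> < 1" using True c by simp
        ultimately have "norm (?T (p, c)) < 1" by linarith
        moreover have "\<kappa> * norm (?T (p, c)) < c" using a True c by (simp add: field_simps)
        ultimately show ?thesis by blast
      next
        case False
        with p have "(norm p)\<^sup>2 + c\<^sup>2 < 1" by (simp add: R_def)
        then have a: "norm (?T (p, c)) < 1"
          unfolding nT by simp
        have "\<kappa> * norm (?T (p, c)) < c"
        proof (cases "\<kappa> = 0")
          case f: False
          then have "\<kappa> * norm (?T (p, c)) < \<kappa> * 1" using a k by (intro mult_strict_left_mono) auto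
          then show ?thesis using False by simp
        qed (use c in auto)
        with a show ?thesis by simp
      qed
      then have "?T (p, c) \<in> {x \<in> ball 0 1 - {0}. x $ 3 > \<kappa> * norm x}"
        using n0 by auto
      then show "p \<in> (\<lambda>p. (p, c)) -` (?T -` E)" using 1 by blast
    next
      fix p assume "p \<in> (\<lambda>p. (p, c)) -` (?T -` E)"
      with 2 have p: "norm (?T (p, c)) < 1" "\<kappa> * norm (?T (p, c)) \<le> c" by auto
      have p1: "(norm p)\<^sup>2 + c\<^sup>2 < 1" using p(1) unfolding nT by simp
      have "(norm p)\<^sup>2 \<le> R c"
      proof (cases "c < \<kappa>")
        case True
        have "sqrt ((norm p)\<^sup>2 + c\<^sup>2) \<le> c / \<kappa>" using p(2) True c unfolding nT by (simp add: field_simps)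
        then have "(norm p)\<^sup>2 + c\<^sup>2 \<le> (c / \<kappa>)\<^sup>2"
          by (rule sqrt_le_D)
        then show ?thesis using True by (simp add: R_def field_simps power_divide)
      qed (use p1 in \<open>simp add: R_def\<close>)
      then show "p \<in> {p. (norm p)\<^sup>2 \<le> R c}" by simp
    qed
    have b: "{p::real\<times>real. (norm p)\<^sup>2 < R c} = ball 0 (sqrt (R c))" "{p::real\<times>real. (norm p)\<^sup>2 \<le> R c} = cball 0 (sqrt (R c))"
      using real_sqrt_less_iff[of "(norm (p::real\<times>real))\<^sup>2" "R c" for p] real_sqrt_le_iff[of "(norm (p::real\<times>real))\<^sup>2" "R c" for p]
      by auto
    have m: "(\<lambda>p. (p, c)) -` (?T -` E) \<in> sets lborel"
      using sets_Pair2[OF E'] by simp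
    have v: "emeasure lborel (ball (0::real\<times>real) (sqrt (R c))) = ennreal (pi * R c)"
      "emeasure lborel (cball (0::real\<times>real) (sqrt (R c))) = ennreal (pi * R c)"
      using R0 by (simp_all add: emeasure_cball emeasure_ball unit_ball_vol_2)
    have "emeasure lborel ((\<lambda>p. (p, c)) -` (?T -` E)) = ennreal (pi * R c)"
    proof (rule antisym)
      have "emeasure lborel ((\<lambda>p. (p, c)) -` (?T -` E)) \<le> emeasure lborel (cball (0::real\<times>real) (sqrt (R c)))"
        using R unfolding b by (intro emeasure_mono) auto
      then show "emeasure lborel ((\<lambda>p. (p, c)) -` (?T -` E)) \<le> ennreal (pi * R c)"
        using v by simp
      have "emeasure lborel ((\<lambda>p. (p, c)) -` (?T -` E)) \<ge> emeasure lborel (ball (0::real\<times>real) (sqrt (R c)))"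
        using R m unfolding b by (intro emeasure_mono) auto
      then show "ennreal (pi * R c) \<le> emeasure lborel ((\<lambda>p. (p, c)) -` (?T -` E))"
        using v by simp
    qed
    then show ?thesis using c by simp
  qed
  have "emeasure lborel E = emeasure lborel (?T -` E)"
    by (subst lborel_vec3, subst emeasure_distr) (use E in auto)
  also have "\<dots> = emeasure (lborel \<Otimes>\<^sub>M lborel) (?T -` E)"
    by (simp add: lborel_prod)
  also have "\<dots> = (\<integral>\<^sup>+c. emeasure lborel ((\<lambda>p. (p, c)) -` (?T -` E)) \<partial>lborel)"
    by (rule lborel_pair.emeasure_pair_measure_alt2[OF E'])
  also have "\<dots> = (\<integral>\<^sup>+c. ennreal (pi * (c\<^sup>2 * (1 / \<kappa>\<^sup>2 - 1))) * indicator {0..\<kappa>} c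
       + ennreal (pi * (1 - c\<^sup>2)) * indicator {\<kappa>..1} c \<partial>lborel)"
  proof (rule nn_integral_cong_AE)
    have "AE c in lborel. c \<noteq> (0::real)" "AE c in lborel. c \<noteq> \<kappa>" 
      using AE_lborel_singleton[of "0::real"] AE_lborel_singleton[of \<kappa>] by auto
    then show "AE c in lborel. emeasure lborel ((\<lambda>p. (p, c)) -` (?T -` E)) = ennreal (pi * (c\<^sup>2 * (1 / \<kappa>\<^sup>2 - 1))) * indicator {0..\<kappa>} c
       + ennreal (pi * (1 - c\<^sup>2)) * indicator {\<kappa>..1} c"
    proof eventually_elim
      case (elim c)
      then show ?case using k by (subst area) (auto simp: R_def indicator_def)
    qed
  qed
  also have "\<dots> = (\<integral>\<^sup>+c. ennreal (pi * (c\<^sup>2 * (1 / \<kappa>\<^sup>2 - 1))) * indicator {0..\<kappa>} c \<partial>lborel)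
      + (\<integral>\<^sup>+c. ennreal (pi * (1 - c\<^sup>2)) * indicator {\<kappa>..1} c \<partial>lborel)"
    by (rule nn_integral_add) auto
  also have "(\<integral>\<^sup>+c. ennreal (pi * (c\<^sup>2 * (1 / \<kappa>\<^sup>2 - 1))) * indicator {0..\<kappa>} c \<partial>lborel)
      = ennreal (pi * (\<kappa>^3/3 * (1 / \<kappa>\<^sup>2 - 1)) - pi * (0^3/3 * (1 / \<kappa>\<^sup>2 - 1)))"
  proof (rule nn_integral_FTC_Icc[where F="\<lambda>c. pi * (c^3/3 * (1 / \<kappa>\<^sup>2 - 1))"])
    define a where "a = 1 / \<kappa>\<^sup>2 - 1"
    show "((\<lambda>c. pi * (c^3/3 * (1 / \<kappa>\<^sup>2 - 1))) has_real_derivative pi * (x\<^sup>2 * (1 / \<kappa>\<^sup>2 - 1))) (at x)" for x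
      unfolding a_def[symmetric] by (auto intro!: derivative_eq_intros)
    show "0 \<le> pi * (x\<^sup>2 * (1 / \<kappa>\<^sup>2 - 1))" if "x \<in> {0..\<kappa>}" for x
    proof (cases "\<kappa> = 0")
      case False
      then have "1 / \<kappa>\<^sup>2 \<ge> 1" using k by (simp add: power_le_one)
      then show ?thesis by simp
    qed (use that in simp)
  qed (use k in auto)
  also have "(\<integral>\<^sup>+c. ennreal (pi * (1 - c\<^sup>2)) * indicator {\<kappa>..1} c \<partial>lborel)
      = ennreal (pi * (1 - 1^3/3) - pi * (\<kappa> - \<kappa>^3/3))"
    apply (rule nn_integral_FTC_Icc[where F="\<lambda>c. pi * (c - c^3/3)"])
    using k by (auto intro!: derivative_eq_intros simp: power_le_one)
  also have "ennreal (pi * (\<kappa>^3/3 * (1 / \<kappa>\<^sup>2 - 1)) - pi * (0^3/3 * (1 / \<kappa>\<^sup>2 - 1))) + ennreal (pi * (1 - 1^3/3) - pi * (\<kappa> - \<kappa>^3/3))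
     = ennreal ((pi * (\<kappa>^3/3 * (1 / \<kappa>\<^sup>2 - 1)) - pi * (0^3/3 * (1 / \<kappa>\<^sup>2 - 1))) + (pi * (1 - 1^3/3) - pi * (\<kappa> - \<kappa>^3/3)))"
  proof (rule ennreal_plus[symmetric])
    show "0 \<le> pi * (\<kappa>^3/3 * (1 / \<kappa>\<^sup>2 - 1)) - pi * (0^3/3 * (1 / \<kappa>\<^sup>2 - 1))"
    proof (cases "\<kappa> = 0")
      case False
      then have "1 / \<kappa>\<^sup>2 \<ge> 1" using k by (simp add: power_le_one)
      then show ?thesis using k by simp
    qed simp
    have "\<kappa>^3/3 - \<kappa> + 2/3 = (1-\<kappa>)^2 * (\<kappa>+2) / 3" by (simp add: power2_eq_square power3_eq_cube field_simps)
    moreover have "\<dots> \<ge> 0" using k by simp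
    ultimately have "pi * (\<kappa>^3/3 - \<kappa> + 2/3) \<ge> 0" by simp
    then show "0 \<le> pi * (1 - 1^3/3) - pi * (\<kappa> - \<kappa>^3/3)" by (simp add: algebra_simps)
  qed
  also have "(pi * (\<kappa>^3/3 * (1 / \<kappa>\<^sup>2 - 1)) - pi * (0^3/3 * (1 / \<kappa>\<^sup>2 - 1))) + (pi * (1 - 1^3/3) - pi * (\<kappa> - \<kappa>^3/3)) = 2 * pi / 3 * (1 - \<kappa>)"
    by (cases "\<kappa> = 0") (simp_all add: field_simps power2_eq_square power3_eq_cube)
  finally show ?thesis .
qed


lemma borel_cone [measurable]: "{x::real^3 \<in> ball 0 1 - {0}. \<kappa> * norm x < x \<bullet> y} \<in> sets borel"
proof -
  have "{x::real^3 \<in> ball 0 1 - {0}. \<kappa> * norm x < x \<bullet> y} = {x \<in> space borel. norm x < 1 \<and> x \<noteq> 0 \<and> \<kappa> * norm x < x \<bullet> y}"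
    by auto
  also have "\<dots> \<in> sets borel" by measurable
  finally show ?thesis .
qed

lemma distr_uminus_lborel: "distr lborel borel uminus = (lborel :: 'a::euclidean_space measure)"
  using lborel_affine[of "-1" "0::'a"] by (simp add: density_1)

text \<open>For \<open>\<kappa> < 0\<close> the sector is the complement of the reflection of a closed sector with
  parameter \<open>-\<kappa>\<close>.\<close>

lemma cone_volume_north:
  assumes "-1 \<le> \<kappa>" "\<kappa> \<le> 1"
  shows "emeasure lborel {x::real^3 \<in> ball 0 1 - {0}. \<kappa> * norm x < x \<bullet> axis 3 1} = ennreal (2 * pi / 3 * (1 - \<kappa>))"
proof (cases "\<kappa> \<ge> 0")
  case True
  then show ?thesis
    by (intro sector_volume borel_cone) (use assms in \<open>auto simp: inner_axis\<close>)
next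
  case False
  let ?B = "ball 0 1 - {0} :: (real^3) set"
  let ?P = "{x \<in> ?B. \<kappa> * norm x < x \<bullet> axis 3 1}"
  let ?N = "{x \<in> ?B. - \<kappa> * norm x \<le> x \<bullet> axis 3 1}"
  have "?N = {x \<in> space borel. norm x < 1 \<and> x \<noteq> 0 \<and> - \<kappa> * norm x \<le> x \<bullet> axis 3 1}"
    by auto
  also have "\<dots> \<in> sets borel" by measurable
  finally have Nm: "?N \<in> sets borel" .
  have N: "emeasure lborel ?N = ennreal (2 * pi / 3 * (1 + \<kappa>))"
  proof -
    have "emeasure lborel ?N = ennreal (2 * pi / 3 * (1 - (- \<kappa>)))"
      by (rule sector_volume[OF Nm]) (use assms False in \<open>auto simp: inner_axis\<close>)
    then show ?thesis by simp
  qed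
  have vB: "emeasure lborel ?B = ennreal (4 * pi / 3)"
    by (subst emeasure_Diff) (auto simp: emeasure_ball unit_ball_vol_3)
  have "?P = ?B - uminus -` ?N"
    by (auto simp: inner_axis)
  moreover have "emeasure lborel (uminus -` ?N) = emeasure lborel ?N"
    using emeasure_distr[of uminus "lborel :: (real^3) measure" borel ?N] Nm
    by (simp add: distr_uminus_lborel)
  moreover have "uminus -` ?N \<subseteq> ?B" by auto
  moreover have "uminus -` ?N \<in> sets borel"
    using measurable_sets[of uminus "borel :: (real^3) measure" borel ?N] Nm by simp
  ultimately have "emeasure lborel ?P = emeasure lborel ?B - emeasure lborel ?N"
    using N by (simp add: emeasure_Diff)
  also have "\<dots> = ennreal (4 * pi / 3 - 2 * pi / 3 * (1 + \<kappa>))"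
    unfolding N vB using assms by (intro ennreal_minus) auto
  finally show ?thesis by (simp add: field_simps)
qed

lemma cone_volume:
  assumes y: "norm y = 1" and k: "-1 \<le> \<kappa>" "\<kappa> \<le> 1"
  shows "emeasure lborel {x::real^3 \<in> ball 0 1 - {0}. \<kappa> * norm x < x \<bullet> y} = ennreal (2 * pi / 3 * (1 - \<kappa>))"
proof -
  let ?P = "\<lambda>y. {x::real^3 \<in> ball 0 1 - {0}. \<kappa> * norm x < x \<bullet> y}"
  obtain f :: "real^3 \<Rightarrow> real^3" where f: "orthogonal_transformation f" "f y = axis 3 1"
    using orthogonal_transformation_exists_1[of y "axis 3 1"] y by auto
  have lm: "?P y \<in> lmeasurable" for y
    by (rule bounded_set_imp_lmeasurable) (auto intro: bounded_subset[OF bounded_ball[of 0 1]])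
  have n: "norm (f x) = norm x" for x using f(1) by (simp add: orthogonal_transformation)
  have i: "f x \<bullet> f z = x \<bullet> z" for x z using f(1) by (simp add: orthogonal_transformation_def)
  have "f ` ?P y = ?P (axis 3 1)"
  proof (intro antisym subsetI)
    fix x assume "x \<in> f ` ?P y"
    then show "x \<in> ?P (axis 3 1)"
      using n by (auto simp: f(2)[symmetric] i) (metis norm_eq_zero)+
  next
    fix x assume x: "x \<in> ?P (axis 3 1)"
    obtain z where z: "x = f z" using orthogonal_transformation_surj[OF f(1)] by (metis surjD)
    have "z \<in> ?P y"
      using x n[of z] i[of z y] unfolding z by (auto simp: f(2))
    then show "x \<in> f ` ?P y" using z by blast
  qed
  then have "measure lebesgue (?P (axis 3 1)) = measure lebesgue (?P y)"
    using measure_orthogonal_image[OF f(1) lm[of y]] by simp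
  then have "emeasure lebesgue (?P (axis 3 1)) = emeasure lebesgue (?P y)"
    using lm by (simp add: emeasure_eq_measure2 fmeasurableD2)
  then show ?thesis
    using cone_volume_north[OF k] by (simp add: borel_cone)
qed

lemma finite_sphere_measure: "finite_measure \<mu>"
  by standard (simp add: emeasure_sphere_measure_total)

lemma borel_measurable_sphere [measurable (raw)]:
  "f \<in> measurable borel N \<Longrightarrow> f \<in> measurable \<mu> N"
  by (simp add: measurable_cong_sets[OF sets_sphere_measure refl] measurable_restrict_space1)

text \<open>Archimedes' hat-box theorem: the projection to a diameter carries the area to a multiple of
  Lebesgue measure.\<close>

lemma distr_height:
  assumes y: "y \<in> S2"
  shows "distr \<mu> borel (\<lambda>x. x \<bullet> y) = density lborel (\<lambda>t. ennreal (2 * pi) * indicator {-1..1} t)"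
    (is "?L = ?R")
proof (rule measure_eqI_lessThan)
  interpret finite_measure \<mu> by (rule finite_sphere_measure)
  have L: "emeasure ?L {\<kappa><..} = emeasure \<mu> {x \<in> S2. \<kappa> < x \<bullet> y}" for \<kappa>
    by (subst emeasure_distr) (auto intro!: arg_cong[where f="emeasure \<mu>"] borel_measurable_sphere)
  show "emeasure ?L {\<kappa><..} < \<infinity>" for \<kappa>
    unfolding L by (simp add: emeasure_eq_measure)
  have R: "emeasure ?R {\<kappa><..} = ennreal (2 * pi) * emeasure lborel ({-1..1} \<inter> {\<kappa><..})" for \<kappa> :: real
    by (subst emeasure_density)
      (auto simp: mult.assoc nn_integral_cmult simp flip: indicator_inter_arith)
  show "emeasure ?L {\<kappa><..} = emeasure ?R {\<kappa><..}" for \<kappa> :: real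
  proof -
    have xy: "\<bar>x \<bullet> y\<bar> \<le> 1" if "x \<in> S2" for x
      using Cauchy_Schwarz_ineq2[of x y] that y by simp
    consider "\<kappa> < -1" | "-1 \<le> \<kappa>" "\<kappa> \<le> 1" | "\<kappa> > 1" by linarith
    then show ?thesis
    proof cases
      case 1
      then have "{x \<in> S2. \<kappa> < x \<bullet> y} = S2" using xy by force
      moreover have "{-1..1} \<inter> {\<kappa><..} = {-1..1}" using 1 by auto
      ultimately show ?thesis unfolding L R using emeasure_sphere_measure_total
        by (simp flip: ennreal_mult ennreal_numeral)
    next
      case 3
      then have "{x \<in> S2. \<kappa> < x \<bullet> y} = {}" using xy by force
      moreover have "{-1..1} \<inter> {\<kappa><..} = {}" using 3 by auto
      ultimately show ?thesis unfolding L R by (simp only: emeasure_empty mult_zero_right)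
    next
      case 2
      then have e: "{-1..1} \<inter> {\<kappa><..} = {\<kappa><..1}" by auto
      have "{x \<in> S2. \<kappa> < x \<bullet> y} = S2 \<inter> {x \<in> space borel. \<kappa> < x \<bullet> y}" by auto
      also have "\<dots> \<in> sets borel" by (rule sets.Int[OF borel_closed[OF closed_sphere]]) measurable
      finally have "emeasure \<mu> {x \<in> S2. \<kappa> < x \<bullet> y} = 3 * emeasure lborel {x \<in> ball 0 1 - {0}. sgn x \<in> {x \<in> S2. \<kappa> < x \<bullet> y}}"
        by (intro emeasure_sphere_measure) auto
      also have "{x \<in> ball 0 1 - {0}. sgn x \<in> {x \<in> S2. \<kappa> < x \<bullet> y}} = {x \<in> ball 0 1 - {0}. \<kappa> * norm x < x \<bullet> y}"
        by (auto simp: norm_sgn sgn_div_norm field_simps)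
      also have "3 * emeasure lborel {x \<in> ball 0 1 - {0}. \<kappa> * norm x < x \<bullet> y} = ennreal (3 * (2 * pi / 3 * (1 - \<kappa>)))"
        using 2 y cone_volume[of y \<kappa>] ennreal_mult[of 3 "2 * pi / 3 * (1 - \<kappa>)"] by simp
      finally show ?thesis unfolding L R e using 2 by (simp flip: ennreal_mult)
    qed
  qed
qed auto

text \<open>As \<open>|x - y|\<^sup>2 = 2 - 2 x \<bullet> y\<close>, the hat-box theorem says that the squared distance to \<open>y\<close> is
  uniformly distributed on \<open>[0, 4]\<close>.\<close>

lemma nn_integral_sphere_dist:
  assumes y: "y \<in> S2" and [measurable]: "f \<in> borel_measurable borel"
  shows "(\<integral>\<^sup>+x. f ((norm (x - y))\<^sup>2) \<partial>\<mu>) = ennreal pi * (\<integral>\<^sup>+s. f s * indicator {0..4} s \<partial>lborel)"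
proof -
  have "(\<integral>\<^sup>+x. f ((norm (x - y))\<^sup>2) \<partial>\<mu>) = (\<integral>\<^sup>+x. f (2 - 2 * (x \<bullet> y)) \<partial>\<mu>)"
  proof (rule nn_integral_cong)
    fix x assume "x \<in> space \<mu>"
    then have "(norm (x - y))\<^sup>2 = 2 - 2 * (x \<bullet> y)"
      using y by (simp add: power2_norm_eq_inner inner_diff inner_commute norm_eq_1)
    then show "f ((norm (x - y))\<^sup>2) = f (2 - 2 * (x \<bullet> y))" by simp
  qed
  also have "\<dots> = (\<integral>\<^sup>+t. f (2 - 2 * t) \<partial>distr \<mu> borel (\<lambda>x. x \<bullet> y))"
    by (subst nn_integral_distr) (auto intro: borel_measurable_sphere)
  also have "\<dots> = (\<integral>\<^sup>+t. ennreal (2 * pi) * indicator {-1..1} t * f (2 - 2 * t) \<partial>lborel)"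
    unfolding distr_height[OF y] by (subst nn_integral_density) auto
  also have "\<dots> = (\<integral>\<^sup>+t. ennreal 2 * (ennreal pi * (f (2 + (-2) * t) * indicator {0..4} (2 + (-2) * t))) \<partial>lborel)"
    by (intro nn_integral_cong) (auto simp: indicator_def ennreal_mult mult_ac)
  also have "\<dots> = ennreal 2 * (\<integral>\<^sup>+t. ennreal pi * (f (2 + (-2) * t) * indicator {0..4} (2 + (-2) * t)) \<partial>lborel)"
    by (subst nn_integral_cmult) auto
  also have "\<dots> = (\<integral>\<^sup>+s. ennreal pi * (f s * indicator {0..4} s) \<partial>lborel)"
    by (subst nn_integral_real_affine[where c="-2" and t=2 and f="\<lambda>s. ennreal pi * (f s * indicator {0..4} s)"]) auto
  also have "\<dots> = ennreal pi * (\<integral>\<^sup>+s. f s * indicator {0..4} s \<partial>lborel)"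
    by (subst nn_integral_cmult) auto
  finally show ?thesis .
qed

text \<open>The kernels below depend on the distance only; in this form their integrals follow from the
  fundamental theorem of calculus.\<close>

lemma has_bochner_integral_sphere_dist:
  assumes y: "y \<in> S2" and ab: "0 \<le> a" "a \<le> b" "b \<le> 4" and [measurable]: "f \<in> borel_measurable borel"
    and F: "\<And>s. s \<in> {a..b} \<Longrightarrow> (F has_real_derivative f s) (at s)"
    and nonneg: "\<And>s. s \<in> {a..b} \<Longrightarrow> 0 \<le> f s"
  shows "has_bochner_integral \<mu>
    (\<lambda>x. f ((norm (x - y))\<^sup>2) * indicator {a..b} ((norm (x - y))\<^sup>2)) (pi * (F b - F a))"
proof (rule has_bochner_integral_nn_integral)
  show "(\<lambda>x. f ((norm (x - y))\<^sup>2) * indicator {a..b} ((norm (x - y))\<^sup>2)) \<in> borel_measurable \<mu>"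
    by measurable
  show "AE x in \<mu>. 0 \<le> f ((norm (x - y))\<^sup>2) * indicator {a..b} ((norm (x - y))\<^sup>2)"
    using nonneg by (auto simp: indicator_def)
  have m: "F a \<le> F b"
    using F nonneg by (intro DERIV_nonneg_imp_nondecreasing[of a b F]) (use ab in auto)
  then show "0 \<le> pi * (F b - F a)" by simp
  have "(\<integral>\<^sup>+x. ennreal (f ((norm (x - y))\<^sup>2) * indicator {a..b} ((norm (x - y))\<^sup>2)) \<partial>\<mu>)
     = ennreal pi * (\<integral>\<^sup>+s. ennreal (f s * indicator {a..b} s) * indicator {0..4} s \<partial>lborel)"
    by (rule nn_integral_sphere_dist[OF y]) measurable
  also have "(\<integral>\<^sup>+s. ennreal (f s * indicator {a..b} s) * indicator {0..4} s \<partial>lborel)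
     = (\<integral>\<^sup>+s. ennreal (f s) * indicator {a..b} s \<partial>lborel)"
    using ab by (intro nn_integral_cong) (auto simp: indicator_def)
  also have "\<dots> = ennreal (F b - F a)"
    by (rule nn_integral_FTC_Icc) (use ab F nonneg in auto)
  also have "ennreal pi * \<dots> = ennreal (pi * (F b - F a))"
    using m by (simp add: ennreal_mult)
  finally show "(\<integral>\<^sup>+x. ennreal (f ((norm (x - y))\<^sup>2) * indicator {a..b} ((norm (x - y))\<^sup>2)) \<partial>\<mu>) = ennreal (pi * (F b - F a))" .
qed

section \<open>Regularised kernels\<close>

lemma chord_sq_le: "x \<in> S2 \<Longrightarrow> y \<in> S2 \<Longrightarrow> (norm (x - y))\<^sup>2 \<le> 4"
  using power_mono[of "norm (x - y)" 2 2] norm_triangle_ineq4[of x y] by simp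

definition sq_dist :: "real \<Rightarrow> real^3 \<Rightarrow> real^3 \<Rightarrow> real" where
  "sq_dist \<delta> x y = (norm (x - y))\<^sup>2 + \<delta>"

lemma sq_dist_commute: "sq_dist \<delta> x y = sq_dist \<delta> y x"
  by (simp add: sq_dist_def norm_minus_commute)

lemma sq_dist_ge: "\<delta> \<le> sq_dist \<delta> x y"
  by (simp add: sq_dist_def)

lemma sq_dist_pos: "0 < \<delta> \<Longrightarrow> 0 < sq_dist \<delta> x y"
  by (simp add: sq_dist_def add_nonneg_pos)

lemma sq_dist_le: "x \<in> S2 \<Longrightarrow> y \<in> S2 \<Longrightarrow> \<delta> \<le> 1 \<Longrightarrow> sq_dist \<delta> x y \<le> 5"
  using chord_sq_le[of x y] by (simp add: sq_dist_def)

text \<open>The square root of the regularised squared distance is the distance in one more dimension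
  between points whose heights differ by \<open>\<surd>\<delta>\<close>.\<close>

lemma sqrt_sq_dist_triangle:
  assumes "0 < \<delta>"
  shows "sqrt (sq_dist \<delta> y z) \<le> sqrt (sq_dist \<delta> x y) + sqrt (sq_dist \<delta> x z)"
proof -
  define a b where "a = norm (x - y)" and "b = norm (x - z)"
  have ab: "a \<ge> 0" "b \<ge> 0" by (simp_all add: a_def b_def)
  have "norm (y - z) \<le> a + b"
    unfolding a_def b_def by (metis norm_minus_commute norm_triangle_ineq diff_add_cancel add_diff_eq)
  then have "(norm (y - z))\<^sup>2 \<le> (a + b)\<^sup>2" by (simp add: power_mono)
  moreover have "a * b \<le> sqrt (a\<^sup>2 + \<delta>) * sqrt (b\<^sup>2 + \<delta>)"
    using ab assms by (intro mult_mono) (auto intro!: real_le_rsqrt)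
  ultimately have "sq_dist \<delta> y z \<le> (sqrt (a\<^sup>2 + \<delta>) + sqrt (b\<^sup>2 + \<delta>))\<^sup>2"
    using assms ab unfolding sq_dist_def by (simp add: power2_sum)
  then show ?thesis
    using assms unfolding a_def b_def sq_dist_def by (intro real_le_lsqrt) auto
qed

lemma sq_dist_measurable [measurable]: "(\<lambda>x. sq_dist \<delta> x y) \<in> borel_measurable borel" "(\<lambda>x. sq_dist \<delta> y x) \<in> borel_measurable borel"
  unfolding sq_dist_def by measurable

text \<open>A regularisation of \<open>1 / (2 \<pi> |x - y|)\<close>, which bounds the gradient of the Green function of the
  sphere.\<close>

definition riesz_kernel :: "real \<Rightarrow> real^3 \<Rightarrow> real^3 \<Rightarrow> real" where
  "riesz_kernel \<delta> x y = 1 / (2 * pi * sqrt (sq_dist \<delta> x y))"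

text \<open>This splits the sphere, for points \<open>y\<close>, \<open>z\<close> with squared distance \<open>Q\<close>, into a neighbourhood of
  each point and the rest. By the triangle inequality at most one of the two distances is small, and then the
  other one is comparable to \<open>\<surd>Q\<close>. On the rest the arithmetic-geometric mean inequality loses nothing to
  leading order, because there the two distances are almost equal except close to \<open>y\<close> and \<open>z\<close>.\<close>

lemma inverse_sqrt_prod_le:
  fixes a b Q :: real
  assumes "0 < a" "0 < b" "0 < Q" and tri: "sqrt Q \<le> sqrt a + sqrt b"
  shows "1 / (sqrt a * sqrt b) \<le> 1/2 * (1/a * of_bool (Q/4 \<le> a)) + 1/2 * (1/b * of_bool (Q/4 \<le> b))
    + 2 / sqrt Q * (1 / sqrt a * of_bool (a \<le> Q/4)) + 2 / sqrt Q * (1 / sqrt b * of_bool (b \<le> Q/4))"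
proof -
  have pos: "sqrt a > 0" "sqrt b > 0" "sqrt Q > 0" using assms by auto
  have sQ: "sqrt (Q/4) = sqrt Q / 2" by (simp add: real_sqrt_divide)
  consider "a < Q/4" | "b < Q/4" | "Q/4 \<le> a" "Q/4 \<le> b" by linarith
  then show ?thesis
  proof cases
    case 1
    then have "sqrt a < sqrt Q / 2" using real_sqrt_less_mono[OF 1] sQ by simp
    then have "sqrt b \<ge> sqrt Q / 2" using tri by linarith
    then have "1 / sqrt b \<le> 2 / sqrt Q" using pos by (simp add: field_simps)
    then have "1 / (sqrt a * sqrt b) \<le> 2 / sqrt Q * (1 / sqrt a)"
      using pos mult_right_mono[of "1 / sqrt b" "2 / sqrt Q" "1 / sqrt a"] by (simp add: mult.commute)
    moreover have "2 / sqrt Q * (1 / sqrt b * of_bool (b \<le> Q/4)) \<ge> 0"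
      "1/2 * (1/a * of_bool (Q/4 \<le> a)) \<ge> 0" "1/2 * (1/b * of_bool (Q/4 \<le> b)) \<ge> 0"
      using assms pos by auto
    ultimately show ?thesis using 1 by simp
  next
    case 2
    then have "sqrt b < sqrt Q / 2" using real_sqrt_less_mono[OF 2] sQ by simp
    then have "sqrt a \<ge> sqrt Q / 2" using tri by linarith
    then have "1 / sqrt a \<le> 2 / sqrt Q" using pos by (simp add: field_simps)
    then have "1 / (sqrt a * sqrt b) \<le> 2 / sqrt Q * (1 / sqrt b)"
      using pos mult_right_mono[of "1 / sqrt a" "2 / sqrt Q" "1 / sqrt b"] by (simp add: mult.commute)
    moreover have "2 / sqrt Q * (1 / sqrt a * of_bool (a \<le> Q/4)) \<ge> 0"
      "1/2 * (1/a * of_bool (Q/4 \<le> a)) \<ge> 0" "1/2 * (1/b * of_bool (Q/4 \<le> b)) \<ge> 0"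
      using assms pos by auto
    ultimately show ?thesis using 2 by simp
  next
    case 3
    have "0 \<le> (1 / sqrt a - 1 / sqrt b)\<^sup>2" by simp
    also have "\<dots> = 1/a + 1/b - 2 * (1 / (sqrt a * sqrt b))"
      using assms by (simp add: power2_diff power_divide)
    finally have "1 / (sqrt a * sqrt b) \<le> 1/2 * (1/a) + 1/2 * (1/b)" by simp
    moreover have "2 / sqrt Q * (1 / sqrt a * of_bool (a \<le> Q/4)) \<ge> 0"
      "2 / sqrt Q * (1 / sqrt b * of_bool (b \<le> Q/4)) \<ge> 0"
      using assms pos by auto
    ultimately show ?thesis using 3 by simp
  qed
qed

lemma integral_inverse_sq_dist_le:
  assumes y: "y \<in> S2" and d: "0 < \<delta>" "\<delta> \<le> 1" and Q: "0 < Q" "Q \<le> 5"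
  shows "integrable \<mu> (\<lambda>x. 1 / sq_dist \<delta> x y * of_bool (Q/4 \<le> sq_dist \<delta> x y))"
    and "(LINT x|\<mu>. 1 / sq_dist \<delta> x y * of_bool (Q/4 \<le> sq_dist \<delta> x y)) \<le> pi * ln (20 / Q)"
proof -
  define a where "a = max 0 (Q/4 - \<delta>)"
  have a: "0 \<le> a" "a \<le> 4" using Q d by (auto simp: a_def)
  have "has_bochner_integral \<mu>
    (\<lambda>x. 1 / ((norm (x - y))\<^sup>2 + \<delta>) * indicator {a..4} ((norm (x - y))\<^sup>2)) (pi * (ln (4 + \<delta>) - ln (a + \<delta>)))"
    by (rule has_bochner_integral_sphere_dist[OF y a order_refl, where F="\<lambda>s. ln (s + \<delta>)" and f="\<lambda>s. 1 / (s + \<delta>)"])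
      (use d a in \<open>auto intro!: derivative_eq_intros\<close>)
  moreover have "1 / ((norm (x - y))\<^sup>2 + \<delta>) * indicator {a..4} ((norm (x - y))\<^sup>2) = 1 / sq_dist \<delta> x y * of_bool (Q/4 \<le> sq_dist \<delta> x y)"
    if "x \<in> S2" for x
    using chord_sq_le[OF that y] by (auto simp: sq_dist_def a_def indicator_def)
  ultimately have h: "has_bochner_integral \<mu>
    (\<lambda>x. 1 / sq_dist \<delta> x y * of_bool (Q/4 \<le> sq_dist \<delta> x y)) (pi * (ln (4 + \<delta>) - ln (a + \<delta>)))"
    by (subst has_bochner_integral_cong[OF refl _ refl]) auto
  then show "integrable \<mu> (\<lambda>x. 1 / sq_dist \<delta> x y * of_bool (Q/4 \<le> sq_dist \<delta> x y))"
    by (simp add: has_bochner_integral_iff)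
  have "ln (4 + \<delta>) - ln (a + \<delta>) = ln ((4 + \<delta>) / (a + \<delta>))" using a d by (simp add: ln_div)
  also have "\<dots> \<le> ln (5 / (Q / 4))"
    using a d Q by (intro ln_mono frac_le) (auto simp: a_def max_def)
  finally show "(LINT x|\<mu>. 1 / sq_dist \<delta> x y * of_bool (Q/4 \<le> sq_dist \<delta> x y)) \<le> pi * ln (20 / Q)"
    using h by (simp add: has_bochner_integral_iff)
qed

lemma integral_inverse_sqrt_sq_dist_le:
  assumes y: "y \<in> S2" and d: "0 < \<delta>" "\<delta> \<le> 1" and Q: "0 < Q" "Q \<le> 5"
  shows "integrable \<mu> (\<lambda>x. 1 / sqrt (sq_dist \<delta> x y) * of_bool (sq_dist \<delta> x y \<le> Q/4))"
    and "(LINT x|\<mu>. 1 / sqrt (sq_dist \<delta> x y) * of_bool (sq_dist \<delta> x y \<le> Q/4)) \<le> pi * sqrt Q"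
proof -
  have "integrable \<mu> (\<lambda>x. 1 / sqrt (sq_dist \<delta> x y) * of_bool (sq_dist \<delta> x y \<le> Q/4))
    \<and> (LINT x|\<mu>. 1 / sqrt (sq_dist \<delta> x y) * of_bool (sq_dist \<delta> x y \<le> Q/4)) \<le> pi * sqrt Q"
  proof (cases "Q/4 < \<delta>")
    case True
    then have "\<not> sq_dist \<delta> x y \<le> Q/4" for x using sq_dist_ge[of \<delta> x y] by linarith
    then show ?thesis using Q by simp
  next
    case False
    define b where "b = Q/4 - \<delta>"
    have b: "0 \<le> b" "b \<le> 4" using Q d False by (auto simp: b_def)
    have "has_bochner_integral \<mu>
      (\<lambda>x. 1 / sqrt ((norm (x - y))\<^sup>2 + \<delta>) * indicator {0..b} ((norm (x - y))\<^sup>2)) (pi * (2 * sqrt (b + \<delta>) - 2 * sqrt (0 + \<delta>)))"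
      by (rule has_bochner_integral_sphere_dist[OF y order_refl b, where F="\<lambda>s. 2 * sqrt (s + \<delta>)" and f="\<lambda>s. 1 / sqrt (s + \<delta>)"])
        (use d b in \<open>auto intro!: derivative_eq_intros simp: field_simps\<close>)
    moreover have "(\<lambda>x. 1 / sqrt ((norm (x - y))\<^sup>2 + \<delta>) * indicator {0..b} ((norm (x - y))\<^sup>2))
      = (\<lambda>x. 1 / sqrt (sq_dist \<delta> x y) * of_bool (sq_dist \<delta> x y \<le> Q/4))"
      by (auto simp: sq_dist_def b_def indicator_def fun_eq_iff)
    ultimately have h: "has_bochner_integral \<mu>
      (\<lambda>x. 1 / sqrt (sq_dist \<delta> x y) * of_bool (sq_dist \<delta> x y \<le> Q/4)) (pi * (2 * sqrt (b + \<delta>) - 2 * sqrt (0 + \<delta>)))"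
      by simp
    moreover have "2 * sqrt (b + \<delta>) - 2 * sqrt (0 + \<delta>) \<le> sqrt Q"
      using d by (simp add: b_def real_sqrt_divide)
    ultimately show ?thesis by (auto simp: has_bochner_integral_iff)
  qed
  then show "integrable \<mu> (\<lambda>x. 1 / sqrt (sq_dist \<delta> x y) * of_bool (sq_dist \<delta> x y \<le> Q/4))"
    and "(LINT x|\<mu>. 1 / sqrt (sq_dist \<delta> x y) * of_bool (sq_dist \<delta> x y \<le> Q/4)) \<le> pi * sqrt Q"
    by auto
qed

text \<open>The kernel of the square of the Riesz potential. The constant \<open>1 / (4 \<pi>)\<close> in front of the
  logarithm is sharp, and it is the source of the constant in the final inequality. It comes from the region
  where both distances exceed half of \<open>|y - z|\<close>; the two neighbourhoods contribute \<open>1 / (2 \<pi>)\<close> each.\<close>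

lemma integral_riesz_kernel_product_le:
  assumes y: "y \<in> S2" and z: "z \<in> S2" and d: "0 < \<delta>" "\<delta> \<le> 1"
  shows "(LINT x|\<mu>. riesz_kernel \<delta> x y * riesz_kernel \<delta> x z) \<le> 1 / (4 * pi) * ln (20 / sq_dist \<delta> y z) + 1 / pi"
proof -
  let ?Q = "sq_dist \<delta> y z"
  have Q: "0 < ?Q" "?Q \<le> 5" using sq_dist_pos sq_dist_le y z d by auto
  note I = integral_inverse_sq_dist_le[OF y d Q] integral_inverse_sq_dist_le[OF z d Q]
    integral_inverse_sqrt_sq_dist_le[OF y d Q] integral_inverse_sqrt_sq_dist_le[OF z d Q]
  let ?f = "\<lambda>x. 1/2 * (1 / sq_dist \<delta> x y * of_bool (?Q/4 \<le> sq_dist \<delta> x y)) + 1/2 * (1 / sq_dist \<delta> x z * of_bool (?Q/4 \<le> sq_dist \<delta> x z))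
    + 2 / sqrt ?Q * (1 / sqrt (sq_dist \<delta> x y) * of_bool (sq_dist \<delta> x y \<le> ?Q/4)) + 2 / sqrt ?Q * (1 / sqrt (sq_dist \<delta> x z) * of_bool (sq_dist \<delta> x z \<le> ?Q/4))"
  have "(LINT x|\<mu>. riesz_kernel \<delta> x y * riesz_kernel \<delta> x z) \<le> (LINT x|\<mu>. 1 / (4 * pi\<^sup>2) * ?f x)"
  proof (rule integral_mono')
    show "integrable \<mu> (\<lambda>x. 1 / (4 * pi\<^sup>2) * ?f x)"
      by (intro integrable_mult_right Bochner_Integration.integrable_add I)
    show "riesz_kernel \<delta> x y * riesz_kernel \<delta> x z \<le> 1 / (4 * pi\<^sup>2) * ?f x" for x
    proof -
      have "riesz_kernel \<delta> x y * riesz_kernel \<delta> x z = 1 / (4 * pi\<^sup>2) * (1 / (sqrt (sq_dist \<delta> x y) * sqrt (sq_dist \<delta> x z)))"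
        by (simp add: riesz_kernel_def power2_eq_square)
      also have "\<dots> \<le> 1 / (4 * pi\<^sup>2) * ?f x"
        by (intro mult_left_mono inverse_sqrt_prod_le sq_dist_pos d Q sqrt_sq_dist_triangle) simp
      finally show ?thesis .
    qed
    show "0 \<le> 1 / (4 * pi\<^sup>2) * ?f x" for x
      using sq_dist_pos[OF d(1), of x y] sq_dist_pos[OF d(1), of x z] Q by (intro mult_nonneg_nonneg add_nonneg_nonneg) auto
  qed
  also have "\<dots> = 1 / (4 * pi\<^sup>2) * (1/2 * (LINT x|\<mu>. 1 / sq_dist \<delta> x y * of_bool (?Q/4 \<le> sq_dist \<delta> x y))
    + 1/2 * (LINT x|\<mu>. 1 / sq_dist \<delta> x z * of_bool (?Q/4 \<le> sq_dist \<delta> x z))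
    + 2 / sqrt ?Q * (LINT x|\<mu>. 1 / sqrt (sq_dist \<delta> x y) * of_bool (sq_dist \<delta> x y \<le> ?Q/4)) 
    + 2 / sqrt ?Q * (LINT x|\<mu>. 1 / sqrt (sq_dist \<delta> x z) * of_bool (sq_dist \<delta> x z \<le> ?Q/4)))"
    by (simp only: Bochner_Integration.integral_add Bochner_Integration.integral_mult_right
      integrable_mult_right Bochner_Integration.integrable_add I integral_mult_right_zero)
  also have "\<dots> \<le> 1 / (4 * pi\<^sup>2) * (1/2 * (pi * ln (20 / ?Q)) + 1/2 * (pi * ln (20 / ?Q))
    + 2 / sqrt ?Q * (pi * sqrt ?Q) + 2 / sqrt ?Q * (pi * sqrt ?Q))"
    using Q by (intro mult_left_mono add_mono I) auto
  also have "\<dots> = 1 / (4 * pi) * ln (20 / ?Q) + 1 / pi"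
    using Q by (simp add: field_simps power2_eq_square)
  finally show ?thesis .
qed

text \<open>The bound does not depend on \<open>\<delta>\<close>, since \<open>|x - y|\<^bsup>-2(1 - \<kappa>)\<^esup>\<close> is integrable in dimension two.\<close>

lemma integral_sq_dist_powr_le:
  assumes y: "y \<in> S2" and d: "0 < \<delta>" "\<delta> \<le> 1" and a: "0 < \<kappa>" "\<kappa> < 1"
  shows "integrable \<mu> (\<lambda>x. sq_dist \<delta> x y powr (\<kappa> - 1))"
    and "(LINT x|\<mu>. sq_dist \<delta> x y powr (\<kappa> - 1)) \<le> 5 * pi / \<kappa>"
proof -
  have "has_bochner_integral \<mu>
    (\<lambda>x. ((norm (x - y))\<^sup>2 + \<delta>) powr (\<kappa> - 1) * indicator {0..4} ((norm (x - y))\<^sup>2)) (pi * ((4 + \<delta>) powr \<kappa> / \<kappa> - (0 + \<delta>) powr \<kappa> / \<kappa>))"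
    by (rule has_bochner_integral_sphere_dist[OF y, where F="\<lambda>s. (s + \<delta>) powr \<kappa> / \<kappa>" and f="\<lambda>s. (s + \<delta>) powr (\<kappa> - 1)"])
      (use d a in \<open>auto intro!: derivative_eq_intros\<close>)
  then have h: "has_bochner_integral \<mu> (\<lambda>x. sq_dist \<delta> x y powr (\<kappa> - 1)) (pi * ((4 + \<delta>) powr \<kappa> / \<kappa> - (0 + \<delta>) powr \<kappa> / \<kappa>))"
    by (subst (asm) has_bochner_integral_cong[OF refl _ refl, where g="\<lambda>x. sq_dist \<delta> x y powr (\<kappa> - 1)"])
      (use chord_sq_le[OF _ y] in \<open>auto simp: sq_dist_def indicator_def\<close>)
  then show "integrable \<mu> (\<lambda>x. sq_dist \<delta> x y powr (\<kappa> - 1))"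
    by (simp add: has_bochner_integral_iff)
  have "(4 + \<delta>) powr \<kappa> \<le> 5 powr \<kappa>" using d a by (intro powr_mono2) auto
  also have "\<dots> \<le> 5 powr 1" using a by (intro powr_mono) auto
  finally have p5: "(4 + \<delta>) powr \<kappa> \<le> 5 powr 1" .
  have "(4 + \<delta>) powr \<kappa> / \<kappa> - (0 + \<delta>) powr \<kappa> / \<kappa> \<le> 5 / \<kappa>"
  proof -

    have "(4 + \<delta>) powr \<kappa> / \<kappa> \<le> 5 / \<kappa>" using a p5 by (simp add: divide_right_mono)
    moreover have "0 \<le> (0 + \<delta>) powr \<kappa> / \<kappa>" using a by simp
    ultimately show ?thesis by linarith
  qed
  then have "pi * ((4 + \<delta>) powr \<kappa> / \<kappa> - (0 + \<delta>) powr \<kappa> / \<kappa>) \<le> pi * (5 / \<kappa>)" by (rule mult_left_mono) simp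
  then show "(LINT x|\<mu>. sq_dist \<delta> x y powr (\<kappa> - 1)) \<le> 5 * pi / \<kappa>"
    using h by (simp add: has_bochner_integral_iff mult.commute)
qed

section \<open>The gradient of the regularised Green function\<close>

text \<open>Smoothness of the test fields is shown by means of two classes of functions that are closed under
  directional derivatives and contain the components of the test fields.\<close>

inductive smooth_scalar :: "real \<Rightarrow> real^3 \<Rightarrow> (real^3 \<Rightarrow> real) \<Rightarrow> bool" for \<delta> y where
  const: "smooth_scalar \<delta> y (\<lambda>x. c)"
| linear: "smooth_scalar \<delta> y (\<lambda>x. x \<bullet> v)"
| add: "smooth_scalar \<delta> y f \<Longrightarrow> smooth_scalar \<delta> y g \<Longrightarrow> smooth_scalar \<delta> y (\<lambda>x. f x + g x)"
| mult: "smooth_scalar \<delta> y f \<Longrightarrow> smooth_scalar \<delta> y g \<Longrightarrow> smooth_scalar \<delta> y (\<lambda>x. f x * g x)"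
| inverse: "smooth_scalar \<delta> y (\<lambda>x. inverse (sq_dist \<delta> x y))"

inductive smooth_vector :: "real \<Rightarrow> real^3 \<Rightarrow> (real^3 \<Rightarrow> real^3) \<Rightarrow> bool" for \<delta> y where
  const: "smooth_vector \<delta> y (\<lambda>x. w)"
| ident: "smooth_vector \<delta> y (\<lambda>x. x)"
| add: "smooth_vector \<delta> y F \<Longrightarrow> smooth_vector \<delta> y G \<Longrightarrow> smooth_vector \<delta> y (\<lambda>x. F x + G x)"
| scale: "smooth_scalar \<delta> y f \<Longrightarrow> smooth_vector \<delta> y F \<Longrightarrow> smooth_vector \<delta> y (\<lambda>x. f x *\<^sub>R F x)"

lemma sq_dist_has_derivative:
  "((\<lambda>x. sq_dist \<delta> x y) has_derivative (\<lambda>v. 2 * ((x - y) \<bullet> v))) (at x)"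
  unfolding sq_dist_def power2_norm_eq_inner
  by (auto intro!: derivative_eq_intros simp: inner_commute)

lemma inverse_sq_dist_has_derivative:
  assumes "0 < \<delta>"
  shows "((\<lambda>x. inverse (sq_dist \<delta> x y)) has_derivative
    (\<lambda>v. - 2 * ((x - y) \<bullet> v) * (inverse (sq_dist \<delta> x y) * inverse (sq_dist \<delta> x y)))) (at x)"
  using sq_dist_pos[OF assms, of x y]
  by (auto intro!: derivative_eq_intros sq_dist_has_derivative)

lemma smooth_scalar_derivative:
  assumes "smooth_scalar \<delta> y f" and d: "0 < \<delta>"
  shows "\<exists>f'. (\<forall>x. (f has_derivative f' x) (at x)) \<and> (\<forall>v. smooth_scalar \<delta> y (\<lambda>x. f' x v))"
  using assms(1)
proof induction
  case (const c)
  show ?case by (rule exI[of _ "\<lambda>x v. 0"]) (auto intro: smooth_scalar.const)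
next
  case (linear v)
  show ?case
    by (rule exI[of _ "\<lambda>x w. w \<bullet> v"]) (auto intro!: smooth_scalar.const derivative_eq_intros)
next
  case (add f g)
  then obtain f' g' where "\<forall>x. (f has_derivative f' x) (at x)" "\<forall>v. smooth_scalar \<delta> y (\<lambda>x. f' x v)"
    "\<forall>x. (g has_derivative g' x) (at x)" "\<forall>v. smooth_scalar \<delta> y (\<lambda>x. g' x v)" by blast
  then show ?case
    by (intro exI[of _ "\<lambda>x v. f' x v + g' x v"]) (auto intro!: smooth_scalar.add has_derivative_add)
next
  case (mult f g)
  then obtain f' g' where "\<forall>x. (f has_derivative f' x) (at x)" "\<forall>v. smooth_scalar \<delta> y (\<lambda>x. f' x v)"
    "\<forall>x. (g has_derivative g' x) (at x)" "\<forall>v. smooth_scalar \<delta> y (\<lambda>x. g' x v)" by blast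
  with mult.hyps show ?case
    by (intro exI[of _ "\<lambda>x v. f x * g' x v + f' x v * g x"])
      (auto intro!: smooth_scalar.add smooth_scalar.mult has_derivative_mult)
next
  case inverse
  have *: "smooth_scalar \<delta> y (\<lambda>x. - 2 * ((x - y) \<bullet> v) * (inverse (sq_dist \<delta> x y) * inverse (sq_dist \<delta> x y)))" for v
  proof -
    have "smooth_scalar \<delta> y (\<lambda>x. ((-2) * (x \<bullet> v) + 2 * (y \<bullet> v)) * (inverse (sq_dist \<delta> x y) * inverse (sq_dist \<delta> x y)))"
      by (intro smooth_scalar.intros)
    then show ?thesis by (simp add: inner_diff_left algebra_simps)
  qed
  show ?case
    by (rule exI[of _ "\<lambda>x v. - 2 * ((x - y) \<bullet> v) * (inverse (sq_dist \<delta> x y) * inverse (sq_dist \<delta> x y))"])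
      (use inverse_sq_dist_has_derivative[OF d] * in blast)
qed

lemma smooth_vector_derivative:
  assumes "smooth_vector \<delta> y F" and d: "0 < \<delta>"
  shows "\<exists>F'. (\<forall>x. (F has_derivative F' x) (at x)) \<and> (\<forall>v. smooth_vector \<delta> y (\<lambda>x. F' x v))"
  using assms(1)
proof induction
  case (const c)
  show ?case by (rule exI[of _ "\<lambda>x v. 0"]) (auto intro: smooth_vector.const)
next
  case ident
  show ?case by (rule exI[of _ "\<lambda>x v. v"]) (auto intro!: smooth_vector.const derivative_eq_intros)
next
  case (add f g)
  then obtain f' g' where "\<forall>x. (f has_derivative f' x) (at x)" "\<forall>v. smooth_vector \<delta> y (\<lambda>x. f' x v)"
    "\<forall>x. (g has_derivative g' x) (at x)" "\<forall>v. smooth_vector \<delta> y (\<lambda>x. g' x v)" by blast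
  then show ?case
    by (intro exI[of _ "\<lambda>x v. f' x v + g' x v"]) (auto intro!: smooth_vector.add has_derivative_add)
next
  case (scale f g)
  then obtain g' where "\<forall>x. (g has_derivative g' x) (at x)" "\<forall>v. smooth_vector \<delta> y (\<lambda>x. g' x v)" by blast
  moreover obtain f' where "\<forall>x. (f has_derivative f' x) (at x)" "\<forall>v. smooth_scalar \<delta> y (\<lambda>x. f' x v)"
    using smooth_scalar_derivative[OF scale.hyps(1) d] by blast
  ultimately show ?case
    using scale.hyps
    by (intro exI[of _ "\<lambda>x v. f x *\<^sub>R g' x v + f' x v *\<^sub>R g x"])
      (auto intro!: smooth_vector.add smooth_vector.scale has_derivative_scaleR)
qed

text \<open>A class of differentiable maps that is closed under directional derivatives consists of smooth
  maps.\<close>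

lemma smooth_vector_k_times_cont_diff:
  assumes d: "0 < \<delta>"
  shows "smooth_vector \<delta> y F \<Longrightarrow> k_times_cont_diff n F"
proof (induction n arbitrary: F)
  case 0
  obtain F' where "\<forall>x. (F has_derivative F' x) (at x)"
    using smooth_vector_derivative[OF 0 d] by blast
  then show ?case
    by (auto intro!: continuous_at_imp_continuous_on has_derivative_continuous)
next
  case (Suc n)
  obtain F' where F': "\<forall>x. (F has_derivative F' x) (at x)" "\<forall>v. smooth_vector \<delta> y (\<lambda>x. F' x v)"
    using smooth_vector_derivative[OF Suc.prems d] by blast
  have "frechet_derivative F (at x) = F' x" for x
    using F'(1) frechet_derivative_at by metis
  then show ?case using F' Suc.IH by (auto simp: differentiable_def)
qed

text \<open>On the sphere this is the tangential gradient of
  \<open>x \<mapsto> - ln (|x - y|\<^sup>2 + \<delta>) / (4 \<pi>)\<close>, a regularised Green function with pole \<open>y\<close>; off the sphere it is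
  a convenient smooth extension.\<close>

definition green_field :: "real \<Rightarrow> real^3 \<Rightarrow> real^3 \<Rightarrow> real^3" where
  "green_field \<delta> y x = (inverse (sq_dist \<delta> x y) / (2 * pi)) *\<^sub>R (y - (x \<bullet> y) *\<^sub>R x)"

lemma smooth_tangent_green_field:
  assumes "0 < \<delta>" shows "smooth_tangent_field (green_field \<delta> y)"
proof -
  have "smooth_vector \<delta> y (\<lambda>x. (inverse (sq_dist \<delta> x y) * (1 / (2 * pi))) *\<^sub>R (y + (-1 * (x \<bullet> y)) *\<^sub>R x))"
    by (intro smooth_vector.intros smooth_scalar.intros)
  also have "(\<lambda>x. (inverse (sq_dist \<delta> x y) * (1 / (2 * pi))) *\<^sub>R (y + (-1 * (x \<bullet> y)) *\<^sub>R x)) = green_field \<delta> y"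
    by (simp add: fun_eq_iff green_field_def)
  finally have "k_times_cont_diff n (green_field \<delta> y)" for n
    by (rule smooth_vector_k_times_cont_diff[OF assms])
  moreover have "green_field \<delta> y x \<bullet> x = 0" if "x \<in> S2" for x
    using that by (simp add: green_field_def inner_diff_left inner_commute[of y x] norm_eq_1)
  ultimately show ?thesis by (simp add: smooth_tangent_field_def)
qed

text \<open>The tangential part of \<open>y\<close> at \<open>x\<close> has length at most \<open>|x - y|\<close>.\<close>

lemma norm_green_field_le:
  assumes x: "x \<in> S2" and y: "y \<in> S2" and d: "0 < \<delta>"
  shows "norm (green_field \<delta> y x) \<le> riesz_kernel \<delta> x y"
proof -
  have xx: "x \<bullet> x = 1" "y \<bullet> y = 1" using x y by (simp_all add: norm_eq_1)
  have "(norm (y - (x \<bullet> y) *\<^sub>R x))\<^sup>2 = 1 - (x \<bullet> y)\<^sup>2"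
    unfolding power2_norm_eq_inner by (simp add: inner_diff inner_commute xx power2_eq_square)
  also have "\<dots> \<le> 2 - 2 * (x \<bullet> y)"
    using zero_le_power2[of "1 - x \<bullet> y"] by (simp add: power2_diff)
  also have "\<dots> = (norm (x - y))\<^sup>2"
    by (simp add: power2_norm_eq_inner inner_diff inner_commute xx)
  also have "\<dots> \<le> sq_dist \<delta> x y" using d by (simp add: sq_dist_def)
  finally have "norm (y - (x \<bullet> y) *\<^sub>R x) \<le> sqrt (sq_dist \<delta> x y)" by (rule real_le_rsqrt)
  then have "(inverse (sq_dist \<delta> x y) / (2 * pi)) * norm (y - (x \<bullet> y) *\<^sub>R x) \<le> (inverse (sq_dist \<delta> x y) / (2 * pi)) * sqrt (sq_dist \<delta> x y)"
    using sq_dist_pos[OF d, of x y] by (intro mult_left_mono) auto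
  moreover have "norm (green_field \<delta> y x) = (inverse (sq_dist \<delta> x y) / (2 * pi)) * norm (y - (x \<bullet> y) *\<^sub>R x)"
    using sq_dist_pos[OF d, of x y] by (simp add: green_field_def)
  ultimately have "norm (green_field \<delta> y x) \<le> (inverse (sq_dist \<delta> x y) / (2 * pi)) * sqrt (sq_dist \<delta> x y)" by simp
  also have "\<dots> = riesz_kernel \<delta> x y"
    using sq_dist_pos[OF d, of x y] by (simp add: riesz_kernel_def field_simps)
  finally show ?thesis .
qed

text \<open>Up to sign and the constant \<open>1 / (4 \<pi>)\<close>, the Laplacian of the regularised Green function. The factor
  in front is what the computation of the divergence produces; it normalises the integral to 1.\<close>

definition smoothing_kernel :: "real \<Rightarrow> real^3 \<Rightarrow> real^3 \<Rightarrow> real" where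
  "smoothing_kernel \<delta> x y = (2 * \<delta> + \<delta>\<^sup>2 / 2) / (2 * pi * (sq_dist \<delta> x y)\<^sup>2)"

text \<open>The Green function of the sphere satisfies \<open>\<Delta>G = 1 / (4 \<pi>)\<close> minus a point mass; here the point
  mass is spread out to the smoothing kernel.\<close>

lemma sphere_div_green_field:
  assumes x: "x \<in> S2" and y: "y \<in> S2" and d: "0 < \<delta>"
  shows "sphere_div (green_field \<delta> y) x = 1 / (4 * pi) - smoothing_kernel \<delta> x y"
proof -
  define t where "t = x \<bullet> y"
  define Q where "Q = sq_dist \<delta> x y"
  have Q0: "Q > 0" using sq_dist_pos d by (simp add: Q_def)
  have xx: "x \<bullet> x = 1" "y \<bullet> y = 1" "y \<bullet> x = t" "x \<bullet> y = t" using x y by (simp_all add: norm_eq_1 t_def inner_commute)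
  have t: "t = 1 - (Q - \<delta>) / 2"
    by (simp add: Q_def sq_dist_def power2_norm_eq_inner inner_diff xx field_simps)
  define D where "D v = (inverse Q / (2 * pi)) *\<^sub>R (- ((v \<bullet> y) *\<^sub>R x + t *\<^sub>R v))
    + ((- 2 * ((x - y) \<bullet> v) * (inverse Q * inverse Q)) / (2 * pi)) *\<^sub>R (y - t *\<^sub>R x)" for v
  have "(green_field \<delta> y has_derivative D) (at x)"
    unfolding green_field_def[abs_def] D_def[abs_def] Q_def t_def
  proof (rule has_derivative_scaleR)
    show "((\<lambda>x. inverse (sq_dist \<delta> x y) / (2 * pi)) has_derivative
      (\<lambda>v. (- 2 * ((x - y) \<bullet> v) * (inverse (sq_dist \<delta> x y) * inverse (sq_dist \<delta> x y))) / (2 * pi))) (at x)"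
      by (rule bounded_linear.has_derivative[OF bounded_linear_divide inverse_sq_dist_has_derivative[OF d]])
    show "((\<lambda>x. y - (x \<bullet> y) *\<^sub>R x) has_derivative (\<lambda>v. - ((v \<bullet> y) *\<^sub>R x + (x \<bullet> y) *\<^sub>R v))) (at x)"
      by (auto intro!: derivative_eq_intros)
  qed
  then have "frechet_derivative (green_field \<delta> y) (at x) = D"
    using frechet_derivative_at by metis
  then have "sphere_div (green_field \<delta> y) x = (\<Sum>b\<in>Basis. D b \<bullet> b) - D x \<bullet> x"
    by (simp add: sphere_div_def)
  also have "D x \<bullet> x = - (inverse Q / (2 * pi)) * (2 * t)"
    unfolding D_def inner_add_left inner_scaleR_left inner_minus_left inner_diff_left xx by simp
  also have "(\<Sum>b\<in>Basis. D b \<bullet> b) = - (inverse Q / (2 * pi)) * (\<Sum>b\<in>Basis. (b \<bullet> y) * (x \<bullet> b))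
      - (inverse Q / (2 * pi)) * t * (\<Sum>b\<in>(Basis::(real^3) set). b \<bullet> b)
      - 2 * (inverse Q * inverse Q) / (2 * pi) * (\<Sum>b\<in>Basis. ((x - y) \<bullet> b) * ((y - t *\<^sub>R x) \<bullet> b))"
    unfolding sum_distrib_left sum_subtractf[symmetric]
  proof (intro sum.cong refl)
    fix b :: "real^3"
    define \<alpha> \<beta> where "\<alpha> = inverse Q / (2 * pi)" and "\<beta> = 2 * (inverse Q * inverse Q) / (2 * pi)"
    have "D b = \<alpha> *\<^sub>R (- ((b \<bullet> y) *\<^sub>R x + t *\<^sub>R b)) + (- \<beta> * ((x - y) \<bullet> b)) *\<^sub>R (y - t *\<^sub>R x)"
      by (simp add: D_def \<alpha>_def \<beta>_def)
    then have "D b \<bullet> b = - \<alpha> * ((b \<bullet> y) * (x \<bullet> b)) - \<alpha> * t * (b \<bullet> b) - \<beta> * (((x - y) \<bullet> b) * ((y - t *\<^sub>R x) \<bullet> b))"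
      by (simp only: inner_add_left inner_scaleR_left inner_minus_left inner_diff_left) (simp add: algebra_simps)
    then show "D b \<bullet> b = - (inverse Q / (2 * pi)) * ((b \<bullet> y) * (x \<bullet> b)) - (inverse Q / (2 * pi)) * t * (b \<bullet> b)
      - 2 * (inverse Q * inverse Q) / (2 * pi) * (((x - y) \<bullet> b) * ((y - t *\<^sub>R x) \<bullet> b))"
      unfolding \<alpha>_def \<beta>_def .
  qed
  also have "(\<Sum>b\<in>Basis. (b \<bullet> y) * (x \<bullet> b)) = t"
    using euclidean_inner[of x y] by (simp add: t_def inner_commute mult.commute)
  also have "(\<Sum>b\<in>(Basis::(real^3) set). b \<bullet> b) = 3"
    by (simp add: inner_Basis)
  also have "(\<Sum>b\<in>Basis. ((x - y) \<bullet> b) * ((y - t *\<^sub>R x) \<bullet> b)) = (x - y) \<bullet> (y - t *\<^sub>R x)"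
    by (rule euclidean_inner[symmetric])
  also have "\<dots> = t\<^sup>2 - 1"
    by (simp add: inner_simps xx power2_eq_square) (simp add: algebra_simps)
  also have "- (inverse Q / (2 * pi)) * t - (inverse Q / (2 * pi)) * t * 3 - 2 * (inverse Q * inverse Q) / (2 * pi) * (t\<^sup>2 - 1)
     - - (inverse Q / (2 * pi)) * (2 * t) = (2 * (1 - t\<^sup>2) - 2 * t * Q) / (2 * pi * Q\<^sup>2)"
    using Q0 by (simp add: field_simps power2_eq_square)
  also have "2 * (1 - t\<^sup>2) - 2 * t * Q = Q\<^sup>2 / 2 - (2 * \<delta> + \<delta>\<^sup>2 / 2)"
    unfolding t by (simp add: field_simps power2_eq_square)
  also have "(Q\<^sup>2 / 2 - (2 * \<delta> + \<delta>\<^sup>2 / 2)) / (2 * pi * Q\<^sup>2) = 1 / (4 * pi) - smoothing_kernel \<delta> x y"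
    using Q0 unfolding smoothing_kernel_def Q_def[symmetric] by (simp add: diff_divide_distrib)
  finally show ?thesis .
qed

lemma smoothing_kernel_nonneg: "0 < \<delta> \<Longrightarrow> 0 \<le> smoothing_kernel \<delta> x y"
  unfolding smoothing_kernel_def by (intro divide_nonneg_nonneg mult_nonneg_nonneg add_nonneg_nonneg) auto

lemma smoothing_kernel_commute: "smoothing_kernel \<delta> x y = smoothing_kernel \<delta> y x"
  by (simp add: smoothing_kernel_def sq_dist_commute)

text \<open>Away from the pole the kernel is \<open>O(\<delta>)\<close>.\<close>

lemma smoothing_kernel_le:
  assumes "0 < \<delta>" "\<delta> \<le> 1" "0 < r" "r \<le> norm (x - y)"
  shows "smoothing_kernel \<delta> x y \<le> 3 * \<delta> / (2 * pi * r^4)"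
proof -
  have "r\<^sup>2 \<le> (norm (x - y))\<^sup>2" using assms by (intro power_mono) auto
  then have "r\<^sup>2 \<le> sq_dist \<delta> x y" using assms unfolding sq_dist_def by linarith
  then have "(r\<^sup>2)\<^sup>2 \<le> (sq_dist \<delta> x y)\<^sup>2" by (intro power_mono) auto
  then have "r^4 \<le> (sq_dist \<delta> x y)\<^sup>2" by simp
  moreover have "\<delta>\<^sup>2 \<le> \<delta>" using assms by (simp add: power2_eq_square mult_left_le)
  ultimately show ?thesis
    unfolding smoothing_kernel_def using assms by (intro frac_le mult_left_mono) auto
qed

lemma smoothing_kernel_bounded:
  assumes "0 < \<delta>"
  shows "smoothing_kernel \<delta> x y \<le> (2 * \<delta> + \<delta>\<^sup>2 / 2) / (2 * pi * \<delta>\<^sup>2)"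
  unfolding smoothing_kernel_def using assms sq_dist_ge[of \<delta> x y]
  by (intro divide_left_mono mult_left_mono power_mono mult_pos_pos add_nonneg_nonneg) auto

lemma has_bochner_integral_smoothing_kernel:
  assumes y: "y \<in> S2" and d: "0 < \<delta>"
  shows "has_bochner_integral \<mu> (\<lambda>x. smoothing_kernel \<delta> x y) 1"
proof -
  define c where "c = (2 * \<delta> + \<delta>\<^sup>2 / 2) / (2 * pi)"
  have c: "c > 0" unfolding c_def using d by (intro divide_pos_pos add_pos_nonneg) auto
  have "has_bochner_integral \<mu>
    (\<lambda>x. c / ((norm (x - y))\<^sup>2 + \<delta>)\<^sup>2 * indicator {0..4} ((norm (x - y))\<^sup>2)) (pi * (- c / (4 + \<delta>) - - c / (0 + \<delta>)))"
    by (rule has_bochner_integral_sphere_dist[OF y, where F="\<lambda>s. - c / (s + \<delta>)" and f="\<lambda>s. c / (s + \<delta>)\<^sup>2"])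
      (use d c in \<open>auto intro!: derivative_eq_intros simp: power2_eq_square\<close>)
  moreover have "pi * (- c / (4 + \<delta>) - - c / (0 + \<delta>)) = 1"
  proof -
    have c: "c = \<delta> * (4 + \<delta>) / (4 * pi)" by (simp add: c_def field_simps power2_eq_square)
    have "c / (4 + \<delta>) = \<delta> / (4 * pi)" "c / \<delta> = (4 + \<delta>) / (4 * pi)"
      unfolding c using d by auto
    then have "pi * (- c / (4 + \<delta>) - - c / (0 + \<delta>)) = pi * ((4 + \<delta>) / (4 * pi) - \<delta> / (4 * pi))"
      by (metis add_0 add.commute diff_minus_eq_add minus_divide_left uminus_add_conv_diff)
    also have "\<dots> = 1" by (simp add: diff_divide_distrib[symmetric])
    finally show ?thesis .
  qed
  ultimately show ?thesis
    by (subst (asm) has_bochner_integral_cong[OF refl _ refl, where g="\<lambda>x. smoothing_kernel \<delta> x y"])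
      (use chord_sq_le[OF _ y] in \<open>auto simp: smoothing_kernel_def sq_dist_def c_def indicator_def\<close>)
qed

section \<open>Density of continuous functions\<close>

interpretation sphere: finite_measure \<mu>
  by (rule finite_sphere_measure)

lemma sets_sphere_measure_iff: "A \<in> sets (restrict_space borel S2) \<longleftrightarrow> A \<in> sets borel \<and> A \<subseteq> S2"
  by (auto simp: sets_restrict_space_iff)

lemma integrable_sphere_bounded:
  fixes f :: "_ \<Rightarrow> 'b::{banach, second_countable_topology}"
  assumes "f \<in> borel_measurable \<mu>" "\<And>x. x \<in> S2 \<Longrightarrow> norm (f x) \<le> B"
  shows "integrable \<mu> f"
  by (rule sphere.integrable_const_bound[where B=B]) (use assms in auto)

lemma integrable_sphere_continuous:
  assumes "continuous_on UNIV (h :: real^3 \<Rightarrow> real)"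
  shows "integrable \<mu> h"
proof -
  have "bounded (h ` S2)"
    using assms by (intro compact_imp_bounded compact_continuous_image) (auto intro: continuous_on_subset)
  then obtain B where "\<forall>x\<in>S2. norm (h x) \<le> B" by (auto simp: bounded_iff)
  then show ?thesis
    by (intro integrable_sphere_bounded[of _ B]) (auto intro: borel_measurable_sphere borel_measurable_continuous_onI assms)
qed

lemma less_add_if_ennreal_less_add:
  assumes "ennreal a < ennreal b + ennreal c" "0 \<le> b" "0 \<le> c"
  shows "a < b + c"
proof (rule ccontr)
  assume "\<not> a < b + c"
  then have "ennreal (b + c) \<le> ennreal a" by (intro ennreal_leI) simp
  with assms show False by simp
qed

text \<open>A Urysohn function between a compact set inside \<open>A\<close> and an open set around \<open>A\<close> of almost the same
  area.\<close>

lemma indicator_L1_approx: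
  assumes A: "A \<in> sets \<mu>" and e: "0 < e"
  shows "\<exists>h :: real^3 \<Rightarrow> real. continuous_on UNIV h \<and> (LINT x|\<mu>. \<bar>indicator A x - h x\<bar>) < e"
proof -
  define M where "M = distr \<mu> borel (\<lambda>x. x)"
  have M: "sets M = sets borel" "emeasure M (space M) \<noteq> \<infinity>"
    by (simp_all add: M_def emeasure_distr borel_measurable_sphere)
  have em: "emeasure M B = emeasure \<mu> (B \<inter> S2)" if "B \<in> sets borel" for B
    using that by (simp add: M_def emeasure_distr borel_measurable_sphere)
  have Ab: "A \<in> sets borel" "A \<subseteq> S2" using A by (auto simp: sets_sphere_measure_iff)
  have fin: "emeasure M B \<noteq> \<infinity>" if "B \<in> sets borel" for B
    using that by (simp add: em)
  obtain U where U: "A \<subseteq> U" "open U" "emeasure M U < emeasure M A + ennreal (e/3)"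
  proof -
    have "(INF U\<in>{U. A \<subseteq> U \<and> open U}. emeasure M U) < emeasure M A + ennreal (e/3)"
      using fin[OF Ab(1)] e by (subst outer_regular[OF M Ab(1), symmetric]) (simp add: ennreal_add_left_cancel_less[of _ 0, simplified])
    then show ?thesis using that by (auto simp: INF_less_iff)
  qed
  obtain K where K: "K \<subseteq> A" "compact K" "emeasure M A < emeasure M K + ennreal (e/3)"
  proof (cases "emeasure M A = 0")
    case True
    then show ?thesis using that[of "{}"] e by simp
  next
    case False
    have "emeasure M A - ennreal (e/3) < emeasure M A"
    proof -
      have "emeasure M A = ennreal (measure \<mu> (A \<inter> S2))" using Ab by (simp add: em sphere.emeasure_eq_measure)
      with False e show ?thesis
        using measure_nonneg[of \<mu> "A \<inter> S2"] by (auto simp: ennreal_minus intro!: ennreal_lessI simp del: measure_nonneg)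
    qed
    then have "emeasure M A - ennreal (e/3) < (SUP K\<in>{K. K \<subseteq> A \<and> compact K}. emeasure M K)"
      by (subst inner_regular[OF M Ab(1), symmetric])
    then obtain K where "K \<subseteq> A" "compact K" "emeasure M A - ennreal (e/3) < emeasure M K" by (auto simp: less_SUP_iff)
    moreover from this have eK: "emeasure M K = ennreal (measure \<mu> (K \<inter> S2))"
      "emeasure M A = ennreal (measure \<mu> (A \<inter> S2))"
      using Ab by (simp_all add: em sphere.emeasure_eq_measure borel_compact)
    ultimately have "ennreal (measure \<mu> (A \<inter> S2) - e/3) < ennreal (measure \<mu> (K \<inter> S2))"
      using e by (simp add: ennreal_minus)
    then have "measure \<mu> (A \<inter> S2) - e/3 < measure \<mu> (K \<inter> S2)"
      using ennreal_leI not_le by metis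
    then have "ennreal (measure \<mu> (A \<inter> S2)) < ennreal (measure \<mu> (K \<inter> S2) + e/3)"
      using e by (intro ennreal_lessI) (auto intro: add_nonneg_pos)
    then have "emeasure M A < emeasure M K + ennreal (e/3)" unfolding eK using e by simp
    then show ?thesis using that[of K] \<open>K \<subseteq> A\<close> \<open>compact K\<close> by blast
  qed
  have "K \<inter> - U = {}" using K U by auto
  then obtain h :: "real^3 \<Rightarrow> real" where h: "continuous_on UNIV h" "\<And>x. h x \<in> closed_segment 1 0" "\<And>x. x \<in> K \<Longrightarrow> h x = 1" "\<And>x. x \<in> - U \<Longrightarrow> h x = 0"
    using Urysohn[of K "- U" "1::real" 0] compact_imp_closed[OF K(2)] U(2) by (metis closed_Compl)
  have h01: "0 \<le> h x" "h x \<le> 1" for x using h(2)[of x] by (auto simp: closed_segment_eq_real_ivl)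
  have KUb: "K \<in> sets borel" "U \<in> sets borel" using K U by (auto intro: borel_compact)
  have D: "U \<inter> S2 - K \<in> sets \<mu>" using KUb by (auto simp: sets_sphere_measure_iff)
  have "measure \<mu> (U \<inter> S2 - K) = measure \<mu> (U \<inter> S2) - measure \<mu> (K \<inter> S2)"
    using KUb K U Ab by (subst sphere.finite_measure_Diff[symmetric]) (auto simp: sets_sphere_measure_iff intro!: arg_cong[where f="measure \<mu>"])
  moreover have "measure \<mu> (U \<inter> S2) < measure \<mu> (A \<inter> S2) + e/3"
    using U(3) KUb Ab e by (intro less_add_if_ennreal_less_add) (simp_all add: em sphere.emeasure_eq_measure)
  moreover have "measure \<mu> (A \<inter> S2) < measure \<mu> (K \<inter> S2) + e/3"
    using K(3) KUb Ab e by (intro less_add_if_ennreal_less_add) (simp_all add: em sphere.emeasure_eq_measure)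
  ultimately have D3: "measure \<mu> (U \<inter> S2 - K) < e"
    using e by linarith
  have "(LINT x|\<mu>. \<bar>indicator A x - h x\<bar>) \<le> (LINT x|\<mu>. indicator (U \<inter> S2 - K) x)"
  proof (rule integral_mono')
    show "integrable \<mu> (indicat_real (U \<inter> S2 - K))"
      using D by (simp add: sphere.emeasure_eq_measure)
    show "\<bar>indicator A x - h x\<bar> \<le> indicator (U \<inter> S2 - K) x" if "x \<in> space \<mu>" for x
      using h(3,4)[of x] h01[of x] K U that by (auto simp: indicator_def)
  qed auto
  also have "\<dots> < e" proof -
    have "(U \<inter> S2 - K) \<inter> S2 = U \<inter> S2 - K" by auto
    then show ?thesis using D D3 by simp
  qed
  finally show ?thesis using h(1) by blast
qed

lemma integrable_L1_approx:
  assumes "integrable \<mu> (f :: _ \<Rightarrow> real)" "0 < e"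
  shows "\<exists>h. continuous_on UNIV h \<and> (LINT x|\<mu>. \<bar>f x - h x\<bar>) < e"
  using assms
proof (induction arbitrary: e rule: integrable_induct)
  case (base A c)
  obtain h :: "real^3 \<Rightarrow> real" where h: "continuous_on UNIV h" "(LINT x|\<mu>. \<bar>indicator A x - h x\<bar>) < e / (\<bar>c\<bar> + 1)"
    using indicator_L1_approx[OF base(1), of "e / (\<bar>c\<bar> + 1)"] base by auto
  have "(LINT x|\<mu>. \<bar>indicator A x *\<^sub>R c - h x * c\<bar>) = \<bar>c\<bar> * (LINT x|\<mu>. \<bar>indicator A x - h x\<bar>)"
    by (subst integral_mult_right_zero[symmetric]) (auto simp: abs_mult[symmetric] algebra_simps)
  also have "\<dots> \<le> \<bar>c\<bar> * (e / (\<bar>c\<bar> + 1))" using h(2) by (intro mult_left_mono) auto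
  also have "\<dots> < e" using base(3) by (simp add: field_simps)
  finally show ?case using h(1) by (intro exI[of _ "\<lambda>x. h x * c"]) (auto intro!: continuous_intros)
next
  case (add f g)
  obtain h where h: "continuous_on UNIV h" "(LINT x|\<mu>. \<bar>f x - h x\<bar>) < e / 2"
    using add.IH(1)[of "e/2"] add.prems by auto
  obtain h' where h': "continuous_on UNIV h'" "(LINT x|\<mu>. \<bar>g x - h' x\<bar>) < e / 2"
    using add.IH(2)[of "e/2"] add.prems by auto
  note i = integrable_sphere_continuous[OF h(1)] integrable_sphere_continuous[OF h'(1)] add.hyps
  have "(LINT x|\<mu>. \<bar>f x + g x - (h x + h' x)\<bar>) \<le> (LINT x|\<mu>. \<bar>f x - h x\<bar> + \<bar>g x - h' x\<bar>)"
    by (intro integral_mono) (use i in auto)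
  also have "\<dots> = (LINT x|\<mu>. \<bar>f x - h x\<bar>) + (LINT x|\<mu>. \<bar>g x - h' x\<bar>)"
    by (intro Bochner_Integration.integral_add) (use i in auto)
  also have "\<dots> < e" using h(2) h'(2) by simp
  finally show ?case using h(1) h'(1) by (intro exI[of _ "\<lambda>x. h x + h' x"]) (auto intro!: continuous_intros)
next
  case (lim f s)
  have "(\<lambda>i. LINT x|\<mu>. \<bar>s i x - f x\<bar>) \<longlonglongrightarrow> (LINT x|\<mu>. 0)"
  proof (rule integral_dominated_convergence[where w="\<lambda>x. 3 * \<bar>f x\<bar>"])
    show "AE x in \<mu>. (\<lambda>i. \<bar>s i x - f x\<bar>) \<longlonglongrightarrow> 0"
      using lim.hyps(2) by (auto intro!: tendsto_rabs_zero LIM_zero)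
    show "AE x in \<mu>. norm \<bar>s i x - f x\<bar> \<le> 3 * \<bar>f x\<bar>" for i
      using lim.hyps(3)[of _ i] by (force intro!: AE_I2)
  qed (use lim in auto)
  then have "eventually (\<lambda>i. (LINT x|\<mu>. \<bar>s i x - f x\<bar>) < e/2) sequentially"
    by (rule order_tendstoD) (use lim.prems in simp)
  then obtain i where i: "(LINT x|\<mu>. \<bar>s i x - f x\<bar>) < e/2" by (auto simp: eventually_sequentially)
  obtain h where h: "continuous_on UNIV h" "(LINT x|\<mu>. \<bar>s i x - h x\<bar>) < e / 2"
    using lim.IH[of "e/2"] lim.prems by auto
  note j = integrable_sphere_continuous[OF h(1)] lim.hyps(1)[of i] lim.hyps(4)
  have "(LINT x|\<mu>. \<bar>f x - h x\<bar>) \<le> (LINT x|\<mu>. \<bar>s i x - f x\<bar> + \<bar>s i x - h x\<bar>)"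
    by (intro integral_mono) (use j in auto)
  also have "\<dots> = (LINT x|\<mu>. \<bar>s i x - f x\<bar>) + (LINT x|\<mu>. \<bar>s i x - h x\<bar>)"
    by (intro Bochner_Integration.integral_add) (use j in auto)
  also have "\<dots> < e" using h(2) i by simp
  finally show ?case using h(1) by blast
qed

section \<open>Smoothing at a small scale\<close>

lemma smoothing_kernel_measurable [measurable]:
  "(\<lambda>(x, y). smoothing_kernel \<delta> x y) \<in> borel_measurable (borel \<Otimes>\<^sub>M borel)"
  unfolding smoothing_kernel_def sq_dist_def by measurable

lemma sphere_pair_measurable:
  "f \<in> borel_measurable (borel \<Otimes>\<^sub>M borel) \<Longrightarrow> f \<in> borel_measurable (\<mu> \<Otimes>\<^sub>M \<mu>)"
proof -
  assume [measurable]: "f \<in> borel_measurable (borel \<Otimes>\<^sub>M borel)"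
  have [measurable]: "(\<lambda>x. x) \<in> measurable \<mu> borel" by (simp add: borel_measurable_sphere)
  have "(\<lambda>p. f (fst p, snd p)) \<in> borel_measurable (\<mu> \<Otimes>\<^sub>M \<mu>)"
  proof (rule measurable_compose[OF _ \<open>f \<in> _\<close>])
    show "(\<lambda>p. (fst p, snd p)) \<in> measurable (\<mu> \<Otimes>\<^sub>M \<mu>) (borel \<Otimes>\<^sub>M borel)"
      by (intro measurable_Pair measurable_compose[OF measurable_fst \<open>(\<lambda>x. x) \<in> _\<close>] measurable_compose[OF measurable_snd \<open>(\<lambda>x. x) \<in> _\<close>])
  qed
  then show ?thesis by simp
qed

interpretation sphere_pair: pair_sigma_finite \<mu> \<mu> ..

text \<open>The integrability hypothesis of Fubini's theorem for all kernels used below.\<close>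

lemma integrable_pair_bounded_kernel:
  fixes f :: "real^3 \<Rightarrow> real"
  assumes f: "integrable \<mu> f" and K: "case_prod K \<in> borel_measurable (\<mu> \<Otimes>\<^sub>M \<mu>)"
    and B: "\<And>x y. x \<in> S2 \<Longrightarrow> y \<in> S2 \<Longrightarrow> \<bar>K x y\<bar> \<le> B"
  shows "integrable (\<mu> \<Otimes>\<^sub>M \<mu>) (\<lambda>(x, y). f x * K x y)"
proof (rule Bochner_Integration.integrable_bound)
  have "integrable (\<mu> \<Otimes>\<^sub>M \<mu>) (\<lambda>(x, y). f x)"
  proof (rule sphere_pair.Fubini_integrable)
    show "(\<lambda>(x, y). f x) \<in> borel_measurable (\<mu> \<Otimes>\<^sub>M \<mu>)"
      using f by measurable
  qed (use f in auto)
  then have "integrable (\<mu> \<Otimes>\<^sub>M \<mu>) (\<lambda>p. f (fst p))"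
    by (simp only: case_prod_unfold)
  then show "integrable (\<mu> \<Otimes>\<^sub>M \<mu>) (\<lambda>p. B * f (fst p))"
    by (rule integrable_mult_right)
  show "(\<lambda>(x, y). f x * K x y) \<in> borel_measurable (\<mu> \<Otimes>\<^sub>M \<mu>)"
    using f K by measurable
  show "AE p in \<mu> \<Otimes>\<^sub>M \<mu>. norm (case p of (x, y) \<Rightarrow> f x * K x y) \<le> norm (B * f (fst p))"
  proof (rule AE_I2)
    fix p assume "p \<in> space (\<mu> \<Otimes>\<^sub>M \<mu>)"
    then have "\<bar>K (fst p) (snd p)\<bar> \<le> \<bar>B\<bar>" using B[of "fst p" "snd p"] by (auto simp: space_pair_measure)
    then have "\<bar>f (fst p)\<bar> * \<bar>K (fst p) (snd p)\<bar> \<le> \<bar>f (fst p)\<bar> * \<bar>B\<bar>" by (rule mult_left_mono) simp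
    then show "norm (case p of (x, y) \<Rightarrow> f x * K x y) \<le> norm (B * f (fst p))"
      by (simp add: case_prod_beta abs_mult mult.commute)
  qed
qed

definition smoothing :: "real \<Rightarrow> (real^3 \<Rightarrow> real) \<Rightarrow> real^3 \<Rightarrow> real" where
  "smoothing \<delta> f y = (LINT x|\<mu>. f x * smoothing_kernel \<delta> x y)"

lemma integrable_smoothing_kernel_pair:
  assumes f: "integrable \<mu> f" and d: "0 < \<delta>"
  shows "integrable (\<mu> \<Otimes>\<^sub>M \<mu>) (\<lambda>(x, y). f x * smoothing_kernel \<delta> x y)"
  using smoothing_kernel_nonneg[OF d] smoothing_kernel_bounded[OF d] sphere_pair_measurable[OF smoothing_kernel_measurable]
  by (intro integrable_pair_bounded_kernel[OF f, where B="(2 * \<delta> + \<delta>\<^sup>2 / 2) / (2 * pi * \<delta>\<^sup>2)"]) auto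

lemma integrable_times_smoothing_kernel:
  assumes f: "integrable \<mu> f" and d: "0 < \<delta>"
  shows "integrable \<mu> (\<lambda>x. f x * smoothing_kernel \<delta> x y)"
proof (rule Bochner_Integration.integrable_bound)
  show "integrable \<mu> (\<lambda>x. (2 * \<delta> + \<delta>\<^sup>2 / 2) / (2 * pi * \<delta>\<^sup>2) * f x)" using f by simp
  show "(\<lambda>x. f x * smoothing_kernel \<delta> x y) \<in> borel_measurable \<mu>"
    unfolding smoothing_kernel_def using f by measurable
  show "AE x in \<mu>. norm (f x * smoothing_kernel \<delta> x y) \<le> norm ((2 * \<delta> + \<delta>\<^sup>2 / 2) / (2 * pi * \<delta>\<^sup>2) * f x)"
  proof (rule AE_I2)
    fix x
    have "norm (f x * smoothing_kernel \<delta> x y) = smoothing_kernel \<delta> x y * \<bar>f x\<bar>" using smoothing_kernel_nonneg[OF d, of x y] by (simp add: abs_mult)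
    also have "\<dots> \<le> (2 * \<delta> + \<delta>\<^sup>2 / 2) / (2 * pi * \<delta>\<^sup>2) * \<bar>f x\<bar>" by (intro mult_right_mono smoothing_kernel_bounded d) auto
    also have "\<dots> \<le> norm ((2 * \<delta> + \<delta>\<^sup>2 / 2) / (2 * pi * \<delta>\<^sup>2) * f x)"
      unfolding real_norm_def abs_mult by (intro mult_right_mono abs_ge_self) auto
    finally show "norm (f x * smoothing_kernel \<delta> x y) \<le> norm ((2 * \<delta> + \<delta>\<^sup>2 / 2) / (2 * pi * \<delta>\<^sup>2) * f x)" .
  qed
qed

lemma integrable_smoothing:
  assumes f: "integrable \<mu> f" and d: "0 < \<delta>"
  shows "integrable \<mu> (smoothing \<delta> f)"
  unfolding smoothing_def[abs_def]
  by (rule sphere_pair.integrable_snd[OF integrable_smoothing_kernel_pair[OF f d]])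

text \<open>The kernel is symmetric with integral 1, so averaging does not increase the \<open>L\<^sup>1\<close> norm.\<close>

lemma smoothing_contraction:
  assumes f: "integrable \<mu> f" and d: "0 < \<delta>"
  shows "(LINT y|\<mu>. \<bar>smoothing \<delta> f y\<bar>) \<le> (LINT x|\<mu>. \<bar>f x\<bar>)"
proof -
  have af: "integrable \<mu> (\<lambda>x. \<bar>f x\<bar>)" using f by simp
  have "(LINT y|\<mu>. \<bar>smoothing \<delta> f y\<bar>) \<le> (LINT y|\<mu>. smoothing \<delta> (\<lambda>x. \<bar>f x\<bar>) y)"
  proof (rule integral_mono)
    fix y assume "y \<in> space \<mu>"
    have "\<bar>smoothing \<delta> f y\<bar> \<le> (LINT x|\<mu>. \<bar>f x * smoothing_kernel \<delta> x y\<bar>)"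
      unfolding smoothing_def by (rule integral_abs_bound)
    also have "\<dots> = smoothing \<delta> (\<lambda>x. \<bar>f x\<bar>) y"
      unfolding smoothing_def using smoothing_kernel_nonneg[OF d] by (simp add: abs_mult)
    finally show "\<bar>smoothing \<delta> f y\<bar> \<le> smoothing \<delta> (\<lambda>x. \<bar>f x\<bar>) y" .
  qed (use integrable_smoothing[OF f d] integrable_smoothing[OF af d] in auto)
  also have "\<dots> = (LINT x|\<mu>. LINT y|\<mu>. \<bar>f x\<bar> * smoothing_kernel \<delta> x y)"
    unfolding smoothing_def by (rule sphere_pair.Fubini_integral[OF integrable_smoothing_kernel_pair[OF af d]])
  also have "\<dots> = (LINT x|\<mu>. \<bar>f x\<bar>)"
  proof (rule Bochner_Integration.integral_cong[OF refl])
    fix x assume "x \<in> space \<mu>"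
    then have "(LINT y|\<mu>. smoothing_kernel \<delta> x y) = 1"
      using has_bochner_integral_smoothing_kernel[of x \<delta>] d by (simp add: smoothing_kernel_commute[of \<delta> x] has_bochner_integral_iff)
    then show "(LINT y|\<mu>. \<bar>f x\<bar> * smoothing_kernel \<delta> x y) = \<bar>f x\<bar>" by simp
  qed
  finally show ?thesis .
qed

lemma smoothing_continuous_uniform:
  assumes h: "continuous_on UNIV h" and e: "0 < e"
  shows "\<exists>\<delta>0>0. \<forall>\<delta>. 0 < \<delta> \<and> \<delta> < \<delta>0 \<longrightarrow> (\<forall>y\<in>S2. \<bar>smoothing \<delta> h y - h y\<bar> \<le> e)"
proof -
  have hc: "continuous_on S2 h" using h by (rule continuous_on_subset) simp
  have "uniformly_continuous_on S2 h" by (rule compact_uniformly_continuous[OF hc]) simp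
  then obtain r where r: "r > 0" "\<And>x y. x \<in> S2 \<Longrightarrow> y \<in> S2 \<Longrightarrow> dist x y < r \<Longrightarrow> dist (h x) (h y) < e / 2"
    unfolding uniformly_continuous_on_def using e by (metis half_gt_zero)
  have "bounded (h ` S2)" by (intro compact_imp_bounded compact_continuous_image hc) simp
  then obtain B where B: "B > 0" "\<forall>x\<in>S2. \<bar>h x\<bar> \<le> B" by (auto simp: bounded_pos)
  \<comment> \<open>points at distance at least \<open>r\<close> contribute at most \<open>12 B \<delta> / r\<^sup>4\<close>, which has to be below \<open>e / 2\<close>\<close>
  define \<delta>0 where "\<delta>0 = min 1 (e * r^4 / (24 * B))"
  have "\<bar>smoothing \<delta> h y - h y\<bar> \<le> e" if d: "0 < \<delta>" "\<delta> < \<delta>0" and y: "y \<in> S2" for \<delta> y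
  proof -
    note ih = integrable_sphere_continuous[OF h]
    have iP: "integrable \<mu> (\<lambda>x. smoothing_kernel \<delta> x y)" "(LINT x|\<mu>. smoothing_kernel \<delta> x y) = 1"
      using has_bochner_integral_smoothing_kernel[OF y d(1)] by (auto simp: has_bochner_integral_iff)
    have i: "integrable \<mu> (\<lambda>x. (h x - h y) * smoothing_kernel \<delta> x y)"
      by (intro integrable_times_smoothing_kernel d) (use ih in auto)
    have "smoothing \<delta> h y - h y = (LINT x|\<mu>. h x * smoothing_kernel \<delta> x y) - (LINT x|\<mu>. h y * smoothing_kernel \<delta> x y)"
      using iP by (simp add: smoothing_def)
    also have "\<dots> = (LINT x|\<mu>. h x * smoothing_kernel \<delta> x y - h y * smoothing_kernel \<delta> x y)"
      by (intro Bochner_Integration.integral_diff[symmetric] integrable_times_smoothing_kernel ih d) (use iP in auto)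
    also have "\<dots> = (LINT x|\<mu>. (h x - h y) * smoothing_kernel \<delta> x y)" by (simp add: left_diff_distrib)
    finally have "\<bar>smoothing \<delta> h y - h y\<bar> \<le> (LINT x|\<mu>. \<bar>(h x - h y) * smoothing_kernel \<delta> x y\<bar>)"
      by (metis integral_abs_bound)
    also have "\<dots> \<le> (LINT x|\<mu>. e/2 * smoothing_kernel \<delta> x y + 2 * B * (3 * \<delta> / (2 * pi * r^4)))"
    proof (rule integral_mono)
      fix x assume "x \<in> space \<mu>"
      then have x: "x \<in> S2" by simp
      show "\<bar>(h x - h y) * smoothing_kernel \<delta> x y\<bar> \<le> e/2 * smoothing_kernel \<delta> x y + 2 * B * (3 * \<delta> / (2 * pi * r^4))"
      proof (cases "dist x y < r")
        case True
        then have "\<bar>h x - h y\<bar> \<le> e/2" using r(2)[OF x y] by (simp add: dist_real_def)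
        then have "\<bar>(h x - h y) * smoothing_kernel \<delta> x y\<bar> \<le> e/2 * smoothing_kernel \<delta> x y"
          using smoothing_kernel_nonneg[OF d(1), of x y] mult_right_mono[of "\<bar>h x - h y\<bar>" "e/2" "smoothing_kernel \<delta> x y"] by (simp add: abs_mult)
        moreover have "0 \<le> 2 * B * (3 * \<delta> / (2 * pi * r^4))" using B d r by simp
        ultimately show ?thesis by linarith
      next
        case False
        have "\<bar>h x - h y\<bar> \<le> 2 * B" using B(2) x y by (smt (verit))
        moreover have "smoothing_kernel \<delta> x y \<le> 3 * \<delta> / (2 * pi * r^4)"
          using False d r by (intro smoothing_kernel_le) (auto simp: \<delta>0_def dist_norm)
        ultimately have "\<bar>(h x - h y) * smoothing_kernel \<delta> x y\<bar> \<le> 2 * B * (3 * \<delta> / (2 * pi * r^4))"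
          using smoothing_kernel_nonneg[OF d(1), of x y] B unfolding abs_mult by (intro mult_mono) auto
        moreover have "0 \<le> e/2 * smoothing_kernel \<delta> x y" using smoothing_kernel_nonneg[OF d(1), of x y] e by simp
        ultimately show ?thesis by linarith
      qed
    qed (use i iP in auto)
    also have "\<dots> = e/2 + 2 * B * (3 * \<delta> / (2 * pi * r^4)) * (4 * pi)"
      using iP emeasure_sphere_measure_total by (subst Bochner_Integration.integral_add) (auto simp: measure_def)
    also have "\<dots> = e/2 + 12 * B * \<delta> / r^4" by (simp add: field_simps)
    also have "\<dots> \<le> e/2 + e/2"
    proof -
      have "\<delta> \<le> e * r^4 / (24 * B)" using d by (simp add: \<delta>0_def)
      then have "12 * B * \<delta> / r^4 \<le> e/2" using B(1) r(1) by (simp add: field_simps)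
      then show ?thesis by simp
    qed
    finally show ?thesis by simp
  qed
  moreover have "\<delta>0 > 0" using B(1) r(1) e by (simp add: \<delta>0_def)
  ultimately show ?thesis by blast
qed

text \<open>Continuous functions converge uniformly; the contraction property extends the convergence to the
  closure of the continuous functions in \<open>L\<^sup>1\<close>.\<close>

lemma smoothing_tendsto_L1:
  assumes f: "integrable \<mu> f" and d: "\<And>n. 0 < \<delta> n" "\<delta> \<longlonglongrightarrow> 0"
  shows "(\<lambda>n. LINT y|\<mu>. \<bar>smoothing (\<delta> n) f y - f y\<bar>) \<longlonglongrightarrow> 0"
proof (rule order_tendstoI)
  fix e :: real assume e: "0 < e"
  obtain h where h: "continuous_on UNIV h" "(LINT x|\<mu>. \<bar>f x - h x\<bar>) < e / 4"
    using integrable_L1_approx[OF f, of "e/4"] e by auto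
  note ih = integrable_sphere_continuous[OF h(1)]
  obtain \<delta>0 where \<delta>0: "\<delta>0 > 0" "\<And>\<delta> y. 0 < \<delta> \<Longrightarrow> \<delta> < \<delta>0 \<Longrightarrow> y \<in> S2 \<Longrightarrow> \<bar>smoothing \<delta> h y - h y\<bar> \<le> e / (16 * pi)"
    using smoothing_continuous_uniform[OF h(1), of "e / (16 * pi)"] e by auto
  have "eventually (\<lambda>n. \<delta> n < \<delta>0) sequentially" by (rule order_tendstoD(2)[OF d(2) \<delta>0(1)])
  then show "eventually (\<lambda>n. (LINT y|\<mu>. \<bar>smoothing (\<delta> n) f y - f y\<bar>) < e) sequentially"
  proof eventually_elim
    case (elim n)
    have i: "integrable \<mu> (\<lambda>x. f x - h x)" using f ih by simp
    have split: "smoothing (\<delta> n) f y - f y = smoothing (\<delta> n) (\<lambda>x. f x - h x) y + (smoothing (\<delta> n) h y - h y) + (h y - f y)" for y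
      unfolding smoothing_def left_diff_distrib
      by (subst Bochner_Integration.integral_diff) (auto intro: integrable_times_smoothing_kernel f ih d)
    note j = integrable_smoothing[OF i d(1)[of n]] integrable_smoothing[OF ih d(1)[of n]] f ih
    have "(LINT y|\<mu>. \<bar>smoothing (\<delta> n) f y - f y\<bar>)
       \<le> (LINT y|\<mu>. \<bar>smoothing (\<delta> n) (\<lambda>x. f x - h x) y\<bar> + e / (16 * pi) + \<bar>f y - h y\<bar>)"
    proof (rule integral_mono)
      show "\<bar>smoothing (\<delta> n) f y - f y\<bar> \<le> \<bar>smoothing (\<delta> n) (\<lambda>x. f x - h x) y\<bar> + e / (16 * pi) + \<bar>f y - h y\<bar>"
        if "y \<in> space \<mu>" for y
        using \<delta>0(2)[OF d(1)[of n] elim, of y] that unfolding split by simp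
    qed (use j integrable_smoothing[OF f d(1)[of n]] in auto)
    also have "\<dots> = (LINT y|\<mu>. \<bar>smoothing (\<delta> n) (\<lambda>x. f x - h x) y\<bar>) + e / 4 + (LINT y|\<mu>. \<bar>f y - h y\<bar>)"
      using j emeasure_sphere_measure_total by (simp add: measure_def)
    also have "\<dots> \<le> (LINT y|\<mu>. \<bar>f y - h y\<bar>) + e / 4 + (LINT y|\<mu>. \<bar>f y - h y\<bar>)"
      using smoothing_contraction[OF i d(1)[of n]] by simp
    also have "\<dots> < e" using h(2) e by simp
    finally show ?case .
  qed
next
  fix a :: real assume "a < 0"
  then show "eventually (\<lambda>n. a < (LINT y|\<mu>. \<bar>smoothing (\<delta> n) f y - f y\<bar>)) sequentially"
    by (intro always_eventually allI) (rule less_le_trans, assumption, rule integral_nonneg_AE, simp)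
qed

text \<open>The definition of the weak gradient, tested with the gradient of the Green function. The constant
  part of its divergence disappears because \<open>u\<close> has mean zero.\<close>

lemma smoothing_eq_gradient:
  assumes u: "integrable \<mu> u" "(LINT x|\<mu>. u x) = 0" and G: "has_weak_gradient u G"
    and y: "y \<in> S2" and d: "0 < \<delta>"
  shows "smoothing \<delta> u y = (LINT x|\<mu>. G x \<bullet> green_field \<delta> y x)"
proof -
  have "- (LINT x|\<mu>. G x \<bullet> green_field \<delta> y x) = (LINT x|\<mu>. u x * sphere_div (green_field \<delta> y) x)"
    using G smooth_tangent_green_field[OF d] by (simp add: has_weak_gradient_def)
  also have "\<dots> = (LINT x|\<mu>. u x * (1 / (4 * pi)) - u x * smoothing_kernel \<delta> x y)"
    by (intro Bochner_Integration.integral_cong refl) (use sphere_div_green_field[OF _ y d] in \<open>simp add: right_diff_distrib\<close>)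
  also have "\<dots> = (LINT x|\<mu>. u x * (1 / (4 * pi))) - (LINT x|\<mu>. u x * smoothing_kernel \<delta> x y)"
    by (intro Bochner_Integration.integral_diff integrable_times_smoothing_kernel u d) (use u in auto)
  also have "(LINT x|\<mu>. u x * (1 / (4 * pi))) = 0" using u(2) by simp
  finally show ?thesis by (simp add: smoothing_def)
qed

section \<open>Entropy and logarithmic energy\<close>

lemma integrable_mult_bounded:
  fixes f \<rho> :: "real^3 \<Rightarrow> real"
  assumes f: "integrable \<mu> f" and "\<rho> \<in> borel_measurable \<mu>"
    and B: "\<And>x. x \<in> S2 \<Longrightarrow> \<bar>\<rho> x\<bar> \<le> B"
  shows "integrable \<mu> (\<lambda>x. \<rho> x * f x)"
proof (rule Bochner_Integration.integrable_bound)
  show "integrable \<mu> (\<lambda>x. B * f x)" using f by simp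
  show "(\<lambda>x. \<rho> x * f x) \<in> borel_measurable \<mu>" using assms by measurable
  show "AE x in \<mu>. norm (\<rho> x * f x) \<le> norm (B * f x)"
  proof (rule AE_I2)
    fix x assume "x \<in> space \<mu>"
    then have "\<bar>\<rho> x\<bar> \<le> \<bar>B\<bar>" using B[of x] by simp
    then show "norm (\<rho> x * f x) \<le> norm (B * f x)" by (simp add: abs_mult mult_right_mono)
  qed
qed

text \<open>Since \<open>ln \<rho> = 2 v - ln Z\<close> on \<open>\<Omega>\<close>, this is \<open>\<integral>\<rho> \<psi> - \<integral>\<rho> ln \<rho> \<le> ln \<integral>e\<^sup>\<psi>\<close>. It is obtained by integrating
  \<open>a \<le> e\<^sup>a - 1\<close> against \<open>\<rho>\<close>, with \<open>a\<close> chosen such that \<open>\<rho> e\<^sup>a\<close> is a constant multiple of \<open>e\<^sup>\<psi>\<close> on \<open>\<Omega>\<close>.\<close>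

lemma gibbs_variational:
  fixes v \<psi> \<rho> :: "real^3 \<Rightarrow> real" and Z :: real
  assumes [measurable]: "v \<in> borel_measurable \<mu>" "\<psi> \<in> borel_measurable \<mu>"
    and vB: "\<And>x. x \<in> S2 \<Longrightarrow> \<bar>v x\<bar> \<le> V" and pB: "\<And>x. x \<in> S2 \<Longrightarrow> \<bar>\<psi> x\<bar> \<le> W"
    and [measurable]: "\<rho> \<in> borel_measurable \<mu>"
    and rho: "\<And>x. x \<in> S2 \<Longrightarrow> \<rho> x = indicator \<Omega> x * exp (2 * v x) / Z" "(LINT x|\<mu>. \<rho> x) = 1" and Z: "Z > 0"
  shows "ln Z \<le> 2 * (LINT x|\<mu>. \<rho> x * v x) - (LINT x|\<mu>. \<rho> x * \<psi> x)
    + ln (LINT x|\<mu>. exp (\<psi> x))"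
proof -
  have rB: "0 \<le> \<rho> x \<and> \<rho> x \<le> exp (2 * V) / Z" if "x \<in> S2" for x
    using that rho(1)[OF that] vB[OF that] Z by (auto simp: indicator_def intro!: divide_right_mono)
  have ir: "integrable \<mu> \<rho>"
    by (rule integrable_sphere_bounded[where B="exp (2 * V) / Z"]) (use rB in auto)
  have iv: "integrable \<mu> v" "integrable \<mu> \<psi>"
    by (rule integrable_sphere_bounded[where B=V], use vB in auto)
      (rule integrable_sphere_bounded[where B=W], use pB in auto)
  have irv: "integrable \<mu> (\<lambda>x. \<rho> x * v x)" "integrable \<mu> (\<lambda>x. \<rho> x * \<psi> x)"
    by (intro integrable_mult_bounded[where B="exp (2 * V) / Z"] iv; use rB in force)+
  have ie: "integrable \<mu> (\<lambda>x. exp (\<psi> x))"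
    by (rule integrable_sphere_bounded[where B="exp W"]) (use pB in \<open>auto simp: abs_le_iff\<close>)
  have "(LINT x|\<mu>. exp (- W)) \<le> (LINT x|\<mu>. exp (\<psi> x))"
  proof (intro integral_mono ie)
    show "exp (- W) \<le> exp (\<psi> x)" if "x \<in> space \<mu>" for x
      using pB[of x] that by (auto simp: abs_le_iff)
  qed auto
  moreover have "(LINT x|\<mu>. exp (- W)) > 0"
    using emeasure_sphere_measure_total by (simp add: measure_def)
  ultimately have pos: "(LINT x|\<mu>. exp (\<psi> x)) > 0" by linarith
  define c where "c = ln (LINT x|\<mu>. exp (\<psi> x))"
  have ec: "exp (- c) * (LINT x|\<mu>. exp (\<psi> x)) = 1"
    using pos by (simp add: c_def exp_minus)
  have "(LINT x|\<mu>. \<rho> x * \<psi> x - 2 * (\<rho> x * v x) + (ln Z - c) * \<rho> x) \<le> (LINT x|\<mu>. exp (- c) * exp (\<psi> x) - \<rho> x)"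
  proof (rule integral_mono)
    fix x assume "x \<in> space \<mu>"
    then have x: "x \<in> S2" by simp
    \<comment> \<open>on \<open>\<Omega>\<close> this is the logarithm of \<open>e\<^sup>\<psi> / \<integral>e\<^sup>\<psi>\<close> relative to \<open>\<rho>\<close>\<close>
    define a where "a = \<psi> x - 2 * v x + (ln Z - c)"
    have "\<rho> x * \<psi> x - 2 * (\<rho> x * v x) + (ln Z - c) * \<rho> x = \<rho> x * a" by (simp add: a_def algebra_simps)
    also have "\<dots> \<le> \<rho> x * (exp a - 1)"
    proof (rule mult_left_mono)
      show "a \<le> exp a - 1" using exp_ge_add_one_self[of a] by linarith
    qed (use rB[OF x] in simp)
    also have "\<dots> = \<rho> x * exp a - \<rho> x" by (simp add: algebra_simps)
    also have "\<rho> x * exp a = indicator \<Omega> x * (exp (- c) * exp (\<psi> x))"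
      unfolding rho(1)[OF x] a_def using Z by (simp add: exp_add exp_diff exp_minus field_simps)
    also have "\<dots> \<le> exp (- c) * exp (\<psi> x)" by (simp add: indicator_def)
    finally show "\<rho> x * \<psi> x - 2 * (\<rho> x * v x) + (ln Z - c) * \<rho> x \<le> exp (- c) * exp (\<psi> x) - \<rho> x" by simp
  qed (use irv ir ie in auto)
  also have "\<dots> = 0" using ie ir rho(2) ec by simp
  finally show ?thesis using irv ir rho(2) by (simp add: c_def)
qed

lemma riesz_kernel_nonneg: "0 < \<delta> \<Longrightarrow> 0 \<le> riesz_kernel \<delta> x y"
  using sq_dist_pos[of \<delta> x y] by (simp add: riesz_kernel_def)

lemma riesz_kernel_commute: "riesz_kernel \<delta> x y = riesz_kernel \<delta> y x"
  by (simp add: riesz_kernel_def sq_dist_commute)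

lemma riesz_kernel_le: "0 < \<delta> \<Longrightarrow> riesz_kernel \<delta> x y \<le> 1 / (2 * pi * sqrt \<delta>)"
  unfolding riesz_kernel_def using sq_dist_ge[of \<delta> x y] by (intro frac_le mult_left_mono) auto

lemma riesz_kernel_abs_le: "0 < \<delta> \<Longrightarrow> \<bar>riesz_kernel \<delta> x y\<bar> \<le> 1 / (2 * pi * sqrt \<delta>)"
  using riesz_kernel_nonneg[of \<delta> x y] riesz_kernel_le[of \<delta> x y] by simp

lemma sq_dist_pair_measurable [measurable]: "(\<lambda>(x, y). sq_dist \<delta> x y) \<in> borel_measurable (borel \<Otimes>\<^sub>M borel)"
  unfolding sq_dist_def by measurable

lemma riesz_kernel_measurable [measurable]: "(\<lambda>(x, y). riesz_kernel \<delta> x y) \<in> borel_measurable (borel \<Otimes>\<^sub>M borel)"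
  "(\<lambda>x. riesz_kernel \<delta> x y) \<in> borel_measurable borel"
  unfolding riesz_kernel_def by measurable

definition riesz_potential :: "real \<Rightarrow> (real^3 \<Rightarrow> real) \<Rightarrow> real^3 \<Rightarrow> real" where
  "riesz_potential \<delta> f y = (LINT x|\<mu>. f x * riesz_kernel \<delta> x y)"

lemma integrable_times_riesz_kernel:
  assumes f: "integrable \<mu> f" and d: "0 < \<delta>"
  shows "integrable \<mu> (\<lambda>x. f x * riesz_kernel \<delta> x y)"
proof -
  have "integrable \<mu> (\<lambda>x. riesz_kernel \<delta> x y * f x)"
    using f by (intro integrable_mult_bounded[where B="1 / (2 * pi * sqrt \<delta>)"] riesz_kernel_abs_le d)
      (auto intro: borel_measurable_sphere)
  then show ?thesis by (simp add: mult.commute)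
qed

lemma integrable_riesz_potential_kernel:
  assumes f: "integrable \<mu> f" and d: "0 < \<delta>"
  shows "integrable (\<mu> \<Otimes>\<^sub>M \<mu>) (\<lambda>(x, y). f x * riesz_kernel \<delta> x y)"
  using riesz_kernel_abs_le[OF d] sphere_pair_measurable[OF riesz_kernel_measurable(1)]
  by (intro integrable_pair_bounded_kernel[OF f]) auto

lemma integrable_riesz_potential:
  assumes f: "integrable \<mu> f" and d: "0 < \<delta>"
  shows "integrable \<mu> (riesz_potential \<delta> f)"
  unfolding riesz_potential_def[abs_def] by (rule sphere_pair.integrable_snd[OF integrable_riesz_potential_kernel[OF f d]])

lemma riesz_potential_bounded:
  assumes f: "integrable \<mu> f" and d: "0 < \<delta>"
  shows "\<bar>riesz_potential \<delta> f y\<bar> \<le> (LINT x|\<mu>. \<bar>f x\<bar>) * (1 / (2 * pi * sqrt \<delta>))"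
proof -
  have "\<bar>riesz_potential \<delta> f y\<bar> \<le> (LINT x|\<mu>. \<bar>f x * riesz_kernel \<delta> x y\<bar>)"
    unfolding riesz_potential_def by (rule integral_abs_bound)
  also have "\<dots> \<le> (LINT x|\<mu>. \<bar>f x\<bar> * (1 / (2 * pi * sqrt \<delta>)))"
  proof (rule integral_mono)
    show "integrable \<mu> (\<lambda>x. \<bar>f x * riesz_kernel \<delta> x y\<bar>)" using integrable_times_riesz_kernel[OF f d] by simp
    show "\<bar>f x * riesz_kernel \<delta> x y\<bar> \<le> \<bar>f x\<bar> * (1 / (2 * pi * sqrt \<delta>))" for x
      unfolding abs_mult by (intro mult_left_mono riesz_kernel_abs_le d) auto
  qed (use f in auto)
  finally show ?thesis by simp
qed

lemma riesz_potential_adjoint: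
  assumes g: "integrable \<mu> g" and r: "\<rho> \<in> borel_measurable \<mu>"
    and B: "\<And>x. x \<in> S2 \<Longrightarrow> \<bar>\<rho> x\<bar> \<le> B" and d: "0 < \<delta>"
  shows "(LINT x|\<mu>. g x * riesz_potential \<delta> \<rho> x) = (LINT y|\<mu>. \<rho> y * riesz_potential \<delta> g y)"
proof -
  have i: "integrable (\<mu> \<Otimes>\<^sub>M \<mu>) (\<lambda>(x, y). g x * (riesz_kernel \<delta> x y * \<rho> y))"
  proof (rule integrable_pair_bounded_kernel[OF g, where B="1 / (2 * pi * sqrt \<delta>) * B"])
    show "(\<lambda>(x, y). riesz_kernel \<delta> x y * \<rho> y) \<in> borel_measurable (\<mu> \<Otimes>\<^sub>M \<mu>)"
      using sphere_pair_measurable[OF riesz_kernel_measurable(1), of \<delta>] r by measurable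
    show "\<bar>riesz_kernel \<delta> x y * \<rho> y\<bar> \<le> 1 / (2 * pi * sqrt \<delta>) * B" if "x \<in> S2" "y \<in> S2" for x y
      unfolding abs_mult using B[OF that(2)] d by (intro mult_mono riesz_kernel_abs_le) auto
  qed
  have "(LINT x|\<mu>. g x * riesz_potential \<delta> \<rho> x) = (LINT x|\<mu>. LINT y|\<mu>. g x * (riesz_kernel \<delta> x y * \<rho> y))"
    unfolding riesz_potential_def by (simp add: riesz_kernel_commute[of \<delta> x y for x y] mult.commute)
  also have "\<dots> = (LINT y|\<mu>. LINT x|\<mu>. g x * (riesz_kernel \<delta> x y * \<rho> y))"
    by (rule sphere_pair.Fubini_integral[OF i, symmetric])
  also have "\<dots> = (LINT y|\<mu>. LINT x|\<mu>. \<rho> y * (g x * riesz_kernel \<delta> x y))"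
    by (simp add: mult_ac)
  also have "\<dots> = (LINT y|\<mu>. \<rho> y * riesz_potential \<delta> g y)"
    unfolding riesz_potential_def by simp
  finally show ?thesis .
qed

definition bounded_density :: "(real^3 \<Rightarrow> real) \<Rightarrow> bool" where
  "bounded_density \<rho> \<longleftrightarrow> \<rho> \<in> borel_measurable \<mu> \<and> (\<forall>x\<in>S2. 0 \<le> \<rho> x) \<and>
    (\<exists>B. \<forall>x\<in>S2. \<rho> x \<le> B) \<and> (LINT x|\<mu>. \<rho> x) = 1"

lemma bounded_densityD:
  assumes "bounded_density \<rho>"
  obtains B where "\<rho> \<in> borel_measurable \<mu>" "\<And>x. x \<in> S2 \<Longrightarrow> 0 \<le> \<rho> x" "\<And>x. x \<in> S2 \<Longrightarrow> \<bar>\<rho> x\<bar> \<le> B"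
    "integrable \<mu> \<rho>" "(LINT x|\<mu>. \<rho> x) = 1"
proof -
  from assms obtain B where B: "\<rho> \<in> borel_measurable \<mu>" "\<forall>x\<in>S2. 0 \<le> \<rho> x" "\<forall>x\<in>S2. \<rho> x \<le> B" "(LINT x|\<mu>. \<rho> x) = 1"
    by (auto simp: bounded_density_def)
  moreover have "integrable \<mu> \<rho>"
    by (rule integrable_sphere_bounded[where B=B]) (use B in auto)
  ultimately show ?thesis by (intro that[of B]) auto
qed

text \<open>The constant 20 makes the kernel nonnegative, as the regularised squared distance is at most 5 for
  \<open>\<delta> \<le> 1\<close>.\<close>

definition log_kernel :: "real \<Rightarrow> real^3 \<Rightarrow> real^3 \<Rightarrow> real" where
  "log_kernel \<delta> x y = ln (20 / sq_dist \<delta> x y)"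

lemma log_kernel_measurable [measurable]: "(\<lambda>(x, y). log_kernel \<delta> x y) \<in> borel_measurable (borel \<Otimes>\<^sub>M borel)"
  "(\<lambda>x. log_kernel \<delta> x y) \<in> borel_measurable borel"
  unfolding log_kernel_def by measurable

lemma log_kernel_nonneg: "0 < \<delta> \<Longrightarrow> \<delta> \<le> 1 \<Longrightarrow> x \<in> S2 \<Longrightarrow> y \<in> S2 \<Longrightarrow> 0 \<le> log_kernel \<delta> x y"
  unfolding log_kernel_def using sq_dist_pos[of \<delta> x y] sq_dist_le[of x y \<delta>] by (intro ln_ge_zero) (simp add: field_simps)

lemma log_kernel_le: "0 < \<delta> \<Longrightarrow> log_kernel \<delta> x y \<le> ln (20 / \<delta>)"
  unfolding log_kernel_def using sq_dist_pos[of \<delta> x y] sq_dist_ge[of \<delta> x y] by (intro ln_mono frac_le) auto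

lemma log_kernel_abs_le: "0 < \<delta> \<Longrightarrow> \<delta> \<le> 1 \<Longrightarrow> x \<in> S2 \<Longrightarrow> y \<in> S2 \<Longrightarrow> \<bar>log_kernel \<delta> x y\<bar> \<le> ln (20 / \<delta>)"
  using log_kernel_nonneg[of \<delta> x y] log_kernel_le[of \<delta> x y] by simp

definition log_potential :: "real \<Rightarrow> (real^3 \<Rightarrow> real) \<Rightarrow> real^3 \<Rightarrow> real" where
  "log_potential \<delta> \<rho> y = (LINT x|\<mu>. \<rho> x * log_kernel \<delta> x y)"

definition log_energy :: "real \<Rightarrow> (real^3 \<Rightarrow> real) \<Rightarrow> (real^3 \<Rightarrow> real) \<Rightarrow> real" where
  "log_energy \<delta> \<rho> \<rho>' = (LINT y|\<mu>. \<rho>' y * log_potential \<delta> \<rho> y)"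

lemma integrable_log_potential:
  assumes "integrable \<mu> \<rho>" "0 < \<delta>" "\<delta> \<le> 1"
  shows "integrable \<mu> (log_potential \<delta> \<rho>)"
  unfolding log_potential_def[abs_def]
  using log_kernel_abs_le[OF assms(2,3)] sphere_pair_measurable[OF log_kernel_measurable(1)]
  by (intro sphere_pair.integrable_snd integrable_pair_bounded_kernel[OF assms(1)]) auto

lemma integrable_times_log_kernel:
  assumes f: "integrable \<mu> f" and d: "0 < \<delta>" "\<delta> \<le> 1" and y: "y \<in> S2"
  shows "integrable \<mu> (\<lambda>x. f x * log_kernel \<delta> x y)"
proof -
  have "integrable \<mu> (\<lambda>x. log_kernel \<delta> x y * f x)"
    using f log_kernel_abs_le[OF d _ y] by (intro integrable_mult_bounded)
      (auto intro: borel_measurable_sphere)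
  then show ?thesis by (simp add: mult.commute)
qed

lemma riesz_potential_twice_le:
  assumes r: "bounded_density \<rho>" and d: "0 < \<delta>" "\<delta> \<le> 1" and y: "y \<in> S2"
  shows "riesz_potential \<delta> (riesz_potential \<delta> \<rho>) y \<le> 1 / (4 * pi) * log_potential \<delta> \<rho> y + 1 / pi"
proof -
  obtain B where r: "\<rho> \<in> borel_measurable \<mu>" "\<And>x. x \<in> S2 \<Longrightarrow> 0 \<le> \<rho> x" "\<And>x. x \<in> S2 \<Longrightarrow> \<bar>\<rho> x\<bar> \<le> B"
    "integrable \<mu> \<rho>" "(LINT x|\<mu>. \<rho> x) = 1" by (rule bounded_densityD[OF r]) (rule that)
  have ik: "integrable \<mu> (\<lambda>x. riesz_kernel \<delta> x y)"
    by (rule integrable_sphere_bounded[where B="1 / (2 * pi * sqrt \<delta>)"]) (use riesz_kernel_abs_le[OF d(1)] in \<open>auto intro: borel_measurable_sphere\<close>)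
  have "riesz_potential \<delta> (riesz_potential \<delta> \<rho>) y = (LINT x|\<mu>. riesz_kernel \<delta> x y * riesz_potential \<delta> \<rho> x)"
    by (simp add: riesz_potential_def mult.commute)
  also have "\<dots> = (LINT z|\<mu>. \<rho> z * riesz_potential \<delta> (\<lambda>x. riesz_kernel \<delta> x y) z)"
    by (rule riesz_potential_adjoint[OF ik r(1,3) d(1)])
  also have "\<dots> \<le> (LINT z|\<mu>. 1 / (4 * pi) * (\<rho> z * log_kernel \<delta> z y) + 1 / pi * \<rho> z)"
  proof (rule integral_mono)
    show "integrable \<mu> (\<lambda>z. \<rho> z * riesz_potential \<delta> (\<lambda>x. riesz_kernel \<delta> x y) z)"
      by (intro integrable_mult_bounded[where B=B] integrable_riesz_potential ik d r)
    show "integrable \<mu> (\<lambda>z. 1 / (4 * pi) * (\<rho> z * log_kernel \<delta> z y) + 1 / pi * \<rho> z)"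
      by (intro Bochner_Integration.integrable_add integrable_mult_right integrable_times_log_kernel r d y)
    fix z assume "z \<in> space \<mu>"
    then have z: "z \<in> S2" by simp
    have "riesz_potential \<delta> (\<lambda>x. riesz_kernel \<delta> x y) z \<le> 1 / (4 * pi) * log_kernel \<delta> z y + 1 / pi"
      using integral_riesz_kernel_product_le[OF y z d] by (simp add: riesz_potential_def log_kernel_def sq_dist_commute)
    then have "\<rho> z * riesz_potential \<delta> (\<lambda>x. riesz_kernel \<delta> x y) z \<le> \<rho> z * (1 / (4 * pi) * log_kernel \<delta> z y + 1 / pi)"
      using r(2)[OF z] by (rule mult_left_mono)
    then show "\<rho> z * riesz_potential \<delta> (\<lambda>x. riesz_kernel \<delta> x y) z \<le> 1 / (4 * pi) * (\<rho> z * log_kernel \<delta> z y) + 1 / pi * \<rho> z"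
      by (simp add: algebra_simps)
  qed
  also have "\<dots> = 1 / (4 * pi) * log_potential \<delta> \<rho> y + 1 / pi * (LINT z|\<mu>. \<rho> z)"
    unfolding log_potential_def
    by (subst Bochner_Integration.integral_add) (use integrable_times_log_kernel[OF r(4) d y] r(4) in auto)
  finally show ?thesis using r(5) by simp
qed

text \<open>The scalar product of two potentials is a double integral against the kernel of the squared operator,
  and that kernel is bounded by the logarithm.\<close>

lemma riesz_energy_le:
  assumes r: "bounded_density \<rho>" and r': "bounded_density \<rho>'" and d: "0 < \<delta>" "\<delta> \<le> 1"
  shows "(LINT x|\<mu>. riesz_potential \<delta> \<rho> x * riesz_potential \<delta> \<rho>' x) \<le> 1 / (4 * pi) * log_energy \<delta> \<rho> \<rho>' + 1 / pi"
proof -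
  obtain B where s: "\<rho> \<in> borel_measurable \<mu>" "\<And>x. x \<in> S2 \<Longrightarrow> 0 \<le> \<rho> x" "\<And>x. x \<in> S2 \<Longrightarrow> \<bar>\<rho> x\<bar> \<le> B"
    "integrable \<mu> \<rho>" "(LINT x|\<mu>. \<rho> x) = 1" by (rule bounded_densityD[OF r]) (rule that)
  obtain B' where s': "\<rho>' \<in> borel_measurable \<mu>" "\<And>x. x \<in> S2 \<Longrightarrow> 0 \<le> \<rho>' x" "\<And>x. x \<in> S2 \<Longrightarrow> \<bar>\<rho>' x\<bar> \<le> B'"
    "integrable \<mu> \<rho>'" "(LINT x|\<mu>. \<rho>' x) = 1" by (rule bounded_densityD[OF r']) (rule that)
  note iT = integrable_riesz_potential[OF s(4) d(1)]
  have il: "integrable \<mu> (\<lambda>y. \<rho>' y * log_potential \<delta> \<rho> y)"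
    by (intro integrable_mult_bounded[where B=B'] integrable_log_potential s s' d)
  have "(LINT x|\<mu>. riesz_potential \<delta> \<rho> x * riesz_potential \<delta> \<rho>' x) = (LINT y|\<mu>. \<rho>' y * riesz_potential \<delta> (riesz_potential \<delta> \<rho>) y)"
    by (rule riesz_potential_adjoint[OF iT s'(1,3) d(1)])
  also have "\<dots> \<le> (LINT y|\<mu>. 1 / (4 * pi) * (\<rho>' y * log_potential \<delta> \<rho> y) + 1 / pi * \<rho>' y)"
  proof (rule integral_mono)
    show "integrable \<mu> (\<lambda>y. \<rho>' y * riesz_potential \<delta> (riesz_potential \<delta> \<rho>) y)"
      by (intro integrable_mult_bounded[where B=B'] integrable_riesz_potential iT d s')
    show "integrable \<mu> (\<lambda>y. 1 / (4 * pi) * (\<rho>' y * log_potential \<delta> \<rho> y) + 1 / pi * \<rho>' y)"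
      by (intro Bochner_Integration.integrable_add integrable_mult_right il s')
    fix y assume "y \<in> space \<mu>"
    then have y: "y \<in> S2" by simp
    have "\<rho>' y * riesz_potential \<delta> (riesz_potential \<delta> \<rho>) y \<le> \<rho>' y * (1 / (4 * pi) * log_potential \<delta> \<rho> y + 1 / pi)"
      by (rule mult_left_mono[OF riesz_potential_twice_le[OF r d y] s'(2)[OF y]])
    then show "\<rho>' y * riesz_potential \<delta> (riesz_potential \<delta> \<rho>) y \<le> 1 / (4 * pi) * (\<rho>' y * log_potential \<delta> \<rho> y) + 1 / pi * \<rho>' y"
      by (simp add: algebra_simps)
  qed
  also have "\<dots> = 1 / (4 * pi) * log_energy \<delta> \<rho> \<rho>' + 1 / pi * (LINT y|\<mu>. \<rho>' y)"
    unfolding log_energy_def by (subst Bochner_Integration.integral_add) (use il s' in auto)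
  finally show ?thesis using s'(5) by simp
qed

text \<open>The logarithm is bounded on pairs of points at distance at least \<open>r\<close>.\<close>

lemma log_energy_separated:
  assumes r: "bounded_density \<rho>" and r': "bounded_density \<rho>'" and d: "0 < \<delta>" "\<delta> \<le> 1" and r0: "0 < r"
    and sep: "\<And>x y. x \<in> S2 \<Longrightarrow> y \<in> S2 \<Longrightarrow> \<rho> x \<noteq> 0 \<Longrightarrow> \<rho>' y \<noteq> 0 \<Longrightarrow> r \<le> norm (x - y)"
  shows "log_energy \<delta> \<rho> \<rho>' \<le> ln (20 / r\<^sup>2)"
proof -
  obtain B where s: "\<rho> \<in> borel_measurable \<mu>" "\<And>x. x \<in> S2 \<Longrightarrow> 0 \<le> \<rho> x" "\<And>x. x \<in> S2 \<Longrightarrow> \<bar>\<rho> x\<bar> \<le> B"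
    "integrable \<mu> \<rho>" "(LINT x|\<mu>. \<rho> x) = 1" by (rule bounded_densityD[OF r]) (rule that)
  obtain B' where s': "\<rho>' \<in> borel_measurable \<mu>" "\<And>x. x \<in> S2 \<Longrightarrow> 0 \<le> \<rho>' x" "\<And>x. x \<in> S2 \<Longrightarrow> \<bar>\<rho>' x\<bar> \<le> B'"
    "integrable \<mu> \<rho>'" "(LINT x|\<mu>. \<rho>' x) = 1" by (rule bounded_densityD[OF r']) (rule that)
  have L: "log_kernel \<delta> x y \<le> ln (20 / r\<^sup>2)" if "r \<le> norm (x - y)" for x y
  proof -
    have "r\<^sup>2 \<le> (norm (x - y))\<^sup>2" using that r0 by (intro power_mono) auto
    then have "r\<^sup>2 \<le> sq_dist \<delta> x y" unfolding sq_dist_def using d by linarith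
    moreover have "0 < r\<^sup>2" using r0 by simp
    ultimately show ?thesis unfolding log_kernel_def using sq_dist_pos[OF d(1), of x y] by (intro ln_mono frac_le) auto
  qed
  have "log_energy \<delta> \<rho> \<rho>' \<le> (LINT y|\<mu>. \<rho>' y * ln (20 / r\<^sup>2))"
    unfolding log_energy_def
  proof (rule integral_mono)
    show "integrable \<mu> (\<lambda>y. \<rho>' y * log_potential \<delta> \<rho> y)"
      by (intro integrable_mult_bounded[where B=B'] integrable_log_potential s s' d)
    fix y assume "y \<in> space \<mu>"
    then have y: "y \<in> S2" by simp
    show "\<rho>' y * log_potential \<delta> \<rho> y \<le> \<rho>' y * ln (20 / r\<^sup>2)"
    proof (cases "\<rho>' y = 0")
      case False
      have "log_potential \<delta> \<rho> y \<le> (LINT x|\<mu>. \<rho> x * ln (20 / r\<^sup>2))"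
        unfolding log_potential_def
      proof (rule integral_mono)
        show "\<rho> x * log_kernel \<delta> x y \<le> \<rho> x * ln (20 / r\<^sup>2)" if "x \<in> space \<mu>" for x
          using sep[OF _ y _ False, of x] L[of x y] s(2)[of x] that
          by (cases "\<rho> x = 0") (auto intro!: mult_left_mono)
      qed (use integrable_times_log_kernel[OF s(4) d y] s(4) in auto)
      then show ?thesis using s(5) s'(2)[OF y] by (intro mult_left_mono) auto
    qed simp
  qed (use s' in auto)
  then show ?thesis using s'(5) by simp
qed

text \<open>The Gibbs principle with \<open>\<psi> = (1 - \<kappa>) ln (1 / |x - y|\<^sup>2)\<close> for fixed \<open>y\<close>, averaged over \<open>y\<close> with
  respect to \<open>\<rho>\<close> itself. Taking \<open>\<kappa>\<close> close to 0 costs only the additive constant.\<close>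

lemma ln_exp_integral_le_log_energy:
  assumes v: "v \<in> borel_measurable \<mu>" and vB: "\<And>x. x \<in> S2 \<Longrightarrow> \<bar>v x\<bar> \<le> V"
    and d: "0 < \<delta>" "\<delta> \<le> 1" and a: "0 < \<kappa>" "\<kappa> < 1"
    and rho: "bounded_density \<rho>" "\<And>x. x \<in> S2 \<Longrightarrow> \<rho> x = indicator \<Omega> x * exp (2 * v x) / Z" and Z: "0 < Z"
  shows "ln Z \<le> 2 * (LINT x|\<mu>. \<rho> x * v x) - (1 - \<kappa>) * log_energy \<delta> \<rho> \<rho>
    + (1 - \<kappa>) * ln 20 + ln (5 * pi / \<kappa>)"
proof -
  obtain B where r: "\<rho> \<in> borel_measurable \<mu>" "\<And>x. x \<in> S2 \<Longrightarrow> 0 \<le> \<rho> x" "\<And>x. x \<in> S2 \<Longrightarrow> \<bar>\<rho> x\<bar> \<le> B"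
    "integrable \<mu> \<rho>" "(LINT x|\<mu>. \<rho> x) = 1" by (rule bounded_densityD[OF rho(1)]) (rule that)
  define c where "c = 2 * (LINT x|\<mu>. \<rho> x * v x) + (1 - \<kappa>) * ln 20 + ln (5 * pi / \<kappa>)"
  have pw: "ln Z \<le> c - (1 - \<kappa>) * log_potential \<delta> \<rho> y" if y: "y \<in> S2" for y
  proof -
    define \<psi> where "\<psi> x = (1 - \<kappa>) * (log_kernel \<delta> x y - ln 20)" for x
    have \<psi>: "exp (\<psi> x) = sq_dist \<delta> x y powr (\<kappa> - 1)" for x
      using sq_dist_pos[OF d(1), of x y] by (simp add: \<psi>_def log_kernel_def ln_div powr_def algebra_simps)
    have m: "\<psi> \<in> borel_measurable \<mu>"
      unfolding \<psi>_def by (rule borel_measurable_sphere) measurable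
    have \<psi>B: "\<bar>\<psi> x\<bar> \<le> ln (20 / \<delta>) + ln 20" if "x \<in> S2" for x
    proof -
      have "\<bar>\<psi> x\<bar> \<le> \<bar>log_kernel \<delta> x y - ln 20\<bar>" unfolding \<psi>_def abs_mult using a by (intro mult_left_le_one_le) auto
      also have "\<dots> \<le> \<bar>log_kernel \<delta> x y\<bar> + \<bar>ln 20\<bar>" by (rule abs_triangle_ineq4)
      also have "\<dots> \<le> ln (20 / \<delta>) + ln 20" using log_kernel_abs_le[OF d that y] by simp
      finally show ?thesis .
    qed
    have "ln Z \<le> 2 * (LINT x|\<mu>. \<rho> x * v x) - (LINT x|\<mu>. \<rho> x * \<psi> x)
      + ln (LINT x|\<mu>. exp (\<psi> x))"
      by (rule gibbs_variational[OF v m vB \<psi>B r(1) rho(2) r(5) Z])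
    also have "(LINT x|\<mu>. \<rho> x * \<psi> x) = (LINT x|\<mu>. (1 - \<kappa>) * (\<rho> x * log_kernel \<delta> x y) - (1 - \<kappa>) * ln 20 * \<rho> x)"
      by (simp add: \<psi>_def algebra_simps)
    also have "\<dots> = (1 - \<kappa>) * log_potential \<delta> \<rho> y - (1 - \<kappa>) * ln 20"
      unfolding log_potential_def
      by (subst Bochner_Integration.integral_diff) (use integrable_times_log_kernel[OF r(4) d y] r(4,5) in auto)
    also have "ln (LINT x|\<mu>. exp (\<psi> x)) \<le> ln (5 * pi / \<kappa>)"
    proof -
      have pos: "(LINT x|\<mu>. sq_dist \<delta> x y powr (\<kappa> - 1)) > 0"
      proof -
        have "(LINT x|\<mu>. 5 powr (\<kappa> - 1)) \<le> (LINT x|\<mu>. sq_dist \<delta> x y powr (\<kappa> - 1))"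
          using integral_sq_dist_powr_le(1)[OF y d a] sq_dist_pos[OF d(1)] sq_dist_le[OF _ y d(2)] a
          by (intro integral_mono powr_mono2') auto
        moreover have "(LINT x|\<mu>. 5 powr (\<kappa> - 1)) > 0"
          using emeasure_sphere_measure_total by (simp add: measure_def)
        ultimately show ?thesis by linarith
      qed
      show ?thesis unfolding \<psi> using pos integral_sq_dist_powr_le(2)[OF y d a] by (intro ln_mono) auto
    qed
    finally show ?thesis by (simp add: c_def)
  qed
  have il: "integrable \<mu> (\<lambda>y. \<rho> y * log_potential \<delta> \<rho> y)"
    by (intro integrable_mult_bounded[where B=B] integrable_log_potential r d)
  have "(LINT y|\<mu>. ln Z * \<rho> y) \<le> (LINT y|\<mu>. c * \<rho> y - (1 - \<kappa>) * (\<rho> y * log_potential \<delta> \<rho> y))"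
  proof (rule integral_mono)
    fix y assume "y \<in> space \<mu>"
    then have y: "y \<in> S2" by simp
    from mult_right_mono[OF pw[OF y] r(2)[OF y]]
    show "ln Z * \<rho> y \<le> c * \<rho> y - (1 - \<kappa>) * (\<rho> y * log_potential \<delta> \<rho> y)" by (simp add: algebra_simps)
  qed (use r il in auto)
  also have "\<dots> = c - (1 - \<kappa>) * log_energy \<delta> \<rho> \<rho>"
    unfolding log_energy_def
    by (subst Bochner_Integration.integral_diff) (use il r(4,5) in auto)
  finally show ?thesis using r(5) by (simp add: c_def)
qed

section \<open>Exponential integrals over separated sets\<close>

text \<open>The additive constant collected in the proof below. What matters is that it depends on the number
  \<open>N\<close> of sets, their mutual distance \<open>r\<close> and \<open>\<gamma>\<close> only.\<close>

definition separation_const :: "nat \<Rightarrow> real \<Rightarrow> real \<Rightarrow> real" where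
  "separation_const N r \<gamma> = (\<bar>ln (20 / r\<^sup>2)\<bar> / (4 * pi) + 1 / pi) / \<gamma> + ln 20 / (4 * pi * \<gamma> * N)
     + ln (5 * pi / (1 - 1 / (4 * pi * \<gamma> * N)))"

lemma sum_pair_diagonal_le:
  fixes E :: "'i \<Rightarrow> 'i \<Rightarrow> real"
  assumes I: "finite I" and off: "\<And>i j. i \<in> I \<Longrightarrow> j \<in> I \<Longrightarrow> i \<noteq> j \<Longrightarrow> E i j \<le> c" and c: "0 \<le> c"
  shows "(\<Sum>i\<in>I. \<Sum>j\<in>I. E i j) \<le> (\<Sum>i\<in>I. E i i) + (real (card I))\<^sup>2 * c"
proof -
  have "(\<Sum>i\<in>I. \<Sum>j\<in>I. E i j) \<le> (\<Sum>i\<in>I. \<Sum>j\<in>I. (if i = j then E i i else 0) + c)"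
    using off c by (intro sum_mono) auto
  also have "\<dots> = (\<Sum>i\<in>I. E i i) + (real (card I))\<^sup>2 * c"
    using I by (simp add: sum.distrib power2_eq_square)
  finally show ?thesis .
qed

text \<open>The heart of the matter: \<open>N\<close> self-energies, each weighted by \<open>1 / N\<^sup>2\<close> in the energy of the mean density
  but by \<open>1 / N\<close> in the mean of the entropies, improve the constant by the factor \<open>N\<close>.\<close>

lemma separated_exp_riesz_potential_le:
  fixes \<Omega> :: "'i \<Rightarrow> (real^3) set"
  assumes I: "finite I" "I \<noteq> {}"
    and Om: "\<And>i. i \<in> I \<Longrightarrow> \<Omega> i \<in> sets \<mu>" "\<And>i. i \<in> I \<Longrightarrow> 0 < measure \<mu> (\<Omega> i)"
    and r: "0 < r" and sep: "\<And>i j x y. i \<in> I \<Longrightarrow> j \<in> I \<Longrightarrow> i \<noteq> j \<Longrightarrow> x \<in> \<Omega> i \<Longrightarrow> y \<in> \<Omega> j \<Longrightarrow> r \<le> norm (x - y)"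
    and d: "0 < \<delta>" "\<delta> \<le> 1" and g: "integrable \<mu> g" "integrable \<mu> (\<lambda>x. (g x)\<^sup>2)"
    and lam: "1 / (4 * pi * card I) < \<gamma>"
  shows "(\<Sum>i\<in>I. ln (LINT x|\<mu>. indicator (\<Omega> i) x * exp (2 * riesz_potential \<delta> g x))) / card I
    \<le> \<gamma> * (LINT x|\<mu>. (g x)\<^sup>2) + separation_const (card I) r \<gamma>"
proof -
  define N where "N = real (card I)"
  have N: "N > 0" using I by (simp add: N_def card_gt_0_iff)
  have lam0: "\<gamma> > 0" using lam N by (intro less_trans[OF _ lam]) (simp add: N_def)
  \<comment> \<open>the exponent for which self-energies and entropies cancel\<close>
  define t where "t = 1 / (4 * pi * \<gamma> * N)"
  have t: "0 < t" "t < 1" using lam lam0 N by (auto simp: t_def N_def field_simps)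
  define v where "v = riesz_potential \<delta> g"
  have iv: "integrable \<mu> v" unfolding v_def by (rule integrable_riesz_potential[OF g(1) d(1)])
  then have vm: "v \<in> borel_measurable \<mu>" by simp
  define V where "V = (LINT x|\<mu>. \<bar>g x\<bar>) * (1 / (2 * pi * sqrt \<delta>))"
  have vB: "\<bar>v x\<bar> \<le> V" for x unfolding v_def V_def by (rule riesz_potential_bounded[OF g(1) d(1)])
  define Z where "Z i = (LINT x|\<mu>. indicator (\<Omega> i) x * exp (2 * v x))" for i
  define \<rho> where "\<rho> i x = indicator (\<Omega> i) x * exp (2 * v x) / Z i" for i x
  have mexp: "(\<lambda>x. indicator (\<Omega> i) x * exp (2 * v x)) \<in> borel_measurable \<mu>" if "i \<in> I" for i
    using Om(1)[OF that] vm by measurable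
  have iexp: "integrable \<mu> (\<lambda>x. indicator (\<Omega> i) x * exp (2 * v x))" if "i \<in> I" for i
  proof (rule integrable_sphere_bounded[where B="exp (2 * V)"])
    show "norm (indicat_real (\<Omega> i) x * exp (2 * v x)) \<le> exp (2 * V)" for x
      using vB[of x] by (auto simp: indicator_def)
  qed (rule mexp[OF that])
  have Z: "Z i > 0" if "i \<in> I" for i
  proof -
    have "exp (- 2 * V) * measure \<mu> (\<Omega> i) = (LINT x|\<mu>. exp (- 2 * V) * indicator (\<Omega> i) x)"
      using sets.sets_into_space[OF Om(1)[OF that]] by (simp add: Int_absorb2)
    also have "\<dots> \<le> Z i" unfolding Z_def
    proof (rule integral_mono)
      show "exp (- 2 * V) * indicator (\<Omega> i) x \<le> indicator (\<Omega> i) x * exp (2 * v x)" for x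
        using vB[of x] by (auto simp: indicator_def abs_le_iff)
      show "integrable \<mu> (\<lambda>x. exp (- 2 * V) * indicator (\<Omega> i) x)"
        using Om(1)[OF that] by (simp add: sphere.emeasure_eq_measure)
    qed (rule iexp[OF that])
    finally have "exp (- 2 * V) * measure \<mu> (\<Omega> i) \<le> Z i" .
    moreover have "0 < exp (- 2 * V) * measure \<mu> (\<Omega> i)" using Om(2)[OF that] by simp
    ultimately show ?thesis by linarith
  qed
  have dens: "bounded_density (\<rho> i)" if i: "i \<in> I" for i
    unfolding bounded_density_def
  proof (intro conjI ballI exI[of _ "exp (2 * V) / Z i"])
    show "\<rho> i \<in> borel_measurable \<mu>" unfolding \<rho>_def using mexp[OF i] by measurable
    show "0 \<le> \<rho> i x" "\<rho> i x \<le> exp (2 * V) / Z i" for x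
      using Z[OF i] vB[of x] by (auto simp: \<rho>_def indicator_def abs_le_iff intro!: divide_right_mono)
    show "(LINT x|\<mu>. \<rho> i x) = 1" unfolding \<rho>_def using Z[OF i] by (simp add: Z_def)
  qed
  have idens: "integrable \<mu> (\<rho> i)" "\<rho> i \<in> borel_measurable \<mu>" if "i \<in> I" for i
    using bounded_densityD[OF dens[OF that]] by blast+
  define E where "E i j = log_energy \<delta> (\<rho> i) (\<rho> j)" for i j
  define c1 where "c1 = \<bar>ln (20 / r\<^sup>2)\<bar>"
  have off: "E i j \<le> c1" if "i \<in> I" "j \<in> I" "i \<noteq> j" for i j
  proof -
    have "E i j \<le> ln (20 / r\<^sup>2)" unfolding E_def
      by (rule log_energy_separated[OF dens dens d r]) (use that sep in \<open>auto simp: \<rho>_def indicator_def split: if_splits\<close>)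
    then show ?thesis by (simp add: c1_def)
  qed
  define \<phi> where "\<phi> x = (\<Sum>i\<in>I. riesz_potential \<delta> (\<rho> i) x) / N" for x
  have iT: "integrable \<mu> (riesz_potential \<delta> (\<rho> i))" if "i \<in> I" for i
    by (rule integrable_riesz_potential[OF idens(1)[OF that] d(1)])
  have iTT: "integrable \<mu> (\<lambda>x. riesz_potential \<delta> (\<rho> i) x * riesz_potential \<delta> (\<rho> j) x)" if "i \<in> I" "j \<in> I" for i j
    by (rule integrable_mult_bounded[OF iT[OF that(2)] _ riesz_potential_bounded[OF idens(1)[OF that(1)] d(1)]]) (use iT[OF that(1)] in simp)
  have igT: "integrable \<mu> (\<lambda>x. g x * riesz_potential \<delta> (\<rho> i) x)" if "i \<in> I" for i
    using integrable_mult_bounded[OF g(1) _ riesz_potential_bounded[OF idens(1)[OF that] d(1)]] iT[OF that] by (simp add: mult.commute)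
  have phi2: "(\<phi> x)\<^sup>2 = (\<Sum>i\<in>I. \<Sum>j\<in>I. riesz_potential \<delta> (\<rho> i) x * riesz_potential \<delta> (\<rho> j) x) / N\<^sup>2" for x
    by (simp add: \<phi>_def power_divide power2_eq_square sum_product)
  have iphi2: "integrable \<mu> (\<lambda>x. (\<phi> x)\<^sup>2)"
    unfolding phi2 by (intro integrable_divide_zero Bochner_Integration.integrable_sum iTT) auto
  have gphi: "g x * \<phi> x = (\<Sum>i\<in>I. g x * riesz_potential \<delta> (\<rho> i) x) / N" for x
    by (simp add: \<phi>_def sum_distrib_left)
  have igphi: "integrable \<mu> (\<lambda>x. g x * \<phi> x)"
    unfolding gphi by (intro integrable_divide_zero Bochner_Integration.integrable_sum igT) auto
  have "(\<Sum>i\<in>I. (LINT x|\<mu>. \<rho> i x * v x)) = (\<Sum>i\<in>I. (LINT x|\<mu>. g x * riesz_potential \<delta> (\<rho> i) x))"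
  proof (rule sum.cong[OF refl])
    fix i assume i: "i \<in> I"
    obtain B where "\<And>x. x \<in> S2 \<Longrightarrow> \<bar>\<rho> i x\<bar> \<le> B" by (rule bounded_densityD[OF dens[OF i]]) (rule that)
    from riesz_potential_adjoint[OF g(1) idens(2)[OF i] this d(1)]
    show "(LINT x|\<mu>. \<rho> i x * v x) = (LINT x|\<mu>. g x * riesz_potential \<delta> (\<rho> i) x)" by (simp add: v_def)
  qed
  also have "\<dots> = N * (LINT x|\<mu>. g x * \<phi> x)"
    unfolding gphi using N igT by (simp add: Bochner_Integration.integral_sum)
  finally have lin: "(\<Sum>i\<in>I. (LINT x|\<mu>. \<rho> i x * v x)) = N * (LINT x|\<mu>. g x * \<phi> x)" .
  have "(LINT x|\<mu>. 2 * (g x * \<phi> x)) \<le> (LINT x|\<mu>. \<gamma> * (g x)\<^sup>2 + 1 / \<gamma> * (\<phi> x)\<^sup>2)"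
  proof (rule integral_mono)
    show "2 * (g x * \<phi> x) \<le> \<gamma> * (g x)\<^sup>2 + 1 / \<gamma> * (\<phi> x)\<^sup>2" for x
    proof -
      have "0 \<le> (\<gamma> * g x - \<phi> x)\<^sup>2 / \<gamma>" using lam0 by simp
      also have "\<dots> = \<gamma> * (g x)\<^sup>2 + 1 / \<gamma> * (\<phi> x)\<^sup>2 - 2 * (g x * \<phi> x)"
        using lam0 by (simp add: power2_eq_square field_simps)
      finally show ?thesis by simp
    qed
  qed (use igphi iphi2 g in auto)
  also have "\<dots> = \<gamma> * (LINT x|\<mu>. (g x)\<^sup>2) + 1 / \<gamma> * (LINT x|\<mu>. (\<phi> x)\<^sup>2)"
    by (subst Bochner_Integration.integral_add) (use iphi2 g in auto)
  finally have young: "2 * (LINT x|\<mu>. g x * \<phi> x) \<le> \<gamma> * (LINT x|\<mu>. (g x)\<^sup>2) + 1 / \<gamma> * (LINT x|\<mu>. (\<phi> x)\<^sup>2)"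
    using igphi by simp
  have "(LINT x|\<mu>. (\<phi> x)\<^sup>2) = (\<Sum>i\<in>I. \<Sum>j\<in>I. (LINT x|\<mu>. riesz_potential \<delta> (\<rho> i) x * riesz_potential \<delta> (\<rho> j) x)) / N\<^sup>2"
    unfolding phi2 using iTT by (simp add: Bochner_Integration.integral_sum)
  also have "\<dots> \<le> (\<Sum>i\<in>I. \<Sum>j\<in>I. 1 / (4 * pi) * E i j + 1 / pi) / N\<^sup>2"
    unfolding E_def by (intro divide_right_mono sum_mono riesz_energy_le dens d) auto
  also have "\<dots> = (1 / (4 * pi) * (\<Sum>i\<in>I. \<Sum>j\<in>I. E i j) + N\<^sup>2 * (1 / pi)) / N\<^sup>2"
    by (simp add: sum.distrib sum_distrib_left N_def power2_eq_square)
  also have "\<dots> \<le> (1 / (4 * pi) * ((\<Sum>i\<in>I. E i i) + N\<^sup>2 * c1) + N\<^sup>2 * (1 / pi)) / N\<^sup>2"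
    unfolding N_def by (intro divide_right_mono add_right_mono mult_left_mono sum_pair_diagonal_le I off) (auto simp: c1_def)
  also have "\<dots> = 1 / (4 * pi) * (\<Sum>i\<in>I. E i i) / N\<^sup>2 + (c1 / (4 * pi) + 1 / pi)"
    using N by (simp add: field_simps)
  finally have "1 / \<gamma> * (LINT x|\<mu>. (\<phi> x)\<^sup>2) \<le> 1 / \<gamma> * (1 / (4 * pi) * (\<Sum>i\<in>I. E i i) / N\<^sup>2 + (c1 / (4 * pi) + 1 / pi))"
    using lam0 by (intro mult_left_mono) auto
  also have "\<dots> = t * (\<Sum>i\<in>I. E i i) / N + (c1 / (4 * pi) + 1 / pi) / \<gamma>"
    using lam0 N by (simp add: t_def power2_eq_square field_simps)
  finally have quad: "1 / \<gamma> * (LINT x|\<mu>. (\<phi> x)\<^sup>2) \<le> t * (\<Sum>i\<in>I. E i i) / N + (c1 / (4 * pi) + 1 / pi) / \<gamma>" .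
  have "(\<Sum>i\<in>I. ln (Z i)) \<le> (\<Sum>i\<in>I. 2 * (LINT x|\<mu>. \<rho> i x * v x) - t * E i i + t * ln 20 + ln (5 * pi / (1 - t)))"
  proof (rule sum_mono)
    fix i assume i: "i \<in> I"
    have "ln (Z i) \<le> 2 * (LINT x|\<mu>. \<rho> i x * v x) - (1 - (1 - t)) * log_energy \<delta> (\<rho> i) (\<rho> i)
      + (1 - (1 - t)) * ln 20 + ln (5 * pi / (1 - t))"
      by (rule ln_exp_integral_le_log_energy[OF vm vB d _ _ dens[OF i] _ Z[OF i]]) (use t in \<open>auto simp: \<rho>_def\<close>)
    then show "ln (Z i) \<le> 2 * (LINT x|\<mu>. \<rho> i x * v x) - t * E i i + t * ln 20 + ln (5 * pi / (1 - t))"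
      by (simp add: E_def)
  qed
  also have "\<dots> = 2 * (\<Sum>i\<in>I. (LINT x|\<mu>. \<rho> i x * v x)) - t * (\<Sum>i\<in>I. E i i) + N * (t * ln 20 + ln (5 * pi / (1 - t)))"
    by (simp add: sum.distrib sum_subtractf sum_distrib_left N_def algebra_simps)
  also have "\<dots> = N * (2 * (LINT x|\<mu>. g x * \<phi> x) - t * (\<Sum>i\<in>I. E i i) / N + t * ln 20 + ln (5 * pi / (1 - t)))"
    unfolding lin using N by (simp add: algebra_simps)
  finally have "(\<Sum>i\<in>I. ln (Z i)) / N \<le> 2 * (LINT x|\<mu>. g x * \<phi> x) - t * (\<Sum>i\<in>I. E i i) / N + t * ln 20 + ln (5 * pi / (1 - t))"
    by (subst pos_divide_le_eq[OF N], subst mult.commute)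
  also have "\<dots> \<le> \<gamma> * (LINT x|\<mu>. (g x)\<^sup>2) + (c1 / (4 * pi) + 1 / pi) / \<gamma> + t * ln 20 + ln (5 * pi / (1 - t))"
    using young quad by simp
  finally show ?thesis
    unfolding Z_def v_def N_def separation_const_def c1_def t_def by simp
qed

section \<open>Functions with a weak gradient\<close>

lemma integrable_exp_riesz_potential:
  assumes A: "A \<in> sets \<mu>" and g: "integrable \<mu> g" and d: "0 < \<delta>"
  shows "integrable \<mu> (\<lambda>x. indicator A x * exp (2 * riesz_potential \<delta> g x))"
proof (rule integrable_sphere_bounded)
  show "(\<lambda>x. indicator A x * exp (2 * riesz_potential \<delta> g x)) \<in> borel_measurable \<mu>"
    using A integrable_riesz_potential[OF g d] by measurable
  show "norm (indicat_real A x * exp (2 * riesz_potential \<delta> g x)) \<le> exp (2 * ((LINT x|\<mu>. \<bar>g x\<bar>) * (1 / (2 * pi * sqrt \<delta>))))" for x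
    using riesz_potential_bounded[OF g d, of x] by (auto simp: indicator_def abs_le_iff)
qed

lemma integrable_norm_gradient:
  assumes "has_weak_gradient u G"
  shows "integrable \<mu> (\<lambda>x. norm (G x))" "integrable \<mu> (\<lambda>x. (norm (G x))\<^sup>2)"
proof -
  show i: "integrable \<mu> (\<lambda>x. (norm (G x))\<^sup>2)" using assms by (simp add: has_weak_gradient_def)
  show "integrable \<mu> (\<lambda>x. norm (G x))"
  proof (rule Bochner_Integration.integrable_bound)
    show "integrable \<mu> (\<lambda>x. 1 + (norm (G x))\<^sup>2)" using i by simp
    have "G \<in> borel_measurable \<mu>" using assms by (simp add: has_weak_gradient_def)
    then show "(\<lambda>x. norm (G x)) \<in> borel_measurable \<mu>" by measurable
    have "t \<le> 1 + t\<^sup>2" for t :: real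
    proof -
      have "0 \<le> (t - 1)\<^sup>2" "0 \<le> t\<^sup>2" by simp_all
      moreover have "(t - 1)\<^sup>2 = t\<^sup>2 - 2 * t + 1" by (simp add: power2_diff)
      ultimately show ?thesis by linarith
    qed
    then show "AE x in \<mu>. norm (norm (G x)) \<le> norm (1 + (norm (G x))\<^sup>2)" by simp
  qed
qed

text \<open>From here on only the length of the gradient enters.\<close>

lemma smoothing_le_riesz_potential:
  assumes u: "integrable \<mu> u" "(LINT x|\<mu>. u x) = 0" and G: "has_weak_gradient u G"
    and y: "y \<in> S2" and d: "0 < \<delta>"
  shows "smoothing \<delta> u y \<le> riesz_potential \<delta> (\<lambda>x. norm (G x)) y"
proof -
  have "smoothing \<delta> u y \<le> norm (LINT x|\<mu>. G x \<bullet> green_field \<delta> y x)"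
    unfolding smoothing_eq_gradient[OF u G y d] by simp
  also have "\<dots> \<le> (LINT x|\<mu>. norm (G x \<bullet> green_field \<delta> y x))" by (rule integral_norm_bound)
  also have "\<dots> \<le> (LINT x|\<mu>. norm (G x) * riesz_kernel \<delta> x y)"
  proof (rule integral_mono')
    show "integrable \<mu> (\<lambda>x. norm (G x) * riesz_kernel \<delta> x y)"
      by (rule integrable_times_riesz_kernel[OF integrable_norm_gradient(1)[OF G] d])
    show "norm (G x \<bullet> green_field \<delta> y x) \<le> norm (G x) * riesz_kernel \<delta> x y" if "x \<in> space \<mu>" for x
    proof -
      have x: "x \<in> S2" using that by simp
      have "norm (G x \<bullet> green_field \<delta> y x) \<le> norm (G x) * norm (green_field \<delta> y x)"
        by (simp add: Cauchy_Schwarz_ineq2)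
      also have "\<dots> \<le> norm (G x) * riesz_kernel \<delta> x y" by (intro mult_left_mono norm_green_field_le x y d) simp
      finally show ?thesis .
    qed
    show "0 \<le> norm (G x) * riesz_kernel \<delta> x y" for x using riesz_kernel_nonneg[OF d, of x y] by simp
  qed
  finally show ?thesis by (simp add: riesz_potential_def)
qed

lemma AE_smoothing_sequence:
  assumes u: "integrable \<mu> u"
  obtains \<delta> :: "nat \<Rightarrow> real" where "\<And>n. 0 < \<delta> n" "\<And>n. \<delta> n \<le> 1" "AE x in \<mu>. (\<lambda>n. smoothing (\<delta> n) u x) \<longlonglongrightarrow> u x"
proof -
  define \<delta> where "\<delta> n = inverse (real (Suc n))" for n
  have d: "0 < \<delta> n" "\<delta> n \<le> 1" for n by (simp_all add: \<delta>_def inverse_le_1_iff)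
  have "\<delta> \<longlonglongrightarrow> 0" unfolding \<delta>_def[abs_def] by (rule LIMSEQ_inverse_real_of_nat)
  from smoothing_tendsto_L1[OF u d(1) this]
  have "(\<lambda>n. LINT x|\<mu>. norm (smoothing (\<delta> n) u x - u x)) \<longlonglongrightarrow> 0" by simp
  from tendsto_L1_AE_subseq[OF _ this]
  obtain s where s: "strict_mono s" "AE x in \<mu>. (\<lambda>n. smoothing (\<delta> (s n)) u x - u x) \<longlonglongrightarrow> 0"
    using integrable_smoothing[OF u d(1)] u by auto
  have "AE x in \<mu>. (\<lambda>n. smoothing (\<delta> (s n)) u x) \<longlonglongrightarrow> u x"
    using s(2) by eventually_elim (simp add: LIM_zero_iff)
  then show ?thesis using d by (intro that[of "\<lambda>n. \<delta> (s n)"])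
qed

text \<open>Fatou's lemma, combined with the pointwise bound of the smoothed functions by potentials.\<close>

lemma fatou_exp:
  assumes A: "A \<in> sets \<mu>" and u: "integrable \<mu> u" and g: "integrable \<mu> g"
    and d: "\<And>n. 0 < \<delta> n" and le: "\<And>n y. y \<in> S2 \<Longrightarrow> smoothing (\<delta> n) u y \<le> riesz_potential (\<delta> n) g y"
    and ae: "AE x in \<mu>. (\<lambda>n. smoothing (\<delta> n) u x) \<longlonglongrightarrow> u x"
  shows "(\<integral>\<^sup>+x. ennreal (indicator A x * exp (2 * u x)) \<partial>\<mu>)
    \<le> liminf (\<lambda>n. ennreal (LINT x|\<mu>. indicator A x * exp (2 * riesz_potential (\<delta> n) g x)))"
proof -
  have m: "(\<lambda>x. ennreal (indicator A x * exp (2 * smoothing (\<delta> n) u x))) \<in> borel_measurable \<mu>" for n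
    using A integrable_smoothing[OF u d[of n]] by measurable
  have "(\<integral>\<^sup>+x. ennreal (indicator A x * exp (2 * u x)) \<partial>\<mu>)
     = (\<integral>\<^sup>+x. liminf (\<lambda>n. ennreal (indicator A x * exp (2 * smoothing (\<delta> n) u x))) \<partial>\<mu>)"
  proof (rule nn_integral_cong_AE)
    show "AE x in \<mu>. ennreal (indicator A x * exp (2 * u x)) = liminf (\<lambda>n. ennreal (indicator A x * exp (2 * smoothing (\<delta> n) u x)))"
      using ae
    proof eventually_elim
      case (elim x)
      have l: "(\<lambda>n. ennreal (indicator A x * exp (2 * smoothing (\<delta> n) u x))) \<longlonglongrightarrow> ennreal (indicator A x * exp (2 * u x))"
        using elim by (intro tendsto_ennrealI tendsto_intros)
      show ?case by (rule lim_imp_Liminf[OF trivial_limit_sequentially l, symmetric])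
    qed
  qed
  also have "\<dots> \<le> liminf (\<lambda>n. \<integral>\<^sup>+x. ennreal (indicator A x * exp (2 * smoothing (\<delta> n) u x)) \<partial>\<mu>)"
    by (rule nn_integral_liminf[OF m])
  also have "\<dots> \<le> liminf (\<lambda>n. ennreal (LINT x|\<mu>. indicator A x * exp (2 * riesz_potential (\<delta> n) g x)))"
  proof (intro Liminf_mono always_eventually allI)
    fix n
    have "(\<integral>\<^sup>+x. ennreal (indicator A x * exp (2 * smoothing (\<delta> n) u x)) \<partial>\<mu>)
      \<le> (\<integral>\<^sup>+x. ennreal (indicator A x * exp (2 * riesz_potential (\<delta> n) g x)) \<partial>\<mu>)"
      using le by (intro nn_integral_mono ennreal_leI mult_left_mono) auto
    also have "\<dots> = ennreal (LINT x|\<mu>. indicator A x * exp (2 * riesz_potential (\<delta> n) g x))"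
      by (intro nn_integral_eq_integral integrable_exp_riesz_potential A g d) simp
    finally show "(\<integral>\<^sup>+x. ennreal (indicator A x * exp (2 * smoothing (\<delta> n) u x)) \<partial>\<mu>)
      \<le> ennreal (LINT x|\<mu>. indicator A x * exp (2 * riesz_potential (\<delta> n) g x))" .
  qed
  finally show ?thesis .
qed

text \<open>The bound for the single set \<open>\<Omega> = S\<^sup>2\<close> with \<open>\<gamma> = 1 > 1 / (4 \<pi>)\<close> is uniform in \<open>\<delta>\<close>.\<close>

lemma integrable_exp_H1:
  assumes u: "integrable \<mu> u" "(LINT x|\<mu>. u x) = 0" and G: "has_weak_gradient u G"
  shows "integrable \<mu> (\<lambda>x. exp (2 * u x))"
proof -
  let ?g = "\<lambda>x. norm (G x)"
  note g = integrable_norm_gradient[OF G]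
  obtain \<delta> where d: "\<And>n. 0 < \<delta> n" "\<And>n. \<delta> n \<le> 1" and ae: "AE x in \<mu>. (\<lambda>n. smoothing (\<delta> n) u x) \<longlonglongrightarrow> u x"
    by (rule AE_smoothing_sequence[OF u(1)]) (rule that)
  define b where "b = 1 * (LINT x|\<mu>. (?g x)\<^sup>2) + separation_const 1 1 1"
  have S2: "S2 \<in> sets \<mu>" using sets.top[of \<mu>] by simp
  have pos: "0 < measure \<mu> S2" using emeasure_sphere_measure_total by (simp add: measure_def)
  have bound: "(LINT x|\<mu>. indicator S2 x * exp (2 * riesz_potential (\<delta> n) ?g x)) \<le> exp b" for n
  proof -
    let ?Z = "LINT x|\<mu>. indicator S2 x * exp (2 * riesz_potential (\<delta> n) ?g x)"
    have "(\<Sum>i\<in>{()}. ln ?Z) / card {()} \<le> 1 * (LINT x|\<mu>. (?g x)\<^sup>2) + separation_const (card {()}) 1 1"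
    proof (rule separated_exp_riesz_potential_le)
      show "1 / (4 * pi * card {()}) < (1::real)" using pi_gt3 by simp
    qed (use S2 pos d g in auto)
    then have le: "ln ?Z \<le> b" by (simp add: b_def)
    show ?thesis
    proof (cases "?Z > 0")
      case True
      then show ?thesis using le by (metis exp_le_cancel_iff exp_ln)
    qed (meson exp_gt_zero le_less_trans less_imp_le not_less)
  qed
  have "(\<integral>\<^sup>+x. ennreal (exp (2 * u x)) \<partial>\<mu>) = (\<integral>\<^sup>+x. ennreal (indicator S2 x * exp (2 * u x)) \<partial>\<mu>)"
    by (intro nn_integral_cong) simp
  also have "\<dots> \<le> liminf (\<lambda>n. ennreal (LINT x|\<mu>. indicator S2 x * exp (2 * riesz_potential (\<delta> n) ?g x)))"
    by (rule fatou_exp[OF S2 u(1) g(1) d(1) smoothing_le_riesz_potential[OF u G _ d(1)] ae])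
  also have "\<dots> \<le> liminf (\<lambda>n::nat. ennreal (exp b))"
    by (intro Liminf_mono always_eventually allI ennreal_leI bound)
  also have "\<dots> = ennreal (exp b)" by (simp add: Liminf_const)
  finally have "(\<integral>\<^sup>+x. ennreal (exp (2 * u x)) \<partial>\<mu>) < \<infinity>"
    by (rule le_less_trans) simp
  then show ?thesis using u(1) by (intro integrableI_nonneg) auto
qed

lemma integral_indicator_exp_pos:
  fixes u :: "real^3 \<Rightarrow> real"
  assumes A: "A \<in> sets \<mu>" "0 < measure \<mu> A"
    and i: "integrable \<mu> (\<lambda>x. indicator A x * exp (2 * u x))"
  shows "0 < (LINT x|\<mu>. indicator A x * exp (2 * u x))"
proof -
  have "(LINT x|\<mu>. indicator A x * exp (2 * u x)) \<noteq> 0"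
  proof
    assume "(LINT x|\<mu>. indicator A x * exp (2 * u x)) = 0"
    then have "AE x in \<mu>. indicator A x * exp (2 * u x) = 0"
      using i by (subst (asm) integral_nonneg_eq_0_iff_AE) auto
    then have ae: "AE x in \<mu>. x \<notin> A" by eventually_elim (auto simp: indicator_def split: if_splits)
    have eq: "{x \<in> space \<mu>. \<not> x \<notin> A} = A" using sets.sets_into_space[OF A(1)] by auto
    have "emeasure \<mu> A = 0"
      using ae AE_iff_measurable[OF A(1) eq] by simp
    then show False using A(2) by (simp add: measure_def)
  qed
  moreover have "0 \<le> (LINT x|\<mu>. indicator A x * exp (2 * u x))" by (intro integral_nonneg_AE) simp
  ultimately show ?thesis by linarith
qed

text \<open>Fatou's lemma bounds each of the integrals from above by a lower limit, so for small \<open>\<delta>\<close> all of them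
  are at most \<open>exp e\<close> times their regularised counterparts, for any given \<open>e > 0\<close>.\<close>

lemma separated_moser_trudinger:
  fixes \<Omega> :: "'i \<Rightarrow> (real^3) set"
  assumes I: "finite I" "I \<noteq> {}"
    and Om: "\<And>i. i \<in> I \<Longrightarrow> \<Omega> i \<in> sets \<mu>" "\<And>i. i \<in> I \<Longrightarrow> 0 < measure \<mu> (\<Omega> i)"
    and r: "0 < r" and sep: "\<And>i j x y. i \<in> I \<Longrightarrow> j \<in> I \<Longrightarrow> i \<noteq> j \<Longrightarrow> x \<in> \<Omega> i \<Longrightarrow> y \<in> \<Omega> j \<Longrightarrow> r \<le> norm (x - y)"
    and u: "integrable \<mu> u" "(LINT x|\<mu>. u x) = 0" and G: "has_weak_gradient u G"
    and gam: "1 / (4 * pi * card I) < \<gamma>"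
  shows "(\<Sum>i\<in>I. ln (LINT x|\<mu>. indicator (\<Omega> i) x * exp (2 * u x))) / card I
    \<le> \<gamma> * (LINT x|\<mu>. (norm (G x))\<^sup>2) + separation_const (card I) r \<gamma>"
proof -
  let ?g = "\<lambda>x. norm (G x)"
  note g = integrable_norm_gradient[OF G]
  obtain \<delta> where d: "\<And>n. 0 < \<delta> n" "\<And>n. \<delta> n \<le> 1" and ae: "AE x in \<mu>. (\<lambda>n. smoothing (\<delta> n) u x) \<longlonglongrightarrow> u x"
    by (rule AE_smoothing_sequence[OF u(1)]) (rule that)
  define a where "a i = (LINT x|\<mu>. indicator (\<Omega> i) x * exp (2 * u x))" for i
  define Z where "Z i n = (LINT x|\<mu>. indicator (\<Omega> i) x * exp (2 * riesz_potential (\<delta> n) ?g x))" for i n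
  define b where "b = \<gamma> * (LINT x|\<mu>. (?g x)\<^sup>2) + separation_const (card I) r \<gamma>"
  have N: "card I > 0" using I by (simp add: card_gt_0_iff)
  have ia: "integrable \<mu> (\<lambda>x. indicator (\<Omega> i) x * exp (2 * u x))" if "i \<in> I" for i
    by (rule integrable_mult_bounded[OF integrable_exp_H1[OF u G] borel_measurable_indicator[OF Om(1)[OF that]], where B=1])
      (simp add: indicator_def)
  have apos: "0 < a i" if i: "i \<in> I" for i
    unfolding a_def by (rule integral_indicator_exp_pos[OF Om(1)[OF i] Om(2)[OF i] ia[OF i]])
  have ev: "eventually (\<lambda>n. a i * exp (- e) < Z i n) sequentially" if i: "i \<in> I" and e: "0 < e" for i e
  proof -
    have "ennreal (a i * exp (- e)) < ennreal (a i)"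
      using apos[OF i] e by (intro ennreal_lessI) auto
    also have "ennreal (a i) = (\<integral>\<^sup>+x. ennreal (indicator (\<Omega> i) x * exp (2 * u x)) \<partial>\<mu>)"
      unfolding a_def by (intro nn_integral_eq_integral[symmetric] ia i) simp
    also have "\<dots> \<le> liminf (\<lambda>n. ennreal (Z i n))"
      unfolding Z_def by (rule fatou_exp[OF Om(1)[OF i] u(1) g(1) d(1) smoothing_le_riesz_potential[OF u G _ d(1)] ae])
    finally have "eventually (\<lambda>n. ennreal (a i * exp (- e)) < ennreal (Z i n)) sequentially"
      by (rule less_LiminfD)
    then show ?thesis
      by eventually_elim (metis ennreal_leI not_less)
  qed
  have "(\<Sum>i\<in>I. ln (a i)) / card I \<le> b + e" if e: "0 < e" for e
  proof -
    have "eventually (\<lambda>n. \<forall>i\<in>I. a i * exp (- e) < Z i n) sequentially"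
      using ev[OF _ e] I by (simp add: eventually_ball_finite)
    then obtain n where n: "\<And>i. i \<in> I \<Longrightarrow> a i * exp (- e) < Z i n" by (auto simp: eventually_sequentially)
    have "(\<Sum>i\<in>I. ln (a i)) - card I * e = (\<Sum>i\<in>I. ln (a i * exp (- e)))"
    proof -
      have "ln (a i * exp (- e)) = ln (a i) - e" if "i \<in> I" for i
        using apos[OF that] by (simp add: ln_mult)
      then show ?thesis by (simp add: sum_subtractf)
    qed
    also have "\<dots> \<le> (\<Sum>i\<in>I. ln (Z i n))"
      using n apos by (intro sum_mono ln_mono) (auto intro: less_imp_le)
    finally have "((\<Sum>i\<in>I. ln (a i)) - card I * e) / card I \<le> (\<Sum>i\<in>I. ln (Z i n)) / card I"
      by (rule divide_right_mono) simp
    also have "\<dots> \<le> b" unfolding Z_def b_def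
      by (rule separated_exp_riesz_potential_le[OF I Om r sep d g gam])
    finally show ?thesis using N by (simp add: diff_divide_distrib)
  qed
  then show ?thesis unfolding a_def b_def by (rule field_le_epsilon)
qed

section \<open>Constrained densities do not concentrate\<close>

lemma finite_family_convergent_subsequence:
  fixes f :: "nat \<Rightarrow> 'i \<Rightarrow> 'a::metric_space"
  assumes K: "compact K" and A: "finite A" and f: "\<And>n i. i \<in> A \<Longrightarrow> f n i \<in> K"
  shows "\<exists>s l. strict_mono s \<and> (\<forall>i\<in>A. l i \<in> K \<and> (\<lambda>n. f (s n) i) \<longlonglongrightarrow> l i)"
  using A f
proof (induction A)
  case empty
  show ?case by (intro exI[of _ id]) (auto simp: strict_mono_def)
next
  case (insert a A)
  then obtain s l where s: "strict_mono s" "\<forall>i\<in>A. l i \<in> K \<and> (\<lambda>n. f (s n) i) \<longlonglongrightarrow> l i" by blast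
  have "\<forall>n. f (s n) a \<in> K" using insert.prems by simp
  then obtain b t where t: "b \<in> K" "strict_mono t" "((\<lambda>n. f (s n) a) \<circ> t) \<longlonglongrightarrow> b"
    using K[unfolded compact_def, THEN spec, THEN mp, OF \<open>\<forall>n. f (s n) a \<in> K\<close>] that by blast
  have "(\<lambda>n. f (s (t n)) i) \<longlonglongrightarrow> l i" if "i \<in> A" for i
    using LIMSEQ_subseq_LIMSEQ[OF _ t(2), of "\<lambda>n. f (s n) i"] s(2) that by (simp add: comp_def)
  then show ?case
    using s t insert.hyps
    by (intro exI[of _ "\<lambda>n. s (t n)"] exI[of _ "l(a := b)"]) (auto simp: strict_mono_def comp_def)
qed

lemma polys_continuous: "p \<in> polys m \<Longrightarrow> continuous_on UNIV p"
  unfolding polys_def by (auto intro!: continuous_intros)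

definition prob_density :: "(real^3 \<Rightarrow> real) \<Rightarrow> bool" where
  "prob_density w \<longleftrightarrow> integrable \<mu> w \<and> (\<forall>x\<in>S2. 0 \<le> w x) \<and> (LINT x|\<mu>. w x) = 1"

definition mass :: "(real^3 \<Rightarrow> real) \<Rightarrow> (real^3) set \<Rightarrow> real" where
  "mass w A = (LINT x|\<mu>. indicator A x * w x)"

lemma integrable_indicator_prob_density:
  assumes "prob_density w" "A \<in> sets borel"
  shows "integrable \<mu> (\<lambda>x. indicator A x * w x)"
  by (rule integrable_mult_bounded[where B=1]) (use assms in \<open>auto simp: prob_density_def intro!: borel_measurable_sphere\<close>)

lemma mass_nonneg: "prob_density w \<Longrightarrow> 0 \<le> mass w A"
  unfolding mass_def by (intro integral_nonneg_AE AE_I2) (auto simp: prob_density_def)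

lemma mass_mono:
  assumes "prob_density w" "A \<in> sets borel" "B \<in> sets borel" "A \<inter> S2 \<subseteq> B"
  shows "mass w A \<le> mass w B"
  unfolding mass_def
  by (intro integral_mono integrable_indicator_prob_density assms)
    (use assms in \<open>auto simp: indicator_def prob_density_def\<close>)

lemma mass_S2: "prob_density w \<Longrightarrow> mass w S2 = 1"
proof -
  assume w: "prob_density w"
  have "mass w S2 = (LINT x|\<mu>. w x)"
    unfolding mass_def by (intro Bochner_Integration.integral_cong) auto
  then show ?thesis using w by (simp add: prob_density_def)
qed

lemma mass_UN_le:
  assumes w: "prob_density w" and K: "finite K" and B: "\<And>c. c \<in> K \<Longrightarrow> B c \<in> sets borel" and A: "A \<in> sets borel" "A \<inter> S2 \<subseteq> (\<Union>c\<in>K. B c)"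
  shows "mass w A \<le> (\<Sum>c\<in>K. mass w (B c))"
proof -
  have "mass w A \<le> (LINT x|\<mu>. (\<Sum>c\<in>K. indicator (B c) x * w x))"
    unfolding mass_def
  proof (rule integral_mono)
    fix x assume "x \<in> space \<mu>"
    then have x: "x \<in> S2" by simp
    then have w0: "0 \<le> w x" using w by (auto simp: prob_density_def)
    show "indicator A x * w x \<le> (\<Sum>c\<in>K. indicator (B c) x * w x)"
    proof (cases "x \<in> A")
      case True
      then obtain c where c: "c \<in> K" "x \<in> B c" using A x by auto
      have "indicator (B c) x * w x \<le> (\<Sum>c\<in>K. indicator (B c) x * w x)"
        using K c(1) w0 by (intro member_le_sum) auto
      then show ?thesis using True c by simp
    qed (use w0 in \<open>auto intro!: sum_nonneg\<close>)
  qed (use w A B in \<open>auto intro!: integrable_indicator_prob_density Bochner_Integration.integrable_sum\<close>)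
  also have "\<dots> = (\<Sum>c\<in>K. mass w (B c))"
    unfolding mass_def using w B by (intro Bochner_Integration.integral_sum) (auto intro: integrable_indicator_prob_density)
  finally show ?thesis .
qed

lemma integrable_prob_density_times_continuous:
  assumes "prob_density w" "continuous_on UNIV p"
  shows "integrable \<mu> (\<lambda>x. p x * w x)"
proof -
  have "bounded (p ` S2)"
    using assms by (intro compact_imp_bounded compact_continuous_image) (auto intro: continuous_on_subset)
  then obtain B where "\<forall>x\<in>S2. norm (p x) \<le> B" by (auto simp: bounded_iff)
  then show ?thesis using assms
    by (intro integrable_mult_bounded[where B=B]) (auto simp: prob_density_def intro!: borel_measurable_sphere borel_measurable_continuous_onI)
qed

text \<open>A density concentrated near \<open>n\<close> points behaves like a cubature formula: the balls are made disjoint by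
  removing the earlier ones, the masses of the resulting pieces serve as weights, and a function is replaced on
  each piece by its value at the centre. Here \<open>a\<close> bounds the oscillation and \<open>B * \<eta>\<close> the contribution
  of the mass outside the balls.\<close>

lemma concentrated_density_discretise:
  fixes x :: "nat \<Rightarrow> real^3"
  assumes w: "prob_density w" and x: "\<And>i. i \<in> {1..n} \<Longrightarrow> x i \<in> S2" and r: "0 < r"
  defines "D i \<equiv> (ball (x i) r \<inter> S2) - (\<Union>l\<in>{1..<i}. ball (x l) r)"
  assumes conc: "mass w (S2 - (\<Union>i\<in>{1..n}. ball (x i) r)) \<le> \<eta>"
  shows "1 - \<eta> \<le> (\<Sum>i=1..n. mass w (D i))" "(\<Sum>i=1..n. mass w (D i)) \<le> 1"
    and "\<lbrakk>continuous_on UNIV p; (LINT y|\<mu>. p y * w y) = 0;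
      \<And>y z. y \<in> S2 \<Longrightarrow> z \<in> S2 \<Longrightarrow> dist y z < r \<Longrightarrow> \<bar>p y - p z\<bar> \<le> a; \<And>y. y \<in> S2 \<Longrightarrow> \<bar>p y\<bar> \<le> B; 0 \<le> a\<rbrakk>
      \<Longrightarrow> \<bar>\<Sum>i=1..n. mass w (D i) * p (x i)\<bar> \<le> a + B * \<eta>"
proof -
  define R where "R = S2 - (\<Union>i\<in>{1..n}. ball (x i) r)"
  have Db: "D i \<in> sets borel" for i unfolding D_def by auto
  have Rb: "R \<in> sets borel" unfolding R_def by auto
  have Dx: "y \<in> D i \<Longrightarrow> dist (x i) y < r" for i y by (auto simp: D_def)
  have uniq: "\<exists>!i. i \<in> {1..n} \<and> y \<in> D i" if y: "y \<in> S2" "y \<notin> R" for y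
  proof -
    let ?P = "\<lambda>i. i \<in> {1..n} \<and> y \<in> ball (x i) r"
    \<comment> \<open>earlier balls are removed from later ones, so a point belongs to the piece of the first ball that contains it\<close>
    define j where "j = (LEAST i. ?P i)"
    have "\<exists>i. ?P i" using y by (auto simp: R_def)
    then have L: "?P j" unfolding j_def by (rule LeastI_ex)
    have "y \<notin> ball (x l) r" if "l \<in> {1..<j}" for l
    proof -
      have "\<not> ?P l" using that unfolding j_def by (intro not_less_Least) simp
      then show ?thesis using that L by auto
    qed
    then have "y \<in> D j" using L y(1) unfolding D_def by blast
    moreover have "i = j" if "i \<in> {1..n}" "j \<in> {1..n}" "y \<in> D i" "y \<in> D j" for i j
    proof (rule ccontr)
      assume "i \<noteq> j"
      then consider "i < j" | "j < i" by linarith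
      then show False using that by cases (auto simp: D_def)
    qed
    ultimately show ?thesis using L by blast
  qed
  have noR: "y \<notin> D i" if "y \<in> R" "i \<in> {1..n}" for y i using that by (auto simp: R_def D_def)
  have part: "(\<Sum>i=1..n. indicator (D i) y * f i) = (if y \<in> R then 0 else f (THE i. i \<in> {1..n} \<and> y \<in> D i))" if y: "y \<in> S2" for y and f :: "nat \<Rightarrow> real"
  proof (cases "y \<in> R")
    case True
    then show ?thesis using noR by (auto intro!: sum.neutral)
  next
    case False
    define j where "j = (THE i. i \<in> {1..n} \<and> y \<in> D i)"
    have j: "j \<in> {1..n}" "y \<in> D j" using theI'[OF uniq[OF y False]] by (auto simp: j_def)
    have "(\<Sum>i=1..n. indicator (D i) y * f i) = (\<Sum>i\<in>{j}. indicator (D i) y * f i)"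
      using j uniq[OF y False] by (intro sum.mono_neutral_right) (auto simp: indicator_def)
    also have "\<dots> = f j" using j by simp
    finally show ?thesis using False unfolding j_def by (simp only: if_False)
  qed
  have pw: "(\<Sum>i=1..n. indicator (D i) y * f i) * w y = (\<Sum>i=1..n. f i * (indicator (D i) y * w y))" for f :: "nat \<Rightarrow> real" and y
    unfolding sum_distrib_right by (intro sum.cong refl) (simp only: mult_ac)
  have sm: "(\<Sum>i=1..n. mass w (D i) * f i) = (LINT y|\<mu>. (\<Sum>i=1..n. indicator (D i) y * f i) * w y)" for f :: "nat \<Rightarrow> real"
  proof -
    have "(LINT y|\<mu>. (\<Sum>i=1..n. indicator (D i) y * f i) * w y) = (LINT y|\<mu>. (\<Sum>i=1..n. f i * (indicator (D i) y * w y)))"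
      by (simp only: pw)
    also have "\<dots> = (\<Sum>i=1..n. (LINT y|\<mu>. f i * (indicator (D i) y * w y)))"
      by (intro Bochner_Integration.integral_sum integrable_mult_right integrable_indicator_prob_density w Db)
    finally show ?thesis by (simp add: mass_def mult.commute)
  qed
  have ism: "integrable \<mu> (\<lambda>y. (\<Sum>i=1..n. indicator (D i) y * f i) * w y)" for f :: "nat \<Rightarrow> real"
  proof -
    have "integrable \<mu> (\<lambda>y. (\<Sum>i=1..n. f i * (indicator (D i) y * w y)))"
      by (intro Bochner_Integration.integrable_sum integrable_mult_right integrable_indicator_prob_density w Db)
    then show ?thesis by (simp only: pw)
  qed
  have iw: "integrable \<mu> w" "(LINT y|\<mu>. w y) = 1" and w0: "\<And>y. y \<in> S2 \<Longrightarrow> 0 \<le> w y" using w by (auto simp: prob_density_def)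
  have iR: "integrable \<mu> (\<lambda>y. indicator R y * w y)" by (rule integrable_indicator_prob_density[OF w Rb])
  have "(\<Sum>i=1..n. mass w (D i)) = (LINT y|\<mu>. (\<Sum>i=1..n. indicator (D i) y * 1) * w y)"
    using sm[of "\<lambda>_. 1"] by simp
  also have "\<dots> = (LINT y|\<mu>. w y - indicator R y * w y)"
    using part[of _ "\<lambda>_. 1"] by (intro Bochner_Integration.integral_cong) (auto simp: indicator_def)
  also have "\<dots> = 1 - mass w R" using iw iR by (simp add: mass_def)
  finally have eq: "(\<Sum>i=1..n. mass w (D i)) = 1 - mass w R" .
  have mR: "0 \<le> mass w R" "mass w R \<le> \<eta>" using mass_nonneg[OF w] conc by (auto simp: R_def)
  then show "1 - \<eta> \<le> (\<Sum>i=1..n. mass w (D i))" "(\<Sum>i=1..n. mass w (D i)) \<le> 1" unfolding eq by auto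
  assume p: "continuous_on UNIV p" "(LINT y|\<mu>. p y * w y) = 0"
    and osc: "\<And>y z. y \<in> S2 \<Longrightarrow> z \<in> S2 \<Longrightarrow> dist y z < r \<Longrightarrow> \<bar>p y - p z\<bar> \<le> a" and B: "\<And>y. y \<in> S2 \<Longrightarrow> \<bar>p y\<bar> \<le> B" and a: "0 \<le> a"
  note ip = integrable_prob_density_times_continuous[OF w p(1)]
  let ?s = "\<lambda>y. \<Sum>i=1..n. indicator (D i) y * p (x i)"
  have B0: "0 \<le> B" using B[of "axis 1 1"] by simp
  have "\<bar>\<Sum>i=1..n. mass w (D i) * p (x i)\<bar> = \<bar>(LINT y|\<mu>. ?s y * w y) - (LINT y|\<mu>. p y * w y)\<bar>"
    using p(2) sm[of "\<lambda>i. p (x i)"] by simp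
  also have "\<dots> = \<bar>(LINT y|\<mu>. ?s y * w y - p y * w y)\<bar>"
    by (subst Bochner_Integration.integral_diff[OF ism ip]) simp
  also have "\<dots> \<le> (LINT y|\<mu>. \<bar>?s y * w y - p y * w y\<bar>)" by (rule integral_abs_bound)
  also have "\<dots> \<le> (LINT y|\<mu>. a * w y + B * (indicator R y * w y))"
  proof (rule integral_mono)
    fix y assume "y \<in> space \<mu>"
    then have y: "y \<in> S2" by simp
    have "\<bar>?s y - p y\<bar> \<le> a + B * indicator R y"
    proof (cases "y \<in> R")
      case True
      then show ?thesis using part[OF y] B[OF y] a by simp
    next
      case False
      define j where "j = (THE i. i \<in> {1..n} \<and> y \<in> D i)"
      have j: "j \<in> {1..n}" "y \<in> D j" using theI'[OF uniq[OF y False]] by (auto simp: j_def)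
      have "?s y = p (x j)" using part[OF y] False by (simp add: j_def)
      then show ?thesis using osc[OF x[OF j(1)] y Dx[OF j(2)]] False by simp
    qed
    then have "\<bar>?s y - p y\<bar> * w y \<le> (a + B * indicator R y) * w y" using w0[OF y] by (rule mult_right_mono)
    then show "\<bar>?s y * w y - p y * w y\<bar> \<le> a * w y + B * (indicator R y * w y)"
      using w0[OF y] by (simp only: left_diff_distrib[symmetric] abs_mult) (simp add: algebra_simps)
  qed (use ism ip iw iR in auto)
  also have "\<dots> = a + B * mass w R" using iw iR by (simp add: mass_def)
  also have "\<dots> \<le> a + B * \<eta>" using mR B0 by (simp add: mult_left_mono)
  finally show "\<bar>\<Sum>i=1..n. mass w (D i) * p (x i)\<bar> \<le> a + B * \<eta>" .
qed

definition balanced :: "nat \<Rightarrow> (real^3 \<Rightarrow> real) \<Rightarrow> bool" where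
  "balanced m w \<longleftrightarrow> prob_density w \<and> (\<forall>p\<in>mean_zero_polys m. (LINT y|\<mu>. p y * w y) = 0)"

text \<open>Otherwise there are constrained densities whose mass outside \<open>n\<close> balls of radius \<open>\<eta> \<rightarrow> 0\<close> is below
  \<open>\<eta>\<close>. Their discretisations satisfy the constraints up to \<open>o(1)\<close>, and a limit of nodes and weights along a
  subsequence is a cubature formula with \<open>n\<close> nodes.\<close>

lemma concentration_gap:
  assumes n: "1 \<le> n" "n \<notin> cubature_sizes m"
  shows "\<exists>\<eta>>0. \<forall>w x. balanced m w \<longrightarrow> x ` {1..n} \<subseteq> S2 \<longrightarrow> \<eta> \<le> mass w (S2 - (\<Union>i\<in>{1..n}. ball (x i) \<eta>))"
proof (rule ccontr)
  assume neg: "\<not> ?thesis"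
  define \<eta> where "\<eta> k = inverse (real (Suc k))" for k
  have \<eta>: "0 < \<eta> k" for k by (simp add: \<eta>_def)
  have \<eta>0: "\<eta> \<longlonglongrightarrow> 0" unfolding \<eta>_def[abs_def] by (rule LIMSEQ_inverse_real_of_nat)
  have "\<exists>w x. balanced m w \<and> x ` {1..n} \<subseteq> S2 \<and> mass w (S2 - (\<Union>i\<in>{1..n}. ball (x i) (\<eta> k))) < \<eta> k" for k
  proof (rule ccontr)
    assume a: "\<not> ?thesis"
    show False
    proof (rule notE[OF neg], intro exI[of _ "\<eta> k"] conjI allI impI)
      show "0 < \<eta> k" by (rule \<eta>)
      fix w and x :: "nat \<Rightarrow> real^3"
      assume b: "balanced m w" "x ` {1..n} \<subseteq> S2"
      show "\<eta> k \<le> mass w (S2 - (\<Union>i\<in>{1..n}. ball (x i) (\<eta> k)))"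
      proof (rule ccontr)
        assume "\<not> ?thesis"
        with a b show False by (meson not_le)
      qed
    qed
  qed
  then obtain w x where wx: "\<And>k. balanced m (w k)" "\<And>k. x k ` {1..n} \<subseteq> S2"
      "\<And>k. mass (w k) (S2 - (\<Union>i\<in>{1..n}. ball (x k i) (\<eta> k))) < \<eta> k"
    by metis
  have w: "prob_density (w k)" and wp: "p \<in> mean_zero_polys m \<Longrightarrow> (LINT y|\<mu>. p y * w k y) = 0"
    and conc: "mass (w k) (S2 - (\<Union>i\<in>{1..n}. ball (x k i) (\<eta> k))) \<le> \<eta> k" for k i p
    using wx(1)[of k] wx(3)[of k] by (auto simp: balanced_def)
  have x: "i \<in> {1..n} \<Longrightarrow> x k i \<in> S2" for k i using wx(2)[of k] by blast
  define \<nu> where "\<nu> k i = mass (w k) ((ball (x k i) (\<eta> k) \<inter> S2) - (\<Union>l\<in>{1..<i}. ball (x k l) (\<eta> k)))" for k i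
  note disc = concentrated_density_discretise[OF w x \<eta> conc, folded \<nu>_def]
  have \<nu>0: "0 \<le> \<nu> k i" for k i unfolding \<nu>_def by (rule mass_nonneg[OF w])
  have \<nu>1: "\<nu> k i \<le> 1" if "i \<in> {1..n}" for k i
    using member_le_sum[of i "{1..n}" "\<nu> k"] \<nu>0 that disc(2)[of k] by simp
  define K where "K = S2 \<times> {0..1::real}"
  have K: "compact K" unfolding K_def by (intro compact_Times) auto
  have fK: "(x k i, \<nu> k i) \<in> K" if "i \<in> {1..n}" for k i
    using x[OF that] \<nu>0 \<nu>1[OF that] by (simp add: K_def)
  obtain s l where s: "strict_mono s" and sl: "\<forall>i\<in>{1..n}. l i \<in> K \<and> (\<lambda>k. (x (s k) i, \<nu> (s k) i)) \<longlonglongrightarrow> l i"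
    using finite_family_convergent_subsequence[OF K, of "{1..n}" "\<lambda>k i. (x k i, \<nu> k i)", OF finite_atLeastAtMost fK] by blast
  then have l: "l i \<in> K" "(\<lambda>k. (x (s k) i, \<nu> (s k) i)) \<longlonglongrightarrow> l i" if "i \<in> {1..n}" for i
    using that by blast+
  have lx: "(\<lambda>k. x (s k) i) \<longlonglongrightarrow> fst (l i)" and l\<nu>: "(\<lambda>k. \<nu> (s k) i) \<longlonglongrightarrow> snd (l i)" if "i \<in> {1..n}" for i
    using tendsto_fst[OF l(2)[OF that]] tendsto_snd[OF l(2)[OF that]] by simp_all
  have \<eta>s: "(\<lambda>k. \<eta> (s k)) \<longlonglongrightarrow> 0" using LIMSEQ_subseq_LIMSEQ[OF \<eta>0 s] by (simp add: comp_def)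
  have "(\<lambda>k. \<Sum>i=1..n. \<nu> (s k) i) \<longlonglongrightarrow> (\<Sum>i=1..n. snd (l i))" by (intro tendsto_sum l\<nu>)
  moreover have "(\<lambda>k. \<Sum>i=1..n. \<nu> (s k) i) \<longlonglongrightarrow> 1"
  proof (rule tendsto_sandwich)
    show "(\<lambda>k. 1 - \<eta> (s k)) \<longlonglongrightarrow> 1" using tendsto_diff[OF tendsto_const[of 1] \<eta>s] by simp
  qed (use disc(1,2) in auto)
  ultimately have sum1: "(\<Sum>i=1..n. snd (l i)) = 1" by (rule LIMSEQ_unique)
  have cub: "(\<Sum>i=1..n. snd (l i) * p (fst (l i))) = 0" if p: "p \<in> mean_zero_polys m" for p
  proof -
    have pc: "continuous_on UNIV p" using p by (auto simp: mean_zero_polys_def intro: polys_continuous)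
    then have pS: "continuous_on S2 p" by (rule continuous_on_subset) simp
    have "bounded (p ` S2)" by (intro compact_imp_bounded compact_continuous_image pS) simp
    then obtain B where B: "\<forall>y\<in>S2. \<bar>p y\<bar> \<le> B" by (auto simp: bounded_iff)
    have "(\<lambda>k. \<Sum>i=1..n. \<nu> (s k) i * p (x (s k) i)) \<longlonglongrightarrow> (\<Sum>i=1..n. snd (l i) * p (fst (l i)))"
      by (intro tendsto_sum tendsto_mult l\<nu> continuous_on_tendsto_compose[OF pc lx]) auto
    moreover have "(\<lambda>k. \<Sum>i=1..n. \<nu> (s k) i * p (x (s k) i)) \<longlonglongrightarrow> 0"
    proof (rule LIMSEQ_I)
      fix e :: real assume e: "0 < e"
      have "uniformly_continuous_on S2 p" by (rule compact_uniformly_continuous[OF pS]) simp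
      then obtain \<rho> where \<rho>: "0 < \<rho>" "\<And>y z. y \<in> S2 \<Longrightarrow> z \<in> S2 \<Longrightarrow> dist y z < \<rho> \<Longrightarrow> dist (p y) (p z) < e / 2"
        unfolding uniformly_continuous_on_def using e by (metis half_gt_zero)
      have "(\<lambda>k. B * \<eta> (s k)) \<longlonglongrightarrow> 0" using tendsto_mult[OF tendsto_const[of B] \<eta>s] by simp
      then have "eventually (\<lambda>k. B * \<eta> (s k) < e / 2) sequentially" by (rule order_tendstoD(2)) (use e in simp)
      moreover have "eventually (\<lambda>k. \<eta> (s k) < \<rho>) sequentially" by (rule order_tendstoD(2)[OF \<eta>s \<rho>(1)])
      ultimately have "eventually (\<lambda>k. norm ((\<Sum>i=1..n. \<nu> (s k) i * p (x (s k) i)) - 0) < e) sequentially"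
      proof eventually_elim
        case (elim k)
        have "\<bar>\<Sum>i=1..n. \<nu> (s k) i * p (x (s k) i)\<bar> \<le> e / 2 + B * \<eta> (s k)"
        proof (rule disc(3)[OF _ pc wp[OF p]])
          show "\<bar>p y - p z\<bar> \<le> e / 2" if "y \<in> S2" "z \<in> S2" "dist y z < \<eta> (s k)" for y z
            using \<rho>(2)[OF that(1,2)] that(3) elim(2) by (simp add: dist_real_def)
        qed (use B e in auto)
        then show ?case using elim(1) by simp
      qed
      then show "\<exists>no. \<forall>k\<ge>no. norm ((\<Sum>i=1..n. \<nu> (s k) i * p (x (s k) i)) - 0) < e"
        by (simp add: eventually_sequentially)
    qed
    ultimately show ?thesis by (rule LIMSEQ_unique)
  qed
  have "n \<in> cubature_sizes m"
    unfolding cubature_sizes_def mem_Collect_eq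
  proof (intro conjI n exI[of _ "\<lambda>i. fst (l i)"] exI[of _ "\<lambda>i. snd (l i)"] ballI sum1 cub)
    fix i assume "i \<in> {1..n}"
    then show "fst (l i) \<in> S2" "0 \<le> snd (l i)" using l(1)[of i] by (auto simp: K_def)
  qed
  then show False using n(2) by simp
qed

lemma borel_sphere_minus_balls: "S2 - (\<Union>c\<in>C. ball (x c) r) \<in> sets borel"
  by (intro sets.Diff borel_closed borel_open open_UN) auto

text \<open>A set of fewer than \<open>N\<close> points is enumerated with an arbitrary point as padding, because the preceding
  lemma speaks of exactly \<open>N - 1\<close> nodes.\<close>

lemma concentration_gap_finite:
  assumes N: "N = 1 \<or> (2 \<le> N \<and> N - 1 \<notin> cubature_sizes m)"
  shows "\<exists>\<eta>>0. \<forall>w C. balanced m w \<longrightarrow> C \<subseteq> S2 \<longrightarrow> finite C \<longrightarrow> card C < N \<longrightarrow> \<eta> \<le> mass w (S2 - (\<Union>c\<in>C. ball c \<eta>))"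
  using N
proof
  assume "N = 1"
  then show ?thesis by (intro exI[of _ 1]) (auto simp: balanced_def mass_S2)
next
  assume N: "2 \<le> N \<and> N - 1 \<notin> cubature_sizes m"
  then have N': "1 \<le> N - 1" "N - 1 \<notin> cubature_sizes m" by auto
  obtain \<eta> where \<eta>: "0 < \<eta>" "\<And>w x. balanced m w \<Longrightarrow> x ` {1..N-1} \<subseteq> S2 \<Longrightarrow>
      \<eta> \<le> mass w (S2 - (\<Union>i\<in>{1..N-1}. ball (x i) \<eta>))"
    using concentration_gap[OF N'] by blast
  show ?thesis
  proof (intro exI[of _ \<eta>] conjI allI impI \<eta>(1))
    fix w :: "real^3 \<Rightarrow> real" and C :: "(real^3) set"
    assume w: "balanced m w" and C: "C \<subseteq> S2" "finite C" "card C < N"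
    define e :: "real^3" where "e = axis 1 1"
    obtain h where h: "bij_betw h {1..card C} C" using ex_bij_betw_nat_finite_1[OF C(2)] by blast
    define x where "x i = (if i \<le> card C then h i else e)" for i
    have hC: "h ` {1..card C} = C" using h by (simp add: bij_betw_def)
    have "x i \<in> S2" if "i \<in> {1..N-1}" for i
    proof (cases "i \<le> card C")
      case True
      then have "h i \<in> C" using that hC by auto
      then show ?thesis using True C(1) by (auto simp: x_def)
    qed (simp add: x_def e_def)
    then have xS: "x ` {1..N-1} \<subseteq> S2" by blast
    have "C \<subseteq> x ` {1..N-1}"
    proof
      fix c assume "c \<in> C"
      then obtain i where "i \<in> {1..card C}" "c = h i" using hC by blast
      then show "c \<in> x ` {1..N-1}" using C(3) by (intro image_eqI[of _ _ i]) (auto simp: x_def)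
    qed
    then have "S2 - (\<Union>i\<in>{1..N-1}. ball (x i) \<eta>) \<subseteq> S2 - (\<Union>c\<in>C. ball c \<eta>)" by blast
    then have "mass w (S2 - (\<Union>i\<in>{1..N-1}. ball (x i) \<eta>)) \<le> mass w (S2 - (\<Union>c\<in>C. ball c \<eta>))"
      using C(2) w by (intro mass_mono) (auto simp: balanced_def intro: borel_sphere_minus_balls)
    then show "\<eta> \<le> mass w (S2 - (\<Union>c\<in>C. ball c \<eta>))" using \<eta>(2)[OF w xS] by linarith
  qed
qed

section \<open>Separated balls and the constrained inequality\<close>

text \<open>Greedy choice: as long as fewer than \<open>N\<close> balls have been chosen, mass \<open>\<eta>\<close> remains at distance at least
  \<open>\<eta>\<close> from their centres. Of the finitely many covering balls that meet the remaining region, one carries at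
  least the average share, and its centre is far from the others.\<close>

lemma separated_heavy_balls:
  assumes w: "prob_density w" and \<eta>: "0 < \<eta>"
    and gap: "\<And>C. C \<subseteq> S2 \<Longrightarrow> finite C \<Longrightarrow> card C < N \<Longrightarrow> \<eta> \<le> mass w (S2 - (\<Union>c\<in>C. ball c \<eta>))"
    and K: "finite K" "K \<subseteq> S2" "S2 \<subseteq> (\<Union>c\<in>K. ball c (\<eta>/4))"
  shows "n \<le> N \<Longrightarrow> \<exists>C\<subseteq>K. card C = n \<and> (\<forall>c\<in>C. \<eta> / card K \<le> mass w (S2 \<inter> ball c (\<eta>/4))) \<and>
    (\<forall>c\<in>C. \<forall>c'\<in>C. c \<noteq> c' \<longrightarrow> 3 * \<eta> / 4 \<le> dist c c')"
proof (induction n)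
  case 0
  show ?case by (intro exI[of _ "{}"]) auto
next
  case (Suc n)
  then obtain C where C: "C \<subseteq> K" "card C = n" "\<forall>c\<in>C. \<eta> / card K \<le> mass w (S2 \<inter> ball c (\<eta>/4))"
    "\<forall>c\<in>C. \<forall>c'\<in>C. c \<noteq> c' \<longrightarrow> 3 * \<eta> / 4 \<le> dist c c'" by auto
  have fC: "finite C" using C(1) K(1) by (rule finite_subset)
  define R where "R = S2 - (\<Union>c\<in>C. ball c \<eta>)"
  have Rb: "R \<in> sets borel" unfolding R_def by (intro sets.Diff borel_closed borel_open open_UN) auto
  have gR: "\<eta> \<le> mass w R" unfolding R_def using C K Suc.prems fC by (intro gap) auto
  define K' where "K' = {c \<in> K. ball c (\<eta>/4) \<inter> R \<noteq> {}}"
  have K': "finite K'" "card K' \<le> card K" "K' \<subseteq> K" using K(1) by (auto simp: K'_def intro: card_mono)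
  have Bb: "S2 \<inter> ball c (\<eta>/4) \<in> sets borel" for c by (intro sets.Int borel_closed borel_open) auto
  have "mass w R \<le> (\<Sum>c\<in>K'. mass w (S2 \<inter> ball c (\<eta>/4)))"
  proof (rule mass_UN_le[OF w K'(1) Bb Rb])
    show "R \<inter> S2 \<subseteq> (\<Union>c\<in>K'. S2 \<inter> ball c (\<eta>/4))" using K(3) by (fastforce simp: K'_def)
  qed
  then have sumge: "\<eta> \<le> (\<Sum>c\<in>K'. mass w (S2 \<inter> ball c (\<eta>/4)))" using gR by linarith
  have "\<exists>c\<in>K'. \<eta> / card K \<le> mass w (S2 \<inter> ball c (\<eta>/4))"
  proof (rule ccontr)
    assume "\<not> ?thesis"
    then have lt: "\<And>c. c \<in> K' \<Longrightarrow> mass w (S2 \<inter> ball c (\<eta>/4)) < \<eta> / card K" by force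
    have ne: "K' \<noteq> {}" using sumge \<eta> by auto
    then have cK: "0 < card K" using K' by (metis card_gt_0_iff finite_subset K(1) subset_empty)
    have "(\<Sum>c\<in>K'. mass w (S2 \<inter> ball c (\<eta>/4))) < (\<Sum>c\<in>K'. \<eta> / card K)"
      by (rule sum_strict_mono[OF K'(1) ne lt])
    also have "\<dots> = real (card K') * (\<eta> / card K)" by simp
    also have "\<dots> \<le> real (card K) * (\<eta> / card K)" using K'(2) \<eta> by (intro mult_right_mono) auto
    also have "\<dots> = \<eta>" using cK by simp
    finally show False using sumge by simp
  qed
  then obtain c where c: "c \<in> K'" "\<eta> / card K \<le> mass w (S2 \<inter> ball c (\<eta>/4))" by blast
  obtain z where z: "dist c z < \<eta>/4" "z \<in> R" using c(1) by (auto simp: K'_def)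
  have far: "3 * \<eta> / 4 \<le> dist c c'" if "c' \<in> C" for c'
  proof -
    have "\<eta> \<le> dist c' z" using z(2) that by (auto simp: R_def not_less)
    moreover have "dist c' z \<le> dist c c' + dist c z" using dist_triangle[of c' z c] by (simp add: dist_commute)
    ultimately show ?thesis using z(1) by linarith
  qed
  have "c \<notin> C" using far[of c] \<eta> by auto
  then show ?case
    using C c K'(3) fC far by (intro exI[of _ "insert c C"]) (auto simp: dist_commute)
qed

text \<open>Either \<open>N\<close> is the least size of a cubature formula, or, were there no cubature formula at all, \<open>N\<close> is
  so large that \<open>1 / (4 \<pi> N) < \<epsilon>\<close>. In both cases \<open>N - 1\<close> nodes do not suffice.\<close>

lemma admissible_number_of_balls:
  assumes e: "(0::real) < \<epsilon>"
  obtains N :: nat and \<gamma> :: real where "N = 1 \<or> (2 \<le> N \<and> N - 1 \<notin> cubature_sizes m)" "1 / (4 * pi * N) < \<gamma>"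
    "\<gamma> \<le> 1 / (4 * pi * real (min_cubature_size m)) + \<epsilon>"
proof (cases "cubature_sizes m = {}")
  case True
  obtain n :: nat where n: "1 / (4 * pi * \<epsilon>) < real n" using reals_Archimedean2 by blast
  show ?thesis
  proof (rule that[of "n + 2" \<epsilon>])
    have "1 / (4 * pi * \<epsilon>) < real (n + 2)" using n by simp
    then have "1 < real (n + 2) * (4 * pi * \<epsilon>)" using e by (subst (asm) pos_divide_less_eq) auto
    also have "\<dots> = \<epsilon> * (4 * pi * real (n + 2))" by (simp only: mult_ac)
    finally show "1 / (4 * pi * real (n + 2)) < \<epsilon>" by (subst pos_divide_less_eq) auto
    show "\<epsilon> \<le> 1 / (4 * pi * real (min_cubature_size m)) + \<epsilon>" by simp
  qed (use True in auto)
next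
  case False
  define N where "N = min_cubature_size m"
  obtain n where "n \<in> cubature_sizes m" using False by blast
  then have "N \<in> cubature_sizes m" unfolding N_def min_cubature_size_def by (rule LeastI)
  then have N: "1 \<le> N" by (simp add: cubature_sizes_def)
  have "N - 1 \<notin> cubature_sizes m"
    using N not_less_Least[of "N - 1" "\<lambda>N. N \<in> cubature_sizes m"] by (simp add: N_def min_cubature_size_def)
  then show ?thesis using N e by (intro that[of N "1 / (4 * pi * real N) + \<epsilon>"]) (auto simp: N_def)
qed

theorem theorem1p1:
  fixes m :: nat and \<epsilon> :: real
  assumes "m \<ge> 1" and "\<epsilon> > 0"
  shows "\<exists>c :: real. \<forall>u\<in>sphere_H1.
    (LINT x|sphere_measure. u x) = 0 \<longrightarrow>
    (\<forall>p\<in>mean_zero_polys m. (LINT x|sphere_measure. p x * exp (2 * u x)) = 0) \<longrightarrow>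
    integrable sphere_measure (\<lambda>x. exp (2 * u x)) \<and>
    ln (LINT x|sphere_measure. exp (2 * u x))
      \<le> (1 / (4 * pi * real (min_cubature_size m)) + \<epsilon>)
           * (LINT x|sphere_measure. (norm (weak_gradient u x))\<^sup>2) + c"
proof -
  obtain N :: nat and \<gamma> :: real where N: "N = 1 \<or> (2 \<le> N \<and> N - 1 \<notin> cubature_sizes m)"
    and \<gamma>: "1 / (4 * pi * N) < \<gamma>" "\<gamma> \<le> 1 / (4 * pi * real (min_cubature_size m)) + \<epsilon>"
    by (rule admissible_number_of_balls[OF assms(2)]) (rule that)
  have N0: "0 < N" using N by auto
  obtain \<eta> where \<eta>: "0 < \<eta>" and gap: "\<And>w C. balanced m w \<Longrightarrow> C \<subseteq> S2 \<Longrightarrow> finite C \<Longrightarrow> card C < N \<Longrightarrow> \<eta> \<le> mass w (S2 - (\<Union>c\<in>C. ball c \<eta>))"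
    using concentration_gap_finite[OF N] by (elim exE conjE) (rule that, assumption, simp)
  have "compact S2" by simp
  then obtain K where K: "finite K" "K \<subseteq> S2" "S2 \<subseteq> (\<Union>c\<in>K. ball c (\<eta>/4))"
    by (rule compactE_image[of S2 S2 "\<lambda>c. ball c (\<eta>/4)"]) (use \<eta> in auto)
  have Kne: "K \<noteq> {}" using K(3) by (auto simp: sphere_eq_empty)
  define \<Omega> where "\<Omega> c = S2 \<inter> ball c (\<eta>/4)" for c
  have \<Omega>b: "\<Omega> c \<in> sets borel" for c unfolding \<Omega>_def by (intro sets.Int borel_closed borel_open) auto
  then have \<Omega>m: "\<Omega> c \<in> sets \<mu>" for c by (simp add: sets_sphere_measure_iff \<Omega>_def)
  define b where "b = separation_const N (\<eta>/4) \<gamma> + ln (card K / \<eta>)"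
  show ?thesis
  proof (intro exI[of _ b] ballI impI)
    fix u assume u: "u \<in> sphere_H1" and mean: "(LINT x|\<mu>. u x) = 0"
      and orth: "\<forall>p\<in>mean_zero_polys m. (LINT x|\<mu>. p x * exp (2 * u x)) = 0"
    define G where "G = weak_gradient u"
    have G: "has_weak_gradient u G"
    proof -
      obtain G' where "has_weak_gradient u G'" using u by (auto simp: sphere_H1_def)
      then show ?thesis unfolding G_def weak_gradient_def by (rule someI[of "has_weak_gradient u"])
    qed
    have iu: "integrable \<mu> u"
    proof (rule sphere.square_integrable_imp_integrable)
      show "u \<in> borel_measurable \<mu>" "integrable \<mu> (\<lambda>x. (u x)\<^sup>2)"
        using u unfolding sphere_H1_def by blast+
    qed
    note ie = integrable_exp_H1[OF iu mean G]
    define W where "W = (LINT x|\<mu>. exp (2 * u x))"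
    have eS: "(LINT x|\<mu>. indicator S2 x * exp (2 * u x)) = W"
      unfolding W_def by (intro Bochner_Integration.integral_cong) auto
    have W: "0 < W"
      unfolding eS[symmetric]
    proof (rule integral_indicator_exp_pos)
      show "integrable \<mu> (\<lambda>x. indicat_real S2 x * exp (2 * u x))"
        using ie by (subst Bochner_Integration.integrable_cong[OF refl, where g="\<lambda>x. exp (2 * u x)"]) auto
      show "0 < measure \<mu> S2" using emeasure_sphere_measure_total by (simp add: measure_def)
    qed (use sets.top[of \<mu>] in simp)
    define w where "w x = exp (2 * u x) / W" for x
    have w: "prob_density w" using ie W unfolding prob_density_def w_def[abs_def] W_def by simp
    have bal: "balanced m w" using w orth by (simp add: balanced_def w_def)
    have "\<exists>C\<subseteq>K. card C = N \<and> (\<forall>c\<in>C. \<eta> / card K \<le> mass w (\<Omega> c)) \<and>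
      (\<forall>c\<in>C. \<forall>c'\<in>C. c \<noteq> c' \<longrightarrow> 3 * \<eta> / 4 \<le> dist c c')"
      unfolding \<Omega>_def by (rule separated_heavy_balls[OF w \<eta> gap[OF bal] K order_refl])
    then obtain C where C: "C \<subseteq> K" "card C = N" "\<forall>c\<in>C. \<eta> / card K \<le> mass w (\<Omega> c)"
      "\<forall>c\<in>C. \<forall>c'\<in>C. c \<noteq> c' \<longrightarrow> 3 * \<eta> / 4 \<le> dist c c'" by blast
    have fC: "finite C" "C \<noteq> {}" using C(2) N0 by (auto intro: card_ge_0_finite)
    define a where "a c = (LINT x|\<mu>. indicator (\<Omega> c) x * exp (2 * u x))" for c
    have cK: "0 < real (card K)" using K(1) Kne by (simp add: card_gt_0_iff)
    have ma: "mass w (\<Omega> c) = a c / W" for c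
      by (simp add: mass_def w_def a_def)
    have aW: "W \<le> a c * (card K / \<eta>)" if "c \<in> C" for c
    proof -
      have "\<eta> / card K \<le> a c / W" using C(3) that by (simp add: ma)
      then show ?thesis using W \<eta> cK by (simp add: field_simps)
    qed
    have apos: "0 < a c" if "c \<in> C" for c
    proof -
      have "0 < \<eta> / card K" using \<eta> cK by simp
      also have "\<dots> \<le> a c / W" using C(3) that by (simp add: ma)
      finally show ?thesis using W by (simp add: zero_less_divide_iff)
    qed
    have mpos: "0 < measure \<mu> (\<Omega> c)" if "c \<in> C" for c
    proof (rule ccontr)
      assume "\<not> ?thesis"
      then have "measure \<mu> (\<Omega> c) = 0" using measure_nonneg[of \<mu> "\<Omega> c"] by linarith
      then have "\<Omega> c \<in> null_sets \<mu>" using \<Omega>m by (simp add: null_sets_def sphere.emeasure_eq_measure)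
      then have "AE x in \<mu>. indicator (\<Omega> c) x * exp (2 * u x) = 0"
        by (rule AE_I'[of "\<Omega> c"]) (auto simp: indicator_def)
      then have "a c = 0" unfolding a_def by (rule integral_eq_zero_AE)
      then show False using apos[OF that] by simp
    qed
    have "ln W \<le> (\<Sum>c\<in>C. ln (a c)) / card C + ln (card K / \<eta>)"
    proof -
      have "card C * ln W = (\<Sum>c\<in>C. ln W)" by simp
      also have "\<dots> \<le> (\<Sum>c\<in>C. ln (a c) + ln (card K / \<eta>))"
      proof (rule sum_mono)
        fix c assume c: "c \<in> C"
        have "ln W \<le> ln (a c * (card K / \<eta>))" using aW[OF c] W by (intro ln_mono) auto
        also have "\<dots> = ln (a c) + ln (card K / \<eta>)" using apos[OF c] \<eta> cK by (intro ln_mult_pos) auto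
        finally show "ln W \<le> ln (a c) + ln (card K / \<eta>)" .
      qed
      also have "\<dots> = card C * ((\<Sum>c\<in>C. ln (a c)) / card C + ln (card K / \<eta>))"
        using C(2) N0 by (simp add: sum.distrib algebra_simps)
      finally show ?thesis using C(2) N0 by simp
    qed
    also have "(\<Sum>c\<in>C. ln (a c)) / card C \<le> \<gamma> * (LINT x|\<mu>. (norm (G x))\<^sup>2) + separation_const (card C) (\<eta>/4) \<gamma>"
      unfolding a_def
    proof (rule separated_moser_trudinger[OF fC \<Omega>m mpos _ _ iu mean G])
      show "\<eta>/4 \<le> norm (x - y)" if "c \<in> C" "c' \<in> C" "c \<noteq> c'" "x \<in> \<Omega> c" "y \<in> \<Omega> c'" for c c' x y
      proof -
        have "3 * \<eta> / 4 \<le> dist c c'" using C(4) that by blast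
        moreover have "dist c c' \<le> dist c x + dist x y + dist y c'"
          by (meson add_mono_thms_linordered_semiring(3) dist_triangle order_trans)
        moreover have "dist c x < \<eta>/4" "dist c' y < \<eta>/4" using that by (auto simp: \<Omega>_def)
        ultimately show ?thesis by (simp add: dist_norm norm_minus_commute)
      qed
    qed (use \<eta> \<gamma>(1) C(2) in auto)
    also have "\<gamma> * (LINT x|\<mu>. (norm (G x))\<^sup>2) \<le> (1 / (4 * pi * real (min_cubature_size m)) + \<epsilon>) * (LINT x|\<mu>. (norm (G x))\<^sup>2)"
      by (intro mult_right_mono \<gamma>(2) integral_nonneg_AE) simp
    finally have "ln W \<le> (1 / (4 * pi * real (min_cubature_size m)) + \<epsilon>) * (LINT x|\<mu>. (norm (G x))\<^sup>2) + b"
      by (simp add: b_def C(2))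
    then show "integrable \<mu> (\<lambda>x. exp (2 * u x)) \<and>
      ln (LINT x|\<mu>. exp (2 * u x)) \<le> (1 / (4 * pi * real (min_cubature_size m)) + \<epsilon>)
           * (LINT x|\<mu>. (norm (weak_gradient u x))\<^sup>2) + b"
      using ie unfolding W_def G_def by blast
  qed
qed

end
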